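(* Let $\tilde{g}(n)$ denote the Landau--Okhotin function (defined in the context). Then $$\frac{(\log \tilde{g}(n))^3}{\tfrac14\, n(\log n)^2}\to 1 \quad \text{as } n\to\infty.$$ That is, $\log^3 \tilde{g}(n)\sim \frac14 n\log^2 n$.
   Context: $\log$ denotes the natural logarithm, and $\log^k x$ means $(\log x)^k$. For a positive integer $n$, consider finite arrays $(\pi_1,\ldots,\pi_k)$ of positive integers ($k\geq 1$ arbitrary) such that (i) $\pi_1+\cdots+\pi_k\leq n$, and (ii) there exist integers $f_1,\ldots,f_k$ such that the arithmetic progressions $f_i+\pi_i\mathbb{Z}$, $i=1,\ldots,k$, are pairwise disjoint. The Landau--Okhotin function $\tilde{g}(n)$ is the maximum of $\operatorname{lcm}(\pi_1,\ldots,\pi_k)$ over all such arrays. $X\sim Y$ means $X/Y\to 1$. *)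

theory Defs
  imports Complex_Main "HOL-Library.Disjoint_Sets"
begin

definition arith_prog :: "int \<Rightarrow> nat \<Rightarrow> int set" where
  "arith_prog a p = {a + int p * m | m. True}"

(* Disjointness is required for distinct indices, not merely for distinct progressions:
   one progression may not be used twice. *)
definition disjoint_realizable :: "nat list \<Rightarrow> bool" where
  "disjoint_realizable ps \<longleftrightarrow>
     (\<exists>f :: nat \<Rightarrow> int. disjoint_family_on (\<lambda>i. arith_prog (f i) (ps ! i)) {..<length ps})"

definition admissible_arrays :: "nat \<Rightarrow> nat list set" where
  "admissible_arrays n =
     {ps. ps \<noteq> [] \<and> (\<forall>p \<in> set ps. 0 < p) \<and> sum_list ps \<le> n \<and> disjoint_realizable ps}"

definition landau_okhotin :: "nat \<Rightarrow> nat" where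
  "landau_okhotin n = Max ((\<lambda>ps. Lcm (set ps)) ` admissible_arrays n)"

(* The following two facts show that the maximum is attained for every positive n;
   for n = 0 the value of landau_okhotin is unspecified. *)
lemma finite_admissible_arrays: "finite (admissible_arrays n)"
proof (rule finite_subset)
  show "admissible_arrays n \<subseteq> {ps. set ps \<subseteq> {..n} \<and> length ps \<le> n}"
  proof
    fix ps assume "ps \<in> admissible_arrays n"
    then have pos: "\<forall>p \<in> set ps. 0 < p" and le: "sum_list ps \<le> n"
      by (auto simp: admissible_arrays_def)
    have "length ps \<le> sum_list ps"
      using pos by (induction ps) auto
    moreover have "p \<le> n" if "p \<in> set ps" for p
      using member_le_sum_list[OF that] le by linarith
    ultimately show "ps \<in> {ps. set ps \<subseteq> {..n} \<and> length ps \<le> n}"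
      using le by auto
  qed
qed (rule finite_lists_length_le, simp)

lemma admissible_arrays_nonempty:
  assumes "0 < n"
  shows "admissible_arrays n \<noteq> {}"
proof -
  have "[1] \<in> admissible_arrays n"
    using assms by (auto simp: admissible_arrays_def disjoint_realizable_def disjoint_family_on_def)
  then show ?thesis by blast
qed

end

theory Submission
  imports Defs "HOL-Complex_Analysis.Complex_Analysis" "HOL-Number_Theory.Number_Theory" "HOL-Real_Asymp.Real_Asymp"
begin

text \<open>
  Progressions with periods \<open>m p * p\<close>, one for each prime \<open>p\<close> of a finite set, can be made
  disjoint as soon as essentially \<open>\<Sum> 1 / m p \<le> 1\<close>. Minimising the total length \<open>\<Sum> m p * p\<close> under this
  constraint gives \<open>m p\<close> proportional to \<open>1 / sqrt p\<close> and length \<open>(\<Sum> sqrt p)\<^sup>2\<close>; for the primes up to \<open>x\<close>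
  this is asymptotically \<open>4/9 * x\<^sup>3 / ln\<^sup>2 x\<close>, while the least common multiple has logarithm about \<open>x\<close>.
  Conversely, a product measure on the residues shows that, up to few primes, any disjoint
  family yields pairwise coprime \<open>q i\<close> with the constraint \<open>\<Sum> q i / \<pi> i \<le> 1 + o(1)\<close> on the periods \<open>\<pi> i\<close>, so that
  Cauchy-Schwarz gives \<open>(\<Sum> sqrt (q i))\<^sup>2 \<le> n (1 + o(1))\<close>. Both directions use the prime number theorem, which
  is proved by Newman's contour method applied to the function \<open>(\<psi>(u) - u) / u\<close>.
\<close>

section \<open>Newman's Tauberian theorem\<close>

text \<open>The constant comes from inverting \<open>n = 4/9 * x^3 / ln^2 x\<close>: then
  \<open>ln n\<close> is about \<open>3 * ln x\<close>, so \<open>n * ln^2 n\<close> is about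
  \<open>4 * x^3\<close>. For the upper bound the obstacle is that periods may share primes: such a
  prime can separate many progressions, while its power enters the lcm only once. A prime
  \<open>p\<close> dividing at most \<open>\<epsilon> * p\<close> of the periods can be neutralised
  by the choice of measure. The other primes are few: there are at most \<open>sqrt n\<close>
  progressions with at most \<open>log 2 n\<close> primes each, so the sum of these primes is at
  most \<open>sqrt n * log 2 n / \<epsilon>\<close>, and distinct integers with a small sum are few.
  With \<open>\<epsilon> = 1 / ln^2 n\<close> they cost \<open>n powr (1/4)\<close> up to
  logarithms, below the rate \<open>(n * ln^2 n) powr (1/3)\<close>. For the lower bound the
  \<open>m p\<close> must be integers and residue classes must really be allotted. Hence primes are
  grouped into \<open>J\<close> blocks on which \<open>sqrt p\<close> is nearly constant; the limit
  in \<open>x\<close> is taken for fixed \<open>J\<close>, and \<open>J\<close> is chosen large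
  according to the accuracy wanted. Newman's method is run on a series instead of an integral,
  because \<psi> is constant between integers.\<close>

text \<open>Split \<open>f z / z\<close> into the difference quotient \<open>h\<close>, which
  extends over 0 and integrates to 0 along the closed path in the convex set \<open>V\<close>, and
  \<open>f 0 / z\<close>. Each half contributes \<open>\<i> * pi\<close> for \<open>1/z\<close>,
  since \<open>Ln z\<close> and \<open>Ln (-z)\<close> are primitives on the two closed half-planes
  without 0. No winding number is computed, and the left half stays free: it will be a semicircle or
  three sides of a rectangle.\<close>

lemma cauchy_formula_semicircle:
  fixes f :: "complex \<Rightarrow> complex"
  assumes R: "R > 0" and V: "open V" "convex V" "0 \<in> V" and f: "f holomorphic_on V"
    and arc: "path_image (part_circlepath 0 R (-pi/2) (pi/2)) \<subseteq> V"
    and \<gamma>: "valid_path \<gamma>" "pathstart \<gamma> = \<i> * R" "pathfinish \<gamma> = - (\<i> * R)"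
    and left: "path_image \<gamma> \<subseteq> V \<inter> {z. Re z \<le> 0} - {0}"
  shows "contour_integral (part_circlepath 0 R (-pi/2) (pi/2)) (\<lambda>z. f z / z)
       + contour_integral \<gamma> (\<lambda>z. f z / z) = 2 * pi * \<i> * f 0"
proof -
  define A where "A = part_circlepath 0 R (-pi/2) (pi/2)"
  have A: "valid_path A" "pathstart A = - (\<i> * R)" "pathfinish A = \<i> * R"
    by (simp_all add: A_def exp_eq_polar cis.ctr complex_eq_iff)
  have AV: "path_image A \<subseteq> V" using arc by (simp add: A_def)
  have Apos: "path_image A \<subseteq> {z. Re z \<ge> 0} - {0}"
  proof
    fix z assume "z \<in> path_image A"
    then obtain t where t: "-pi/2 \<le> t" "t \<le> pi/2" and z: "z = R * exp (\<i> * t)"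
      by (auto simp: A_def path_image_part_circlepath closed_segment_eq_real_ivl split: if_splits)
    have "Re z = R * cos t" by (simp add: z exp_eq_polar Re_exp)
    moreover have "cos t \<ge> 0" using t by (intro cos_ge_zero) auto
    ultimately show "z \<in> {z. Re z \<ge> 0} - {0}" using R z by auto
  qed
  define h where "h z = (if z = 0 then deriv f 0 else (f z - f 0) / (z - 0))" for z
  have h: "h holomorphic_on V" unfolding h_def by (rule pole_lemma_open[OF f V(1)])
  have "(h has_contour_integral 0) (A +++ \<gamma>)"
    using AV left A \<gamma> by (intro Cauchy_theorem_convex_simple[OF h V(2)])
      (auto simp: path_image_join)
  moreover have hint: "h contour_integrable_on A" "h contour_integrable_on \<gamma>"
    using AV left A \<gamma> V h
    by (auto intro!: contour_integrable_holomorphic_simple[of h V])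
  ultimately have h0: "contour_integral A h + contour_integral \<gamma> h = 0"
    using A \<gamma> by (metis contour_integral_join contour_integral_unique)
  have "((\<lambda>z. 1/z) has_contour_integral (Ln (pathfinish A) - Ln (pathstart A))) A"
    by (rule contour_integral_primitive[where S = "{z. Re z \<ge> 0} - {0}"])
       (use Apos A in \<open>auto intro!: derivative_eq_intros simp: complex_nonpos_Reals_iff complex_eq_iff Re_divide Im_divide\<close>)
  hence Ainv: "((\<lambda>z. 1/z) has_contour_integral (\<i> * pi)) A"
    using R by (simp add: A Ln_times_of_real Ln_minus mult.commute[of \<i>])
  have "((\<lambda>z. 1/z) has_contour_integral (Ln (- pathfinish \<gamma>) - Ln (- pathstart \<gamma>))) \<gamma>"
    by (rule contour_integral_primitive[where S = "{z. Re z \<le> 0} - {0}" and f = "\<lambda>z. Ln (-z)"])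
       (use left \<gamma> in \<open>auto intro!: derivative_eq_intros simp: complex_nonpos_Reals_iff complex_eq_iff Re_divide Im_divide\<close>)
  hence ginv: "((\<lambda>z. 1/z) has_contour_integral (\<i> * pi)) \<gamma>"
    using R by (simp add: \<gamma> Ln_times_of_real Ln_minus mult.commute[of \<i>])
  have split: "((\<lambda>z. f z / z) has_contour_integral (contour_integral p h + f 0 * (\<i> * pi))) p"
    if "h contour_integrable_on p" "((\<lambda>z. 1/z) has_contour_integral (\<i> * pi)) p" "0 \<notin> path_image p" for p
  proof -
    have "((\<lambda>z. h z + f 0 * (1/z)) has_contour_integral (contour_integral p h + f 0 * (\<i> * pi))) p"
      using that by (intro has_contour_integral_add has_contour_integral_lmul has_contour_integral_integral)
    thus ?thesis
      by (rule has_contour_integral_eq) (use that in \<open>auto simp: h_def diff_divide_distrib\<close>)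
  qed
  have "contour_integral A (\<lambda>z. f z / z) = contour_integral A h + f 0 * (\<i> * pi)"
       "contour_integral \<gamma> (\<lambda>z. f z / z) = contour_integral \<gamma> h + f 0 * (\<i> * pi)"
    using split[OF hint(1) Ainv] split[OF hint(2) ginv] Apos left by (auto intro!: contour_integral_unique)
  thus ?thesis using h0 unfolding A_def[symmetric] by (simp add: algebra_simps)
qed


text \<open>On the circle \<open>1 / z = cnj z / R^2\<close>, so \<open>1 / z + z / R^2\<close>
  collapses to the real number \<open>2 * Re z / R^2\<close>. The factor \<open>Re z\<close> is what
  cancels the \<open>1 / Re z\<close> in the bounds for tails and partial sums.\<close>

lemma norm_newman_kernel:
  fixes z :: complex
  assumes "R > 0" "T > 0" "norm z = R"
  shows "norm (exp (z * of_real (ln T)) * (1 + z^2 / of_real (R^2)) / z) = T powr (Re z) * (2 * \<bar>Re z\<bar> / R^2)"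
proof -
  have z: "z \<noteq> 0" using assms by auto
  have R2: "of_real (R^2) = z * cnj z" using assms complex_norm_square[of z] by simp
  have "(1 + z^2 / of_real (R^2)) / z = (cnj z + z) / of_real (R^2)"
    using z by (simp add: R2 del: of_real_power) (simp add: field_simps power2_eq_square)
  also have "cnj z + z = of_real (2 * Re z)" by (simp add: complex_eq_iff)
  finally have "(1 + z^2 / of_real (R^2)) / z = of_real (2 * Re z / of_real (R^2))" by simp
  hence "norm ((1 + z^2 / of_real (R^2)) / z) = 2 * \<bar>Re z\<bar> / R^2" by (simp add: norm_divide norm_mult norm_power)
  moreover have "norm (exp (z * of_real (ln T))) = T powr Re z" using assms by (simp add: powr_def)
  ultimately show ?thesis unfolding times_divide_eq_right[symmetric] norm_mult by (simp only:)
qed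

text \<open>The bound on \<open>e k\<close> is \<open>C\<close> times the integral of
  \<open>u powr (- Re z - 1)\<close> over \<open>[k + 1, k + 2]\<close>, so that sums of it
  telescope. The remainder \<open>F - S N\<close> is estimated on the right semicircle, the entire
  function \<open>S N\<close> on the left one, and \<open>F\<close> on a path slightly left of the
  imaginary axis; on the semicircles the dependence on \<open>N\<close> cancels against the
  kernel.\<close>

lemma newman_tauberian:
  fixes e :: "nat \<Rightarrow> complex \<Rightarrow> complex"
  assumes hol: "\<And>k. e k holomorphic_on UNIV" and C: "C \<ge> 0"
    and bound: "\<And>k z. Re z \<noteq> 0 \<Longrightarrow>
      norm (e k z) \<le> C * ((real k + 1) powr (- Re z) - (real k + 2) powr (- Re z)) / Re z"
    and U: "open U" "{z. Re z \<ge> 0} \<subseteq> U" "F holomorphic_on U"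
    and F: "\<And>z. Re z > 0 \<Longrightarrow> (\<lambda>k. e k z) sums F z"
  shows "(\<lambda>k. e k 0) sums F 0"
proof -
  define S where "S N z = (\<Sum>k<N. e k z)" for N z
  have S: "S N holomorphic_on A" for N A
    unfolding S_def by (intro holomorphic_intros holomorphic_on_subset[OF hol]) auto
  define D where "D N x = (real N + 1) powr (-x)" for N x
  have bound': "norm (e k z) \<le> C * (D k (Re z) - D (Suc k) (Re z)) / Re z" if "Re z \<noteq> 0" for k z
    using bound[OF that, of k] by (simp add: D_def add_ac)
  have tail: "norm (F z - S N z) \<le> C * D N (Re z) / Re z" if x: "Re z > 0" for z N
  proof -
    have s: "(\<lambda>k. e (k + N) z) sums (F z - S N z)"
      unfolding S_def by (rule sums_split_initial_segment[OF F[OF x]])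
    have "(\<lambda>k. D (k + N) (Re z)) \<longlonglongrightarrow> 0"
      unfolding D_def using x by real_asymp
    from telescope_sums'[OF this] have "(\<lambda>k. D (k+N) (Re z) - D (Suc k + N) (Re z)) sums D N (Re z)"
      by simp
    from sums_mult[OF this, of "C / Re z"]
    have t: "(\<lambda>k. C * (D (k+N) (Re z) - D (Suc (k + N)) (Re z)) / Re z) sums (C * D N (Re z) / Re z)"
      by (simp add: mult_ac)
    have "norm (\<Sum>k. e (k + N) z) \<le> (\<Sum>k. C * (D (k+N) (Re z) - D (Suc (k + N)) (Re z)) / Re z)"
      using bound' x sums_summable[OF t] by (intro norm_suminf_le) auto
    thus ?thesis using sums_unique[OF s] sums_unique[OF t] by simp
  qed
  have part: "norm (S N z) \<le> C * D N (Re z) / (- Re z)" if x: "Re z < 0" for z N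
  proof -
    have "norm (S N z) \<le> (\<Sum>k<N. norm (e k z))" unfolding S_def by (rule norm_sum)
    also have "\<dots> \<le> (\<Sum>k<N. C * (D k (Re z) - D (Suc k) (Re z)) / Re z)"
      using bound' x by (intro sum_mono) auto
    also have "\<dots> = C / Re z * (\<Sum>k<N. D k (Re z) - D (Suc k) (Re z))" by (simp add: sum_distrib_left)
    also have "\<dots> = C * (D N (Re z) - 1) / (- Re z)"
      by (subst sum_lessThan_telescope') (simp add: D_def right_diff_distrib diff_divide_distrib)
    also have "\<dots> \<le> C * D N (Re z) / (- Re z)"
      using x C by (intro divide_right_mono mult_left_mono) auto
    finally show ?thesis .
  qed
  have "\<forall>\<^sub>F N in sequentially. norm (F 0 - S N 0) < \<epsilon>" if eps: "\<epsilon> > 0" for \<epsilon>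
  proof -
    \<comment> \<open>Both semicircles together contribute \<open>4 * pi * C / R\<close> to
      \<open>2 * pi\<close> times the error, hence \<open>2 * C / R\<close> to the error itself,
      which must stay below \<open>\<epsilon> / 3\<close>.\<close>
    define R where "R = 6 * C / \<epsilon> + 2"
    have R2: "R \<ge> 2" using C eps by (simp add: R_def)
    have CR: "2 * C / R < \<epsilon> / 3"
      using C eps by (simp add: R_def field_simps add_pos_nonneg add_nonneg_pos)
    \<comment> \<open>Compactness of this segment of the imaginary axis gives one width
      \<open>\<delta>1\<close> by which the domain of \<open>F\<close> extends to the left.\<close>
    define K where "K = {z. Re z = 0 \<and> \<bar>Im z\<bar> \<le> R + 1}"
    have "K = closed_segment (Complex 0 (-(R+1))) (Complex 0 (R+1))"
      using R2 by (auto simp: K_def closed_segment_same_Re closed_segment_eq_real_ivl)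
    hence "compact K" by simp
    moreover have "K \<subseteq> U" using U(2) by (auto simp: K_def)
    ultimately obtain \<delta>1 where d1: "\<delta>1 > 0" "(\<Union>x\<in>K. ball x \<delta>1) \<subseteq> U"
      using compact_subset_open_imp_ball_epsilon_subset U(1) by metis
    define V where "V = {z. Re z > -\<delta>1} \<inter> ({z. Im z < R + 1} \<inter> {z. Im z > -(R+1)})"
    have V: "open V" "convex V" unfolding V_def
      by (intro open_Int convex_Int open_halfspace_Re_gt open_halfspace_Im_lt open_halfspace_Im_gt
            convex_halfspace_Re_gt convex_halfspace_Im_lt convex_halfspace_Im_gt)+
    have VU: "V \<subseteq> U"
    proof
      fix z assume z: "z \<in> V"
      show "z \<in> U"
      proof (cases "Re z \<ge> 0")
        case True thus ?thesis using U by auto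
      next
        case False
        hence "Complex 0 (Im z) \<in> K" using z by (auto simp: K_def V_def)
        moreover have "z \<in> ball (Complex 0 (Im z)) \<delta>1"
          using z False by (simp add: V_def dist_norm cmod_def)
        ultimately show ?thesis using d1 by blast
      qed
    qed
    have FV: "F holomorphic_on V" using U VU holomorphic_on_subset by blast
    \<comment> \<open>The bound \<open>M\<close> for \<open>F\<close> is taken on a rectangle
      independent of \<open>\<delta>\<close>, so that \<open>\<delta>\<close> may depend on
      \<open>M\<close>.\<close>
    define Q where "Q = cbox (Complex (-\<delta>1/2) (-R)) (Complex 0 R)"
    have QV: "Q \<subseteq> V" using d1 by (auto simp: Q_def V_def in_cbox_complex_iff)
    have "bounded (F ` Q)"
      using holomorphic_on_imp_continuous_on[OF holomorphic_on_subset[OF FV QV]]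
      by (intro compact_imp_bounded compact_continuous_image) (auto simp: Q_def)
    then obtain M where M: "M > 0" "\<And>z. z \<in> Q \<Longrightarrow> norm (F z) \<le> M"
      by (auto simp: bounded_pos)
    \<comment> \<open>The bound used for the horizontal sides does not decay in \<open>N\<close>;
      the third constraint makes it small through their length \<open>\<delta>\<close>.\<close>
    define \<delta> where "\<delta> = min (min (\<delta>1 / 2) 1) (\<epsilon> / (3 * M))"
    have d: "\<delta> > 0" "\<delta> \<le> \<delta>1 / 2" "\<delta> \<le> 1" "M * \<delta> \<le> \<epsilon> / 3"
    proof -
      have "M * \<delta> \<le> M * (\<epsilon> / (3 * M))" using M by (intro mult_left_mono) (auto simp: \<delta>_def)
      thus "M * \<delta> \<le> \<epsilon> / 3" using M by simp
    qed (use d1 eps M in \<open>auto simp: \<delta>_def\<close>)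
    define A where "A = part_circlepath 0 R (-pi/2) (pi/2)"
    define B where "B = part_circlepath 0 R (pi/2) (3*pi/2)"
    define L1 L2 L3 where "L1 = linepath (Complex 0 R) (Complex (-\<delta>) R)"
      and "L2 = linepath (Complex (-\<delta>) R) (Complex (-\<delta>) (-R))"
      and "L3 = linepath (Complex (-\<delta>) (-R)) (Complex 0 (-R))"
    define G where "G = L1 +++ L2 +++ L3"
    have im1: "path_image L1 = {z. Im z = R \<and> -\<delta> \<le> Re z \<and> Re z \<le> 0}"
      and im2: "path_image L2 = {z. Re z = -\<delta> \<and> -R \<le> Im z \<and> Im z \<le> R}"
      and im3: "path_image L3 = {z. Im z = -R \<and> -\<delta> \<le> Re z \<and> Re z \<le> 0}"
      using d R2 by (auto simp: L1_def L2_def L3_def closed_segment_same_Re closed_segment_same_Im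
                       closed_segment_eq_real_ivl)
    have imG: "path_image G = path_image L1 \<union> (path_image L2 \<union> path_image L3)"
      by (simp add: G_def path_image_join L1_def L2_def L3_def)
    have GQ: "path_image G \<subseteq> Q"
      using d R2 unfolding imG im1 im2 im3 by (auto simp: Q_def in_cbox_complex_iff)
    have G: "valid_path G" "pathstart G = \<i> * R" "pathfinish G = -(\<i> * R)"
      by (auto simp: G_def L1_def L2_def L3_def complex_eq_iff intro!: valid_path_join)
    have Gleft: "path_image G \<subseteq> {z. Re z \<le> 0} - {0}"
      using d R2 unfolding imG im1 im2 im3 by auto
    have B: "valid_path B" "pathstart B = \<i> * R" "pathfinish B = -(\<i> * R)"
    proof -
      have c: "cos (3 * pi / 2) = 0" "sin (3 * pi / 2) = -1"
        using cos_3over2_pi sin_3over2_pi by (simp_all add: mult.commute)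
      show "valid_path B" "pathstart B = \<i> * R" "pathfinish B = -(\<i> * R)"
        by (simp_all add: B_def exp_eq_polar cis.ctr complex_eq_iff c)
    qed
    have imA: "norm z = R \<and> Re z \<ge> 0" if "z \<in> path_image A" for z
    proof -
      from that obtain t where t: "-pi/2 \<le> t" "t \<le> pi/2" and z: "z = R * exp (\<i> * t)"
        by (auto simp: A_def path_image_part_circlepath closed_segment_eq_real_ivl split: if_splits)
      have "cos t \<ge> 0" using t by (intro cos_ge_zero) auto
      thus ?thesis using R2 by (simp add: z norm_mult Re_exp)
    qed
    have imB: "norm z = R \<and> Re z \<le> 0" if "z \<in> path_image B" for z
    proof -
      from that obtain t where t: "pi/2 \<le> t" "t \<le> 3*pi/2" and z: "z = R * exp (\<i> * t)"
        by (auto simp: B_def path_image_part_circlepath closed_segment_eq_real_ivl split: if_splits)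
      have "cos (t - pi) \<ge> 0" using t by (intro cos_ge_zero) auto
      hence "cos t \<le> 0" by (simp add: cos_diff)
      thus ?thesis using R2 by (simp add: z norm_mult Re_exp mult_nonneg_nonpos)
    qed
    have AV: "path_image A \<subseteq> V"
    proof
      fix z assume "z \<in> path_image A"
      from imA[OF this] show "z \<in> V" using abs_Im_le_cmod[of z] d1 by (auto simp: V_def)
    qed
    \<comment> \<open>Newman's kernel: since \<open>g N 0 = 1\<close>, the Cauchy formula still
      returns the value at 0.\<close>
    define g where "g N z = exp (z * of_real (ln (real N + 1))) * (1 + z^2 / of_real (R^2))" for N and z :: complex
    have g: "g N holomorphic_on X" for N X
      unfolding g_def using R2 by (auto intro!: holomorphic_intros)
    define H where "H N = contour_integral G (\<lambda>z. F z * g N z / z)" for N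
    have main: "norm (2 * pi * \<i> * (F 0 - S N 0)) \<le> 4 * pi * C / R + norm (H N)" for N
    proof -
      have nz: "0 \<notin> path_image A" "0 \<notin> path_image B" "0 \<notin> path_image G"
        using imA imB R2 Gleft by fastforce+
      have g0: "g N 0 = 1" by (simp add: g_def)
      have V0: "0 \<in> V" using d1 R2 by (simp add: V_def)
      have hol1: "(\<lambda>z. (F z - S N z) * g N z) holomorphic_on V"
        by (intro holomorphic_intros FV S g)
      have hol2: "(\<lambda>z. S N z * g N z) holomorphic_on UNIV" by (intro holomorphic_intros S g)
      have lB: "path_image B \<subseteq> UNIV \<inter> {z. Re z \<le> 0} - {0}" using imB nz by auto
      have lG: "path_image G \<subseteq> V \<inter> {z. Re z \<le> 0} - {0}" using GQ QV Gleft by auto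
      hence lG': "path_image G \<subseteq> UNIV \<inter> {z. Re z \<le> 0} - {0}" by auto
      have R0: "R > 0" using R2 by simp
      note AV' = AV[unfolded A_def]
      have eq1: "contour_integral A (\<lambda>z. (F z - S N z) * g N z / z)
          + contour_integral G (\<lambda>z. (F z - S N z) * g N z / z) = 2 * pi * \<i> * (F 0 - S N 0)"
        using cauchy_formula_semicircle[OF R0 V V0 hol1 AV' G lG] by (simp add: A_def g0)
      \<comment> \<open>\<open>S N\<close> is entire, so its integral over \<open>G\<close> equals
        that over the semicircle \<open>B\<close>, where \<open>norm_newman_kernel\<close>
        applies.\<close>
      have eq2: "contour_integral A (\<lambda>z. S N z * g N z / z)
          + contour_integral G (\<lambda>z. S N z * g N z / z) = 2 * pi * \<i> * S N 0"
        using cauchy_formula_semicircle[OF R0 open_UNIV convex_UNIV UNIV_I hol2 subset_UNIV G lG']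
        by (simp add: A_def g0)
      have eq3: "contour_integral A (\<lambda>z. S N z * g N z / z)
          + contour_integral B (\<lambda>z. S N z * g N z / z) = 2 * pi * \<i> * S N 0"
        using cauchy_formula_semicircle[OF R0 open_UNIV convex_UNIV UNIV_I hol2 subset_UNIV B lB]
        by (simp add: A_def g0)
      have conS: "continuous_on X (S N)" "continuous_on X (g N)" for X
        using S g holomorphic_on_imp_continuous_on by blast+
      have conF: "continuous_on V F" using FV holomorphic_on_imp_continuous_on by blast
      have int1: "(\<lambda>z. F z * g N z / z) contour_integrable_on G"
        using G GQ QV V nz
        by (intro contour_integrable_holomorphic_simple[of _ "V - {0}"] holomorphic_intros
              holomorphic_on_subset[OF FV] g) auto
      have int2: "(\<lambda>z. S N z * g N z / z) contour_integrable_on G"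
        using G nz by (intro contour_integrable_holomorphic_simple[of _ "-{0}"] holomorphic_intros S g) auto
      have int3: "(\<lambda>z. S N z * g N z / z) contour_integrable_on B"
        using nz unfolding B_def
        by (intro contour_integrable_continuous_part_circlepath continuous_intros conS) auto
      have int4: "(\<lambda>z. (F z - S N z) * g N z / z) contour_integrable_on A"
        using nz AV unfolding A_def
        by (intro contour_integrable_continuous_part_circlepath continuous_intros conS
              continuous_on_subset[OF conF]) auto
      have eq4: "contour_integral G (\<lambda>z. (F z - S N z) * g N z / z) =
          H N - contour_integral G (\<lambda>z. S N z * g N z / z)"
        unfolding H_def by (subst contour_integral_diff[OF int1 int2, symmetric])
          (simp add: algebra_simps diff_divide_distrib)
      have "2 * pi * \<i> * (F 0 - S N 0) = contour_integral A (\<lambda>z. (F z - S N z) * g N z / z)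
          - contour_integral B (\<lambda>z. S N z * g N z / z) + H N"
      proof -
        have "contour_integral G (\<lambda>z. S N z * g N z / z) = contour_integral B (\<lambda>z. S N z * g N z / z)"
          by (rule add_left_imp_eq[OF trans[OF eq2 eq3[symmetric]]])
        thus ?thesis unfolding eq1[symmetric] eq4 by (simp only: add_diff_eq diff_add_eq)
      qed
      hence "norm (2 * pi * \<i> * (F 0 - S N 0)) \<le> norm (contour_integral A (\<lambda>z. (F z - S N z) * g N z / z))
          + norm (contour_integral B (\<lambda>z. S N z * g N z / z)) + norm (H N)"
        by (simp only:) (intro norm_triangle_le add_mono norm_triangle_ineq4 order_refl)
      moreover have "norm (contour_integral A (\<lambda>z. (F z - S N z) * g N z / z)) \<le> 2 * C / R^2 * R * \<bar>pi/2 - (-pi/2)\<bar>"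
        unfolding A_def
      proof (rule contour_integral_bound_part_circlepath)
        fix z assume "z \<in> path_image (part_circlepath 0 R (-pi/2) (pi/2))"
        hence z: "norm z = R" "Re z \<ge> 0" using imA by (auto simp: A_def)
        have k: "norm (g N z / z) = (real N + 1) powr (Re z) * (2 * \<bar>Re z\<bar> / R^2)"
          unfolding g_def by (rule norm_newman_kernel) (use R2 z in auto)
        show "norm ((F z - S N z) * g N z / z) \<le> 2 * C / R^2"
        proof (cases "Re z = 0")
          case True
          hence "g N z / z = 0" using k by simp
          thus ?thesis using C by auto
        next
          case False
          have "norm ((F z - S N z) * (g N z / z)) \<le> (C * D N (Re z) / Re z) * ((real N + 1) powr (Re z) * (2 * \<bar>Re z\<bar> / R^2))"
            unfolding norm_mult k using False z by (intro mult_right_mono tail) auto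
          also have "\<dots> = 2 * C / R^2" using False z
            by (simp add: D_def field_simps powr_minus)
          finally show ?thesis by simp
        qed
      qed (use int4 C R2 in \<open>auto simp: A_def\<close>)
      moreover have "norm (contour_integral B (\<lambda>z. S N z * g N z / z)) \<le> 2 * C / R^2 * R * \<bar>3*pi/2 - pi/2\<bar>"
        unfolding B_def
      proof (rule contour_integral_bound_part_circlepath)
        fix z assume "z \<in> path_image (part_circlepath 0 R (pi/2) (3*pi/2))"
        hence z: "norm z = R" "Re z \<le> 0" using imB by (auto simp: B_def)
        have k: "norm (g N z / z) = (real N + 1) powr (Re z) * (2 * \<bar>Re z\<bar> / R^2)"
          unfolding g_def by (rule norm_newman_kernel) (use R2 z in auto)
        show "norm (S N z * g N z / z) \<le> 2 * C / R^2"
        proof (cases "Re z = 0")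
          case True
          hence "g N z / z = 0" using k by simp
          thus ?thesis using C by auto
        next
          case False
          have "norm (S N z * (g N z / z)) \<le> (C * D N (Re z) / (- Re z)) * ((real N + 1) powr (Re z) * (2 * \<bar>Re z\<bar> / R^2))"
            unfolding norm_mult k using False z by (intro mult_right_mono part) (auto intro!: divide_nonpos_nonneg mult_nonneg_nonpos)
          also have "\<dots> = 2 * C / R^2" using False z
            by (simp add: D_def field_simps powr_minus)
          finally show ?thesis by simp
        qed
      qed (use int3 C R2 in \<open>auto simp: B_def\<close>)
      moreover have "2 * C / R^2 * R * \<bar>pi/2 - (-pi/2)\<bar> + 2 * C / R^2 * R * \<bar>3*pi/2 - pi/2\<bar> = 4 * pi * C / R"
        using R2 by (simp add: field_simps power2_eq_square)
      ultimately show ?thesis by linarith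
    qed
    have Hb: "norm (H N) \<le> 6 * M * \<delta> + (real N + 1) powr (-\<delta>) * (M * (1/\<delta> + 3) * (2 * R))" for N
    proof -
      define f where "f = (\<lambda>z. F z * g N z / z)"
      have conf: "continuous_on (path_image G) f"
        unfolding f_def using Gleft GQ QV holomorphic_on_imp_continuous_on[OF FV] holomorphic_on_imp_continuous_on[OF g]
        by (intro continuous_intros) (auto intro: continuous_on_subset)
      have int0: "f contour_integrable_on linepath a b" if "path_image (linepath a b) \<subseteq> path_image G" for a b
        using that by (intro contour_integrable_continuous_linepath continuous_on_subset[OF conf]) simp
      have int: "f contour_integrable_on L1" "f contour_integrable_on L2" "f contour_integrable_on L3"
        unfolding L1_def L2_def L3_def by (rule int0, unfold imG L1_def L2_def L3_def, blast)+
      have H: "H N = contour_integral L1 f + (contour_integral L2 f + contour_integral L3 f)"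
        unfolding H_def f_def[symmetric] G_def
        using int by (simp add: contour_integrable_join L1_def L2_def L3_def valid_path_join)
      have fle: "norm (f z) \<le> (real N + 1) powr (Re z) * (M * (1 / norm z + norm z / R^2))" if z: "z \<in> path_image G" for z
      proof -
        have z0: "z \<noteq> 0" using z Gleft by auto
        have "f z = F z * exp (z * of_real (ln (real N + 1))) * (1 / z + z / of_real (R^2))"
          unfolding f_def g_def using z0 by (simp add: field_simps power2_eq_square)
        hence "norm (f z) = norm (F z) * (real N + 1) powr (Re z) * norm (1 / z + z / of_real (R^2))"
          by (simp add: norm_mult powr_def)
        also have "\<dots> \<le> M * (real N + 1) powr (Re z) * (1 / norm z + norm z / R^2)"
        proof (intro mult_mono)
          have "norm (1 / z + z / of_real (R^2)) \<le> norm (1 / z) + norm (z / of_real (R^2))" by (rule norm_triangle_ineq)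
          also have "\<dots> = 1 / norm z + norm z / R^2" by (simp add: norm_divide norm_power)
          finally show "norm (1 / z + z / of_real (R^2)) \<le> 1 / norm z + norm z / R^2" .
        qed (use M z GQ in auto)
        finally show ?thesis by (simp add: mult_ac)
      qed
      have nle: "norm z / R^2 \<le> 2" if z: "z \<in> path_image G" for z
      proof -
        have "\<bar>Re z\<bar> \<le> 1" "\<bar>Im z\<bar> \<le> R" using z d R2 unfolding imG im1 im2 im3 by auto
        hence "norm z \<le> 1 + R" using cmod_le[of z] by linarith
        also have "\<dots> \<le> 2 * R^2" using R2 mult_right_mono[of 1 R R] unfolding power2_eq_square by linarith
        finally show ?thesis using R2 by (simp add: field_simps)
      qed
      have hor: "norm (f z) \<le> 3 * M" if z: "z \<in> path_image L1 \<union> path_image L3" for z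
      proof -
        have "\<bar>Im z\<bar> = R" "Re z \<le> 0" using z R2 unfolding im1 im3 by auto
        hence "norm z \<ge> R" using abs_Im_le_cmod[of z] by simp
        hence "1 / norm z \<le> 1" using R2 by (intro divide_le_eq_1_pos[THEN iffD2]) linarith+
        moreover have "(real N + 1) powr (Re z) \<le> (real N + 1) powr 0" using \<open>Re z \<le> 0\<close>
          by (intro powr_mono) auto
        hence "(real N + 1) powr (Re z) \<le> 1" by simp
        ultimately have "(real N + 1) powr (Re z) * (M * (1 / norm z + norm z / R^2)) \<le> 1 * (M * (1 + 2))"
          using nle[of z] z M by (intro mult_mono add_mono) (auto simp: imG)
        thus ?thesis using fle[of z] z by (auto simp: imG)
      qed
      have "norm (contour_integral L1 f) \<le> 3 * M * norm (Complex (-\<delta>) R - Complex 0 R)"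
        using int hor M unfolding L1_def by (intro contour_integral_bound_linepath) auto
      hence b1: "norm (contour_integral L1 f) \<le> 3 * M * \<delta>" using d by (simp add: cmod_def)
      have "norm (contour_integral L3 f) \<le> 3 * M * norm (Complex 0 (-R) - Complex (-\<delta>) (-R))"
        using int hor M unfolding L3_def by (intro contour_integral_bound_linepath) auto
      hence b3: "norm (contour_integral L3 f) \<le> 3 * M * \<delta>" using d by (simp add: cmod_def)
      have "norm (contour_integral L2 f) \<le> ((real N + 1) powr (-\<delta>) * (M * (1/\<delta> + 3)))
               * norm (Complex (-\<delta>) (-R) - Complex (-\<delta>) R)"
        unfolding L2_def
      proof (rule contour_integral_bound_linepath)
        fix z assume "z \<in> closed_segment (Complex (- \<delta>) R) (Complex (- \<delta>) (- R))"
        hence z: "z \<in> path_image L2" by (simp add: L2_def)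
        hence zG: "z \<in> path_image G" by (simp add: imG)
        have re: "Re z = -\<delta>" using z im2 by auto
        hence "norm z \<ge> \<delta>" using abs_Re_le_cmod[of z] d by simp
        hence "1 / norm z \<le> 1 / \<delta>" using d by (simp add: frac_le)
        hence "(real N + 1) powr (Re z) * (M * (1 / norm z + norm z / R^2)) \<le> (real N + 1) powr (-\<delta>) * (M * (1 / \<delta> + 3))"
          unfolding re using nle[OF zG] M by (intro mult_left_mono add_mono) auto
        thus "norm (f z) \<le> (real N + 1) powr (-\<delta>) * (M * (1/\<delta> + 3))" using fle[OF zG] by linarith
      qed (use int M d in \<open>auto simp: L2_def\<close>)
      hence b2: "norm (contour_integral L2 f) \<le> (real N + 1) powr (-\<delta>) * (M * (1/\<delta> + 3) * (2 * R))"
        using R2 by (simp add: cmod_eq_Im mult.assoc)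
      have "norm (H N) \<le> norm (contour_integral L1 f) + (norm (contour_integral L2 f) + norm (contour_integral L3 f))"
        unfolding H by (intro norm_triangle_le add_left_mono norm_triangle_ineq)
      thus ?thesis using b1 b2 b3 by linarith
    qed
    have "(\<lambda>N. (real N + 1) powr (-\<delta>) * (M * (1/\<delta> + 3) * (2 * R))) \<longlonglongrightarrow> 0"
      using d(1) by (intro tendsto_mult_left_zero) real_asymp
    hence "\<forall>\<^sub>F N in sequentially. (real N + 1) powr (-\<delta>) * (M * (1/\<delta> + 3) * (2 * R)) < \<epsilon> / 3"
      using eps by (intro order_tendstoD) auto
    thus ?thesis
    proof eventually_elim
      case (elim N)
      have "2 * pi * norm (F 0 - S N 0) = norm (2 * pi * \<i> * (F 0 - S N 0))" by (simp add: norm_mult)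
      also have "\<dots> \<le> 4 * pi * C / R + (6 * M * \<delta> + \<epsilon> / 3)" using main[of N] Hb[of N] elim by linarith
      also have "\<dots> \<le> 2 * pi * (2 * C / R) + 2 * pi * (M * \<delta>) + 2 * pi * (\<epsilon> / 3)"
      proof -
        have "6 * (M * \<delta>) \<le> 2 * pi * (M * \<delta>)" using pi_gt3 M d by (intro mult_right_mono) auto
        moreover have "1 * (\<epsilon> / 3) \<le> 2 * pi * (\<epsilon> / 3)" using pi_gt3 eps by (intro mult_right_mono) auto
        moreover have "4 * pi * C / R = 2 * pi * (2 * C / R)" "6 * M * \<delta> = 6 * (M * \<delta>)" by simp_all
        ultimately show ?thesis by linarith
      qed
      also have "\<dots> = 2 * pi * (2 * C / R + M * \<delta> + \<epsilon> / 3)" by (simp add: algebra_simps)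
      also have "\<dots> < 2 * pi * \<epsilon>" using CR d by (intro mult_strict_left_mono) auto
      finally show ?case by simp
    qed
  qed
  hence "(\<lambda>N. S N 0) \<longlonglongrightarrow> F 0"
    by (intro metric_LIMSEQ_I) (auto simp: dist_norm norm_minus_commute eventually_sequentially)
  thus ?thesis unfolding S_def sums_def .
qed

section \<open>Chebyshev bounds and Dirichlet series\<close>

definition chebyshev_psi :: "nat \<Rightarrow> real" where
  "chebyshev_psi n = (\<Sum>d=1..n. mangoldt d)"

text \<open>Exchange of summation: \<open>d\<close> divides \<open>n div d\<close> of the numbers up
  to \<open>n\<close>. In the induction, passing to \<open>Suc n\<close> raises
  \<open>n div d\<close> precisely for the divisors of \<open>Suc n\<close>.\<close>

lemma sum_divisors_eq_sum_div:
  fixes f :: "nat \<Rightarrow> 'a::comm_semiring_1"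
  shows "(\<Sum>m=1..n. \<Sum>d | d dvd m. f d) = (\<Sum>d=1..n. f d * of_nat (n div d))"
proof (induction n)
  case (Suc n)
  have "(\<Sum>d=1..Suc n. f d * of_nat (Suc n div d)) =
        (\<Sum>d=1..Suc n. f d * of_nat (n div d) + (if d dvd Suc n then f d else 0))"
    by (intro sum.cong refl) (auto simp: div_Suc mod_eq_0_iff_dvd distrib_left add.commute)
  also have "\<dots> = (\<Sum>d=1..Suc n. f d * of_nat (n div d)) + (\<Sum>d | d \<in> {1..Suc n} \<and> d dvd Suc n. f d)"
    by (simp only: sum.distrib sum.inter_filter[symmetric] finite_atLeastAtMost)
  also have "{d. d \<in> {1..Suc n} \<and> d dvd Suc n} = {d. d dvd Suc n}"
    by (auto dest: dvd_imp_le simp: Suc_le_eq intro: dvd_pos_nat[of "Suc n"])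
  also have "(\<Sum>d=1..Suc n. f d * of_nat (n div d)) = (\<Sum>d=1..n. f d * of_nat (n div d))" by simp
  finally show ?case using Suc by simp
qed simp

text \<open>Legendre's formula, from \<open>ln m\<close> being the divisor sum of the von Mangoldt
  function.\<close>

lemma ln_fact_eq_sum_mangoldt:
  "ln (fact n) = (\<Sum>d=1..n. mangoldt d * real (n div d))"
proof -
  have "ln (fact n :: real) = (\<Sum>m=1..n. ln (real m))"
    by (subst fact_prod, subst of_nat_prod, subst ln_prod) auto
  also have "\<dots> = (\<Sum>m=1..n. \<Sum>d | d dvd m. mangoldt d)"
    by (intro sum.cong refl) (simp add: mangoldt_sum)
  finally show ?thesis by (simp only: sum_divisors_eq_sum_div)
qed

text \<open>The central binomial coefficient is at most \<open>2 ^ (2 * n)\<close>, and its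
  logarithm weighs \<open>mangoldt d\<close> by \<open>2 * n div d - 2 * (n div d)\<close>. This
  weight is never negative and equals 1 for \<open>n < d \<le> 2 * n\<close>.\<close>

lemma chebyshev_psi_double: "chebyshev_psi (2 * n) \<le> chebyshev_psi n + 2 * real n * ln 2"
proof -
  have n1: "ln (fact n) = (\<Sum>d=1..2*n. mangoldt d * real (n div d))"
    unfolding ln_fact_eq_sum_mangoldt by (rule sum.mono_neutral_left) auto
  have split: "{1..2*n} = {1..n} \<union> {n<..2*n}" by auto
  have "chebyshev_psi (2*n) - chebyshev_psi n = (\<Sum>d\<in>{n<..2*n}. mangoldt d)"
    unfolding chebyshev_psi_def split by (subst sum.union_disjoint) auto
  also have "\<dots> = (\<Sum>d\<in>{n<..2*n}. mangoldt d * (real (2*n div d) - 2 * real (n div d)))"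
  proof (intro sum.cong refl)
    fix d assume d: "d \<in> {n<..2*n}"
    have "2 * n div d = 1" using d by (intro div_nat_eqI) auto
    thus "mangoldt d = mangoldt d * (real (2*n div d) - 2 * real (n div d))" using d by simp
  qed
  also have "\<dots> \<le> (\<Sum>d=1..2*n. mangoldt d * (real (2*n div d) - 2 * real (n div d)))"
  proof (intro sum_mono2 mult_nonneg_nonneg mangoldt_nonneg)
    fix d assume "d \<in> {1..2*n} - {n<..2*n}"
    have "2 * (n div d) \<le> 2 * n div d"
      using div_times_less_eq_dividend[of n d] by (cases "d = 0") (auto simp: less_eq_div_iff_mult_less_eq)
    thus "0 \<le> real (2*n div d) - 2 * real (n div d)" by linarith
  qed auto
  also have "\<dots> = ln (fact (2*n)) - 2 * ln (fact n)"
    unfolding ln_fact_eq_sum_mangoldt[of "2*n"] n1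
    by (simp only: sum_distrib_left sum_subtractf[symmetric] algebra_simps)
  also have "\<dots> = ln (real ((2*n) choose n))"
    by (simp add: binomial_fact ln_div ln_mult)
  also have "\<dots> \<le> ln (real (2 ^ (2*n)))"
    by (subst ln_le_cancel_iff) (use binomial_le_pow2[of "2*n" n] in \<open>auto simp del: of_nat_power\<close>)
  also have "\<dots> = 2 * real n * ln 2" by (simp add: ln_realpow)
  finally show ?thesis by simp
qed

lemma chebyshev_psi_mono: "m \<le> n \<Longrightarrow> chebyshev_psi m \<le> chebyshev_psi n"
  unfolding chebyshev_psi_def by (intro sum_mono2) (auto simp: mangoldt_nonneg)

lemma chebyshev_psi_nonneg: "chebyshev_psi n \<ge> 0"
  unfolding chebyshev_psi_def by (intro sum_nonneg mangoldt_nonneg)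

lemma chebyshev_psi_Suc: "chebyshev_psi (Suc n) = chebyshev_psi n + mangoldt (Suc n)"
  by (simp add: chebyshev_psi_def)

text \<open>Iterated halving with upward rounding. The constant 5 leaves enough room over
  \<open>2 * ln 2\<close> that the rounding is absorbed already at \<open>n = 2\<close>:
  \<open>(n + 1) * (5/2 + 25/36) \<le> 5 * n\<close>.\<close>

lemma chebyshev_psi_le: "chebyshev_psi n \<le> 5 * real n"
proof (induction n rule: less_induct)
  case (less n)
  consider "n = 0" | "n = 1" | "n \<ge> 2" by linarith
  thus ?case
  proof cases
    case 3
    define m where "m = (n + 1) div 2"
    have m: "n \<le> 2 * m" "m < n" "2 * m \<le> n + 1" using 3 by (auto simp: m_def)
    have "chebyshev_psi n \<le> chebyshev_psi (2 * m)" by (intro chebyshev_psi_mono m)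
    also have "\<dots> \<le> 5 * real m + 2 * real m * ln 2"
      using chebyshev_psi_double[of m] less[OF m(2)] by linarith
    also have "\<dots> \<le> 5 * real m + 2 * real m * (25/36)"
      using ln2_le_25_over_36 by (intro add_mono mult_left_mono) auto
    also have "\<dots> = real (2 * m) * (5/2 + 25/36)" by (simp add: algebra_simps)
    also have "\<dots> \<le> real (n + 1) * (5/2 + 25/36)" using m(3) by (intro mult_right_mono) auto
    also have "\<dots> \<le> 5 * real n" using 3 by (simp add: algebra_simps)
    finally show ?thesis .
  qed (auto simp: chebyshev_psi_def)
qed

section \<open>Dirichlet series of zeta and of its logarithmic derivative\<close>

definition zeta_series :: "complex \<Rightarrow> complex" where
  "zeta_series s = (\<Sum>n. of_nat n powr (-s))"

text \<open>Minus the logarithmic derivative of zeta. In both series the index 0 contributes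
  nothing, because \<open>0 powr s = 0\<close>.\<close>

definition mangoldt_series :: "complex \<Rightarrow> complex" where
  "mangoldt_series s = (\<Sum>n. mangoldt n * of_nat n powr (-s))"

text \<open>Write \<sigma> as \<open>1 + 2 * \<delta>\<close> and spend one \<open>\<delta>\<close>
  on the logarithm.\<close>

lemma summable_ln_powr:
  assumes "\<sigma> > (1::real)"
  shows "summable (\<lambda>n. ln (real n) * real n powr (-\<sigma>))"
proof (rule summable_comparison_test')
  define \<delta> where "\<delta> = (\<sigma> - 1) / 2"
  have d: "\<delta> > 0" "\<sigma> = 1 + \<delta> + \<delta>" using assms by (auto simp: \<delta>_def field_simps)
  show "summable (\<lambda>n. real n powr (-(1 + \<delta>)) * (1 / \<delta>))"
    using d by (intro summable_mult2) (simp add: summable_real_powr_iff)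
  fix n :: nat assume n: "n \<ge> 1"
  have "ln (real n) * real n powr (-\<sigma>) \<le> (real n powr \<delta> / \<delta>) * real n powr (-\<sigma>)"
    using n d by (intro mult_right_mono ln_powr_bound) auto
  also have "\<dots> = real n powr (-(1 + \<delta>)) * (1 / \<delta>)"
    unfolding d(2) by (simp add: powr_add[symmetric] algebra_simps)
  finally show "norm (ln (real n) * real n powr (-\<sigma>)) \<le> real n powr (-(1 + \<delta>)) * (1 / \<delta>)"
    using n by simp
qed

lemma norm_of_nat_powr: "norm (of_nat n powr s :: complex) = real n powr Re s"
  by (simp add: norm_powr_real_powr)

lemma norm_mangoldt_le: "n > 0 \<Longrightarrow> norm (mangoldt n :: complex) \<le> ln (real n)"
  using mangoldt_le[of n] by simp

lemma summable_norm_zeta: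
  "Re s > 1 \<Longrightarrow> summable (\<lambda>n. norm (of_nat n powr (-s) :: complex))"
  by (simp add: norm_of_nat_powr summable_real_powr_iff)

lemma summable_norm_mangoldt:
  assumes "Re s > 1"
  shows "summable (\<lambda>n. norm (mangoldt n * of_nat n powr (-s) :: complex))"
proof (rule summable_comparison_test)
  have "norm (mangoldt n * of_nat n powr (-s) :: complex) \<le> ln (real n) * real n powr (- Re s)" for n
  proof (cases "n = 0")
    case False
    thus ?thesis
      unfolding norm_mult norm_of_nat_powr by (intro mult_mono norm_mangoldt_le) auto
  qed simp
  thus "\<exists>N. \<forall>n\<ge>N. norm (norm (mangoldt n * of_nat n powr (-s) :: complex)) \<le> ln (real n) * real n powr (- Re s)"
    by simp
qed (rule summable_ln_powr[OF assms])

text \<open>The convolution of \<Lambda> with 1 is the logarithm; absolute summability allows the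
  double series over pairs \<open>(a, b)\<close> to be regrouped by the product
  \<open>a * b\<close>.\<close>

lemma zeta_mangoldt_product:
  assumes s: "Re s > 1"
  shows "(\<lambda>n. of_real (ln (real n)) * of_nat n powr (-s)) sums (zeta_series s * mangoldt_series s)"
proof -
  \<comment> \<open>Zero is excluded because every \<open>d\<close> divides 0, so the fibre of the
    regrouping over 0 would be infinite.\<close>
  define P where "P = {0::nat<..}"
  define f g :: "nat \<Rightarrow> complex"
    where "f = (\<lambda>n. mangoldt n * of_nat n powr (-s))" and "g = (\<lambda>n. of_nat n powr (-s))"
  have sumf: "summable (\<lambda>n. norm (f n))" and sumg: "summable (\<lambda>n. norm (g n))"
    unfolding f_def g_def using summable_norm_mangoldt summable_norm_zeta s by auto
  have onP: "(h has_sum S) P \<longleftrightarrow> (h has_sum S) UNIV" if "h 0 = 0" for h :: "nat \<Rightarrow> complex" and S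
    using that by (intro has_sum_cong_neutral) (auto simp: P_def)
  have hf: "(f has_sum mangoldt_series s) P"
    using norm_summable_imp_has_sum[OF sumf summable_sums[OF summable_norm_cancel[OF sumf]]]
    by (subst onP) (auto simp: mangoldt_series_def f_def)
  have hg: "(g has_sum zeta_series s) P"
    using norm_summable_imp_has_sum[OF sumg summable_sums[OF summable_norm_cancel[OF sumg]]]
    by (subst onP) (auto simp: zeta_series_def g_def)
  have af: "(\<lambda>x. norm (f x)) summable_on P" and ag: "(\<lambda>x. norm (g x)) summable_on P"
    using summable_on_UNIV_nonneg_real_iff[of "\<lambda>n. norm (f n)"] summable_on_UNIV_nonneg_real_iff[of "\<lambda>n. norm (g n)"] sumf sumg
    by (auto intro: summable_on_subset_banach)
  have "(\<lambda>x. norm (case x of (a,b) \<Rightarrow> f a * g b)) summable_on (P \<times> P)"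
    unfolding Infinite_Sum.abs_summable_on_Sigma_iff
    using af ag by (auto simp: norm_mult infsum_cmult_right' abs_mult intro!: summable_on_cmult_right summable_on_cmult_left infsum_nonneg)
  hence "(\<lambda>(a,b). f a * g b) summable_on (P \<times> P)" by (rule Infinite_Sum.abs_summable_summable)
  hence "((\<lambda>(a,b). f a * g b) has_sum (mangoldt_series s * zeta_series s)) (P \<times> P)"
    by (intro has_sum_SigmaI[where g = "\<lambda>a. f a * zeta_series s"])
       (auto intro!: has_sum_cmult_right has_sum_cmult_left hf hg)
  also have "?this \<longleftrightarrow> ((\<lambda>(n,d). f d * g (n div d)) has_sum (mangoldt_series s * zeta_series s))
      (SIGMA n:P. {d. d dvd n})"
    by (rule has_sum_reindex_bij_witness[where i = "\<lambda>(n,d). (d, n div d)" and j = "\<lambda>(a,b). (a * b, a)"])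
       (auto simp: P_def elim!: dvdE)
  finally have "((\<lambda>n. \<Sum>d | d dvd n. f d * g (n div d)) has_sum (mangoldt_series s * zeta_series s)) P"
    by (rule has_sum_SigmaD) (auto simp: P_def intro!: has_sum_finite)
  also have "?this \<longleftrightarrow> ((\<lambda>n. of_real (ln (real n)) * of_nat n powr (-s)) has_sum (mangoldt_series s * zeta_series s)) P"
  proof (rule has_sum_cong)
    fix n assume n: "n \<in> P"
    have "f d * g (n div d) = mangoldt d * of_nat n powr (-s)" if "d dvd n" for d
    proof -
      have "of_nat n powr (-s) = (of_nat d * of_nat (n div d) :: complex) powr (-s)"
        using that by (metis dvd_mult_div_cancel of_nat_mult)
      also have "\<dots> = of_nat d powr (-s) * of_nat (n div d) powr (-s)" by (intro powr_times_real) auto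
      finally show ?thesis by (simp add: f_def g_def mult_ac)
    qed
    hence "(\<Sum>d | d dvd n. f d * g (n div d)) = (\<Sum>d | d dvd n. mangoldt d) * of_nat n powr (-s)"
      by (simp add: sum_distrib_right)
    thus "(\<Sum>d | d dvd n. f d * g (n div d)) = of_real (ln (real n)) * of_nat n powr (-s)"
      using n by (subst (asm) mangoldt_sum) (auto simp: P_def)
  qed
  finally show ?thesis
    by (subst (asm) onP) (auto dest: has_sum_imp_sums simp: mult.commute)
qed

text \<open>Termwise differentiation, justified by a majorant on the ball whose radius is half the
  distance to the line Re s = 1; the differentiated series is minus the product computed
  before.\<close>

lemma zeta_has_derivative:
  assumes s: "Re s > 1"
  shows "(zeta_series has_field_derivative (- zeta_series s * mangoldt_series s)) (at s)"
proof -
  have op: "open {s. Re s > 1}" by (rule open_halfspace_Re_gt)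
  have "\<exists>g g'. \<forall>x\<in>{s. Re s > 1}. (\<lambda>n. of_nat n powr (-x)) sums g x \<and>
      (\<lambda>n. - (of_real (ln (real n)) * of_nat n powr (-x))) sums g' x \<and> (g has_field_derivative g' x) (at x)"
  proof (rule series_and_derivative_comparison_local[OF op])
    fix n and x :: complex
    show "((\<lambda>x::complex. of_nat n powr (-x)) has_field_derivative - (of_real (ln (real n)) * of_nat n powr (-x))) (at x)"
    proof (cases "n = 0")
      case False
      hence eq: "of_nat n powr (-x) = exp (- x * of_real (ln (real n)))" for x :: complex
        by (simp add: powr_def Ln_of_nat)
      show ?thesis unfolding eq by (auto intro!: derivative_eq_intros)
    qed simp
  next
    fix x assume x: "x \<in> {s. Re s > 1}"
    define d where "d = (Re x - 1) / 2"
    have d: "d > 0" using x by (simp add: d_def)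
    have "norm (of_nat n powr (-y) :: complex) \<le> real n powr (-(1 + d))" if "y \<in> ball x d" for n y
    proof (cases "n = 0")
      case False
      have "\<bar>Re (x - y)\<bar> < d" using that abs_Re_le_cmod[of "x - y"] by (simp add: dist_norm)
      hence "Re y \<ge> 1 + d" by (simp add: d_def field_simps abs_if split: if_splits)
      thus ?thesis using False unfolding norm_of_nat_powr by (intro powr_mono) auto
    qed simp
    moreover have "summable (\<lambda>n. real n powr (-(1 + d)))" using d by (subst summable_real_powr_iff) auto
    ultimately show "\<exists>d h. 0 < d \<and> summable h \<and> (\<forall>\<^sub>F n in sequentially. \<forall>y\<in>ball x d \<inter> {s. Re s > 1}.
        norm (of_nat n powr (-y) :: complex) \<le> h n)"
      using d by (intro exI[of _ d] exI[of _ "\<lambda>n. real n powr (-(1+d))"]) auto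
  qed
  then obtain g g' where g: "\<And>x. Re x > 1 \<Longrightarrow> (\<lambda>n. of_nat n powr (-x)) sums g x"
    "\<And>x. Re x > 1 \<Longrightarrow> (\<lambda>n. - (of_real (ln (real n)) * of_nat n powr (-x))) sums g' x"
    "\<And>x. Re x > 1 \<Longrightarrow> (g has_field_derivative g' x) (at x)" by auto
  have "g' s = - (zeta_series s * mangoldt_series s)"
    using sums_unique2[OF g(2)[OF s] sums_minus[OF zeta_mangoldt_product[OF s]]] .
  moreover have "g x = zeta_series x" if "Re x > 1" for x
    using g(1)[OF that] by (simp add: zeta_series_def sums_iff)
  ultimately show ?thesis using g(3)[OF s] s op
    by (auto intro: has_field_derivative_transform_within_open[of g _ s "{s. Re s > 1}"])
qed

section \<open>Non-vanishing of the zeta function on the line Re s = 1\<close>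

lemma norm_powr_diff_le:
  fixes a u :: real
  assumes "0 < a" "a \<le> u" "Re s \<ge> -1"
  shows "norm (of_real a powr (-s) - of_real u powr (-s) :: complex) \<le> norm s * a powr (- Re s - 1) * (u - a)"
proof -
  have "norm (of_real a powr (-s) - of_real u powr (-s) :: complex)
      \<le> (norm s * a powr (- Re s - 1)) * norm (of_real a - of_real u :: complex)"
  proof (rule field_differentiable_bound[where S = "closed_segment (of_real a) (of_real u)"
        and f' = "\<lambda>z. (-s) * z powr (-s - 1)"])
    fix z :: complex assume "z \<in> closed_segment (of_real a) (of_real u)"
    then obtain t where t: "z = of_real t" "a \<le> t" "t \<le> u"
      using assms by (auto simp: closed_segment_of_real closed_segment_eq_real_ivl)
    hence "z \<notin> \<real>\<^sub>\<le>\<^sub>0" using assms by (auto simp: complex_nonpos_Reals_iff)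
    thus "((\<lambda>z. z powr (-s)) has_field_derivative (-s) * z powr (-s - 1))
        (at z within closed_segment (of_real a) (of_real u))"
      by (rule has_field_derivative_at_within[OF has_field_derivative_powr])
    have "norm (z powr (-s - 1)) = t powr (- Re s - 1)"
      using t assms by (subst norm_powr_real_powr) auto
    also have "\<dots> \<le> a powr (- Re s - 1)" using t assms by (intro powr_mono2') auto
    finally show "norm ((-s) * z powr (-s - 1)) \<le> norm s * a powr (- Re s - 1)"
      unfolding norm_mult by (simp add: mult_left_mono)
  qed auto
  also have "norm (of_real a - of_real u :: complex) = u - a"
    using assms by (metis abs_minus_commute abs_of_nonneg diff_ge_0_iff_ge norm_of_real of_real_diff)
  finally show ?thesis .
qed

text \<open>This is \<open>s - 1\<close> times the difference between \<open>n powr (-s)\<close> and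
  the integral of \<open>u powr (-s)\<close> over \<open>[n, n + 1]\<close>, with the integral
  evaluated so that no division by \<open>s - 1\<close> occurs.\<close>

definition zeta_term :: "nat \<Rightarrow> complex \<Rightarrow> complex" where
  "zeta_term n s = (s - 1) * of_nat n powr (-s) - of_nat n powr (1 - s) + of_nat (Suc n) powr (1 - s)"

text \<open>The term is the increment over \<open>[n, n + 1]\<close> of a function \<open>G\<close>
  whose derivative contains the difference \<open>n powr (-s) - z powr (-s)\<close>. That difference
  gains a factor \<open>1 / n\<close>, which makes the series converge for all Re s > 0.\<close>

lemma norm_zeta_term_le:
  assumes n: "n > 0" and s: "Re s > 0"
  shows "norm (zeta_term n s) \<le> norm (s - 1) * norm s * real n powr (- Re s - 1)"
proof -
  define G where "G z = z powr (1 - s) + (s - 1) * of_nat n powr (-s) * z" for z :: complex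
  have "norm (G (of_real (real n + 1)) - G (of_real (real n))) \<le>
     (norm (s - 1) * (norm s * real n powr (- Re s - 1))) * norm (of_real (real n + 1) - of_real (real n) :: complex)"
  proof (rule field_differentiable_bound[where S = "closed_segment (of_real (real n)) (of_real (real n + 1))"
        and f' = "\<lambda>z. (s - 1) * (of_nat n powr (-s) - z powr (-s))"])
    fix z :: complex assume "z \<in> closed_segment (of_real (real n)) (of_real (real n + 1))"
    then obtain t where t: "z = of_real t" "real n \<le> t" "t \<le> real n + 1"
      unfolding closed_segment_of_real by (auto simp: closed_segment_eq_real_ivl)
    hence z: "z \<notin> \<real>\<^sub>\<le>\<^sub>0" using n by (auto simp: complex_nonpos_Reals_iff)
    show "(G has_field_derivative (s - 1) * (of_nat n powr (-s) - z powr (-s)))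
        (at z within closed_segment (of_real (real n)) (of_real (real n + 1)))"
      unfolding G_def
      by (rule has_field_derivative_at_within, use z in \<open>auto intro!: derivative_eq_intros simp: algebra_simps\<close>)
    have "norm (of_real (real n) powr (-s) - of_real t powr (-s) :: complex) \<le> norm s * real n powr (- Re s - 1) * (t - real n)"
      using n t s by (intro norm_powr_diff_le) auto
    also have "\<dots> \<le> norm s * real n powr (- Re s - 1) * 1"
      using t by (intro mult_left_mono) auto
    finally show "norm ((s - 1) * (of_nat n powr (-s) - z powr (-s))) \<le> norm (s - 1) * (norm s * real n powr (- Re s - 1))"
      unfolding norm_mult t(1) by (intro mult_left_mono) auto
  qed auto
  moreover have "G (of_real (real n + 1)) - G (of_real (real n)) = zeta_term n s"
    by (simp add: G_def zeta_term_def algebra_simps)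
  ultimately show ?thesis by (simp add: mult.assoc)
qed

text \<open>The continuation of (s - 1) zeta(s): the pole of zeta is removed, so the function is
  holomorphic and nonzero at 1. The summand 1 compensates the telescoping part of
  \<open>zeta_term\<close>, whose sum is -1 for Re s > 1.\<close>

definition zeta_reg :: "complex \<Rightarrow> complex" where
  "zeta_reg s = 1 + (\<Sum>n. zeta_term (Suc n) s)"

lemma zeta_term_holomorphic: "zeta_term n holomorphic_on A"
  unfolding zeta_term_def by (intro holomorphic_intros)

lemma zeta_reg_holomorphic: "zeta_reg holomorphic_on {s. Re s > 0}"
proof -
  have op: "open {s. Re s > 0}" by (rule open_halfspace_Re_gt)
  have "\<exists>g g'. \<forall>x\<in>{s. Re s > 0}. (\<lambda>n. zeta_term (Suc n) x) sums g x \<and>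
      (\<lambda>n. deriv (zeta_term (Suc n)) x) sums g' x \<and> (g has_field_derivative g' x) (at x)"
  proof (rule series_and_derivative_comparison_local[OF op])
    fix n and x :: complex
    show "(zeta_term (Suc n) has_field_derivative deriv (zeta_term (Suc n)) x) (at x)"
      by (rule holomorphic_derivI[OF zeta_term_holomorphic open_UNIV]) auto
  next
    fix x :: complex assume x: "x \<in> {s. Re s > 0}"
    define d where "d = Re x / 2"
    have d: "d > 0" using x by (simp add: d_def)
    define C where "C = (norm x + d + 1) * (norm x + d)"
    have "norm (zeta_term (Suc n) y) \<le> C * real (Suc n) powr (- d - 1)" if y: "y \<in> ball x d" for n y
    proof -
      have "\<bar>Re (x - y)\<bar> < d" using y abs_Re_le_cmod[of "x - y"] by (simp add: dist_norm)
      hence re: "Re y \<ge> d" by (simp add: d_def field_simps abs_if split: if_splits)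
      have ny: "norm y \<le> norm x + d"
        using y norm_triangle_ineq2[of y x] by (simp add: dist_norm norm_minus_commute)
      have "norm (zeta_term (Suc n) y) \<le> norm (y - 1) * norm y * real (Suc n) powr (- Re y - 1)"
        using re d by (intro norm_zeta_term_le) auto
      also have "\<dots> \<le> C * real (Suc n) powr (- d - 1)"
        unfolding C_def using re ny d norm_triangle_ineq4[of y 1]
        by (intro mult_mono powr_mono mult_nonneg_nonneg) auto
      finally show ?thesis .
    qed
    moreover have "summable (\<lambda>n. C * real (Suc n) powr (- d - 1))"
    proof (rule summable_mult)
      have "summable (\<lambda>n. real n powr (- d - 1))" using d by (subst summable_real_powr_iff) auto
      thus "summable (\<lambda>n. real (Suc n) powr (- d - 1))" by (subst summable_Suc_iff)
    qed
    ultimately show "\<exists>d h. 0 < d \<and> summable h \<and> (\<forall>\<^sub>F n in sequentially. \<forall>y\<in>ball x d \<inter> {s. Re s > 0}.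
        norm (zeta_term (Suc n) y) \<le> h n)"
      using d by (intro exI[of _ d] exI[of _ "\<lambda>n. C * real (Suc n) powr (- d - 1)"]) auto
  qed
  then obtain g g' where g: "\<And>x. Re x > 0 \<Longrightarrow> (\<lambda>n. zeta_term (Suc n) x) sums g x"
    "\<And>x. Re x > 0 \<Longrightarrow> (g has_field_derivative g' x) (at x)" by auto
  have "(\<lambda>s. 1 + g s) holomorphic_on {s. Re s > 0}"
    using g(2) op by (intro holomorphic_intros) (auto simp: holomorphic_on_open)
  moreover have "zeta_reg s = 1 + g s" if "s \<in> {s. Re s > 0}" for s
    using g(1)[of s] that by (simp add: zeta_reg_def sums_iff)
  ultimately show ?thesis by (metis (no_types, lifting) holomorphic_transform)
qed

lemma zeta_reg_1: "zeta_reg 1 = 1"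
  by (simp add: zeta_reg_def zeta_term_def powr_def del: of_nat_Suc)

lemma of_nat_Suc_powr_tendsto_0:
  assumes "Re s > 0"
  shows "(\<lambda>n. of_nat (Suc n) powr (-s) :: complex) \<longlonglongrightarrow> 0"
proof (rule tendsto_norm_zero_cancel)
  have "(\<lambda>n. real (Suc n) powr (- Re s)) \<longlonglongrightarrow> 0" using assms by real_asymp
  thus "(\<lambda>n. norm (of_nat (Suc n) powr (-s) :: complex)) \<longlonglongrightarrow> 0"
    unfolding norm_of_nat_powr by simp
qed

lemma zeta_reg_eq:
  assumes s: "Re s > 1"
  shows "zeta_reg s = (s - 1) * zeta_series s"
proof -
  have "(\<lambda>n. of_nat n powr (-s)) sums zeta_series s"
    unfolding zeta_series_def by (rule summable_sums[OF summable_norm_cancel[OF summable_norm_zeta[OF s]]])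
  hence "(\<lambda>n. of_nat (Suc n) powr (-s)) sums zeta_series s" by (subst sums_Suc_iff) simp
  hence 1: "(\<lambda>n. (s - 1) * of_nat (Suc n) powr (-s)) sums ((s - 1) * zeta_series s)" by (rule sums_mult)
  have "(\<lambda>n. of_nat (Suc n) powr (-(s - 1)) :: complex) \<longlonglongrightarrow> 0"
    by (rule of_nat_Suc_powr_tendsto_0) (use s in auto)
  hence "(\<lambda>n. of_nat (Suc n) powr (1 - s) :: complex) \<longlonglongrightarrow> 0" by simp
  from telescope_sums[OF this]
  have "(\<lambda>n. of_nat (Suc (Suc n)) powr (1 - s) - of_nat (Suc n) powr (1 - s) :: complex) sums (-1)"
    by (simp add: powr_def)
  from sums_add[OF 1 this] have "(\<lambda>n. zeta_term (Suc n) s) sums ((s - 1) * zeta_series s - 1)"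
    by (simp add: zeta_term_def algebra_simps)
  thus ?thesis by (simp add: zeta_reg_def sums_iff)
qed

text \<open>The logarithmic derivative is \<open>1 / (s - 1) - mangoldt_series s\<close>. The form
  without division is valid also at a possible zero, as needed while non-vanishing is still to be
  proved.\<close>

lemma zeta_reg_deriv:
  assumes s: "Re s > 1"
  shows "(s - 1) * deriv zeta_reg s = zeta_reg s * (1 - (s - 1) * mangoldt_series s)"
proof -
  have "((\<lambda>s. (s - 1) * zeta_series s) has_field_derivative
        (zeta_series s + (s - 1) * (- zeta_series s * mangoldt_series s))) (at s)"
    using zeta_has_derivative[OF s] by (auto intro!: derivative_eq_intros)
  hence "(zeta_reg has_field_derivative
        (zeta_series s + (s - 1) * (- zeta_series s * mangoldt_series s))) (at s)"
    by (rule has_field_derivative_transform_within_open[of _ _ s "{s. Re s > 1}"])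
       (use s in \<open>auto simp: open_halfspace_Re_gt zeta_reg_eq\<close>)
  thus ?thesis using s by (simp add: DERIV_imp_deriv zeta_reg_eq algebra_simps)
qed

text \<open>The limit is the order of vanishing: factor \<open>f w = (w - \<xi>) ^ n * g w\<close>
  with \<open>g\<close> zero-free, and the logarithmic derivative splits into
  \<open>n / (w - \<xi>)\<close> and a bounded part.\<close>

lemma logderiv_limit:
  assumes f: "f holomorphic_on S" and S: "open S" "connected S" "\<xi> \<in> S" and w: "w \<in> S" "f w \<noteq> 0"
  shows "\<exists>n::nat. (n > 0 \<longleftrightarrow> f \<xi> = 0) \<and> ((\<lambda>w. (w - \<xi>) * (deriv f w / f w)) \<longlongrightarrow> of_nat n) (at \<xi>)"
proof (cases "f \<xi> = 0")
  case False
  have "isCont f \<xi>" "isCont (deriv f) \<xi>"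
    using holomorphic_on_imp_continuous_on[OF f] holomorphic_on_imp_continuous_on[OF holomorphic_deriv[OF f S(1)]]
    by (auto simp: continuous_on_eq_continuous_at S)
  hence "((\<lambda>w. (w - \<xi>) * (deriv f w / f w)) \<longlongrightarrow> (\<xi> - \<xi>) * (deriv f \<xi> / f \<xi>)) (at \<xi>)"
    using False by (intro tendsto_intros) (auto simp: isCont_def)
  thus ?thesis using False by (intro exI[of _ 0]) auto
next
  case True
  have nc: "\<not> f constant_on S" unfolding constant_on_def using w True S(3) by metis
  obtain g r n where n: "0 < n" "0 < r" and r: "ball \<xi> r \<subseteq> S" "g holomorphic_on ball \<xi> r"
    and fg: "\<And>w. w \<in> ball \<xi> r \<Longrightarrow> f w = (w - \<xi>) ^ n * g w" and g0: "\<And>w. w \<in> ball \<xi> r \<Longrightarrow> g w \<noteq> 0"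
    by (rule holomorphic_factor_zero_nonconstant[OF f S True nc]) (rule that; assumption)
  have "isCont g \<xi>" "isCont (deriv g) \<xi>"
    using holomorphic_on_imp_continuous_on[OF r(2)] holomorphic_on_imp_continuous_on[OF holomorphic_deriv[OF r(2)]] n
    by (auto simp: continuous_on_eq_continuous_at)
  hence "((\<lambda>w. of_nat n + (w - \<xi>) * (deriv g w / g w)) \<longlongrightarrow> of_nat n + (\<xi> - \<xi>) * (deriv g \<xi> / g \<xi>)) (at \<xi>)"
    using g0[of \<xi>] n by (intro tendsto_intros) (auto simp: isCont_def)
  hence lim: "((\<lambda>w. of_nat n + (w - \<xi>) * (deriv g w / g w)) \<longlongrightarrow> of_nat n) (at \<xi>)" by simp
  have eqv: "of_nat n + (w - \<xi>) * (deriv g w / g w) = (w - \<xi>) * (deriv f w / f w)"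
    if w: "w \<noteq> \<xi>" "dist w \<xi> < r" for w
  proof -
    have wb: "w \<in> ball \<xi> r" using w by (simp add: dist_commute)
    have "((\<lambda>w. (w - \<xi>) ^ n * g w) has_field_derivative
       (of_nat n * (w - \<xi>) ^ (n - 1) * g w + (w - \<xi>) ^ n * deriv g w)) (at w)"
      using holomorphic_derivI[OF r(2) open_ball wb] by (auto intro!: derivative_eq_intros)
    hence "(f has_field_derivative (of_nat n * (w - \<xi>) ^ (n - 1) * g w + (w - \<xi>) ^ n * deriv g w)) (at w)"
      by (rule has_field_derivative_transform_within_open[OF _ open_ball wb]) (use fg in auto)
    hence df: "deriv f w = of_nat n * (w - \<xi>) ^ (n - 1) * g w + (w - \<xi>) ^ n * deriv g w"
      by (rule DERIV_imp_deriv)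
    have df2: "(w - \<xi>) * deriv f w = (of_nat n * g w + (w - \<xi>) * deriv g w) * (w - \<xi>) ^ n"
      unfolding df using n(1) by (cases n) (auto simp: algebra_simps)
    have "(w - \<xi>) * (deriv f w / f w) =
        ((of_nat n * g w + (w - \<xi>) * deriv g w) * (w - \<xi>) ^ n) / ((w - \<xi>) ^ n * g w)"
      unfolding fg[OF wb] df2[symmetric] by simp
    also have "\<dots> = (of_nat n * g w + (w - \<xi>) * deriv g w) / g w" using w by simp
    also have "\<dots> = of_nat n + (w - \<xi>) * (deriv g w / g w)"
      using g0[OF wb] by (simp add: add_divide_distrib)
    finally show ?thesis ..
  qed
  have "((\<lambda>w. (w - \<xi>) * (deriv f w / f w)) \<longlongrightarrow> of_nat n) (at \<xi>)"
    by (rule Lim_transform_within[OF lim n(2)]) (rule eqv, simp_all)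
  thus ?thesis using n True by (intro exI[of _ n]) auto
qed

text \<open>The approach is horizontal from the right, where for Re \<xi> \<ge> 1 the Dirichlet
  series converges. The point 1, with \<open>zeta_reg 1 = 1\<close>, shows that the function is not
  identically zero.\<close>

lemma zeta_reg_logderiv_limit:
  assumes "Re \<xi> > 0"
  shows "\<exists>n::nat. (n > 0 \<longleftrightarrow> zeta_reg \<xi> = 0) \<and>
    ((\<lambda>t::real. of_real t * (deriv zeta_reg (\<xi> + t) / zeta_reg (\<xi> + t))) \<longlongrightarrow> of_nat n) (at_right 0)"
proof -
  have con: "connected {s. Re s > 0}" by (intro convex_connected convex_halfspace_Re_gt)
  obtain n :: nat where n: "n > 0 \<longleftrightarrow> zeta_reg \<xi> = 0"
    "((\<lambda>w. (w - \<xi>) * (deriv zeta_reg w / zeta_reg w)) \<longlongrightarrow> of_nat n) (at \<xi>)"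
    using logderiv_limit[OF zeta_reg_holomorphic open_halfspace_Re_gt con, of \<xi> 1] assms by (auto simp: zeta_reg_1)
  have "filterlim (\<lambda>t::real. \<xi> + of_real t) (at \<xi>) (at_right 0)"
    unfolding filterlim_at
    by (auto simp: eventually_at_filter intro!: tendsto_eq_intros)
  from filterlim_compose[OF n(2) this]
  have "((\<lambda>t::real. of_real t * (deriv zeta_reg (\<xi> + t) / zeta_reg (\<xi> + t))) \<longlongrightarrow> of_nat n) (at_right 0)" by simp
  thus ?thesis using n(1) by blast
qed

lemma norm_mangoldt_series_le:
  assumes "\<sigma> > 1" "Re s \<ge> \<sigma>"
  shows "norm (mangoldt_series s) \<le> (\<Sum>n. norm (mangoldt n * of_nat n powr (-of_real \<sigma>) :: complex))"
  unfolding mangoldt_series_def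
proof (rule norm_suminf_le)
  fix n
  show "norm (mangoldt n * of_nat n powr (-s) :: complex) \<le> norm (mangoldt n * of_nat n powr (-of_real \<sigma>) :: complex)"
  proof (cases "n = 0")
    case False
    thus ?thesis unfolding norm_mult norm_of_nat_powr using assms
      by (intro mult_left_mono powr_mono) (auto simp: mangoldt_nonneg)
  qed simp
qed (use assms in \<open>intro summable_norm_mangoldt, auto\<close>)

text \<open>At a zero, \<open>t\<close> times the logarithmic derivative at \<open>\<xi> + t\<close>
  would tend to a positive integer, yet to the right of \<xi> that derivative is bounded by
  absolutely convergent series.\<close>

lemma zeta_reg_nonzero_gt_1:
  assumes s: "Re \<xi> > 1"
  shows "zeta_reg \<xi> \<noteq> 0"
proof
  assume z: "zeta_reg \<xi> = 0"
  obtain n :: nat where n: "n > 0"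
    "((\<lambda>t::real. of_real t * (deriv zeta_reg (\<xi> + t) / zeta_reg (\<xi> + t))) \<longlongrightarrow> of_nat n) (at_right 0)"
    using zeta_reg_logderiv_limit[of \<xi>] s z by auto
  define C where "C = 1 / (Re \<xi> - 1) + (\<Sum>n. norm (mangoldt n * of_nat n powr (-of_real (Re \<xi>)) :: complex))"
  have "((\<lambda>t::real. of_real t * (deriv zeta_reg (\<xi> + t) / zeta_reg (\<xi> + t))) \<longlongrightarrow> 0) (at_right 0)"
  proof (rule Lim_null_comparison)
    show "\<forall>\<^sub>F t in at_right 0. norm (of_real t * (deriv zeta_reg (\<xi> + of_real t) / zeta_reg (\<xi> + of_real t))) \<le> t * C"
      unfolding eventually_at_filter
    proof (intro always_eventually allI impI)
      fix t :: real assume t: "t \<noteq> 0" "t \<in> {0<..}"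
      define w where "w = \<xi> + of_real t"
      have w: "Re w > Re \<xi>" "Re w > 1" using t s by (auto simp: w_def)
      have "norm (deriv zeta_reg w / zeta_reg w) \<le> C"
      \<comment> \<open>A zero of the denominator is harmless: division by 0 gives 0.\<close>
      proof (cases "zeta_reg w = 0")
        case True
        have "C \<ge> 0" unfolding C_def using s
          by (intro add_nonneg_nonneg suminf_nonneg summable_norm_mangoldt) auto
        thus ?thesis using True by simp
      next
        case False
        have w1: "w \<noteq> 1" using w(2) by auto
        have "deriv zeta_reg w / zeta_reg w = 1 / (w - 1) - mangoldt_series w"
          using zeta_reg_deriv[OF w(2)] False w1 by (simp add: field_simps)
        also have "norm \<dots> \<le> norm (1 / (w - 1)) + norm (mangoldt_series w)" by (rule norm_triangle_ineq4)
        also have "norm (1 / (w - 1)) \<le> 1 / (Re \<xi> - 1)"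
          using w s abs_Re_le_cmod[of "w - 1"] unfolding norm_divide by (auto intro!: frac_le)
        also have "norm (mangoldt_series w) \<le> (\<Sum>n. norm (mangoldt n * of_nat n powr (-of_real (Re \<xi>)) :: complex))"
          using w s by (intro norm_mangoldt_series_le) auto
        finally show ?thesis unfolding C_def by simp
      qed
      thus "norm (of_real t * (deriv zeta_reg (\<xi> + of_real t) / zeta_reg (\<xi> + of_real t))) \<le> t * C"
        using t unfolding w_def[symmetric] norm_mult by (simp add: mult_left_mono)
    qed
    show "((\<lambda>t. t * C) \<longlongrightarrow> 0) (at_right 0)" by (auto intro!: tendsto_eq_intros)
  qed
  from tendsto_unique[OF _ n(2) this] n(1) show False by simp
qed

lemma Re_mangoldt_series:
  assumes \<sigma>: "\<sigma> > 1"
  shows "(\<lambda>n. mangoldt n * real n powr (-\<sigma>) * cos (y * ln (real n))) sums Re (mangoldt_series (Complex \<sigma> y))"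
proof -
  have "(\<lambda>n. mangoldt n * of_nat n powr (- Complex \<sigma> y)) sums mangoldt_series (Complex \<sigma> y)"
    unfolding mangoldt_series_def
    by (rule summable_sums[OF summable_norm_cancel[OF summable_norm_mangoldt]]) (use \<sigma> in auto)
  from sums_Re[OF this]
  have "(\<lambda>n. Re (mangoldt n * of_nat n powr (- Complex \<sigma> y))) sums Re (mangoldt_series (Complex \<sigma> y))" .
  moreover have "Re (mangoldt n * of_nat n powr (- Complex \<sigma> y)) = mangoldt n * real n powr (-\<sigma>) * cos (y * ln (real n))" for n
  proof (cases "n = 0")
    case False
    have "Re (mangoldt n * of_nat n powr (- Complex \<sigma> y)) = Re (of_real (mangoldt n) * of_nat n powr (- Complex \<sigma> y))"
      by simp
    also have "\<dots> = mangoldt n * Re (of_nat n powr (- Complex \<sigma> y))" by (simp only: scaleR_conv_of_real[symmetric] scaleR_complex.simps)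
    also have "Re (of_nat n powr (- Complex \<sigma> y)) = real n powr (-\<sigma>) * cos (y * ln (real n))"
      using False by (simp add: powr_def Ln_of_nat Re_exp)
    finally show ?thesis by simp
  qed simp
  ultimately show ?thesis by (simp only:)
qed

text \<open>Termwise this is Mertens' inequality
  \<open>3 + 4 * cos t + cos (2 * t) = 2 * (1 + cos t)^2\<close>, with
  \<open>t = y * ln n\<close>.\<close>

lemma mangoldt_series_341:
  assumes "\<sigma> > 1"
  shows "3 * Re (mangoldt_series (Complex \<sigma> 0)) + 4 * Re (mangoldt_series (Complex \<sigma> y))
         + Re (mangoldt_series (Complex \<sigma> (2 * y))) \<ge> 0"
proof -
  note r = Re_mangoldt_series[OF assms]
  have sm: "(\<lambda>n. 3 * (mangoldt n * real n powr (-\<sigma>) * cos (0 * ln (real n))) + 4 * (mangoldt n * real n powr (-\<sigma>) * cos (y * ln (real n)))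
       + mangoldt n * real n powr (-\<sigma>) * cos (2 * y * ln (real n))) sums
     (3 * Re (mangoldt_series (Complex \<sigma> 0)) + 4 * Re (mangoldt_series (Complex \<sigma> y))
         + Re (mangoldt_series (Complex \<sigma> (2 * y))))"
    by (intro sums_add sums_mult r)
  have nn: "3 * (mangoldt n * real n powr (-\<sigma>) * cos (0 * ln (real n))) + 4 * (mangoldt n * real n powr (-\<sigma>) * cos (y * ln (real n)))
       + mangoldt n * real n powr (-\<sigma>) * cos (2 * y * ln (real n)) \<ge> 0" for n
  proof -
    have c: "cos (2 * y * ln (real n)) = 2 * (cos (y * ln (real n)))^2 - 1"
      using cos_double_cos[of "y * ln (real n)"] by (simp add: mult.assoc)
    have "3 * (mangoldt n * real n powr (-\<sigma>) * cos (0 * ln (real n))) + 4 * (mangoldt n * real n powr (-\<sigma>) * cos (y * ln (real n)))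
       + mangoldt n * real n powr (-\<sigma>) * cos (2 * y * ln (real n)) =
       mangoldt n * real n powr (-\<sigma>) * (2 * (1 + cos (y * ln (real n)))^2)"
      unfolding c by (simp add: algebra_simps power2_eq_square)
    also have "\<dots> \<ge> 0" by (intro mult_nonneg_nonneg mangoldt_nonneg) auto
    finally show ?thesis .
  qed
  show ?thesis by (rule sums_le[OF nn sums_zero sm])
qed

text \<open>Let \<open>n1\<close> and \<open>n2\<close> be the orders of vanishing at
  \<open>1 + i y\<close> and \<open>1 + 2 i y\<close>. Multiplying the 3-4-1 inequality by
  \<open>t\<close> and letting \<open>t\<close> tend to 0 gives
  \<open>3 - 4 * n1 - n2 \<ge> 0\<close>, which forces \<open>n1 = 0\<close>.\<close>

lemma zeta_reg_nonzero:
  assumes s: "Re \<xi> \<ge> 1"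
  shows "zeta_reg \<xi> \<noteq> 0"
proof (cases "Re \<xi> > 1 \<or> \<xi> = 1")
  case True thus ?thesis using zeta_reg_nonzero_gt_1 zeta_reg_1 by auto
next
  case False
  define y where "y = Im \<xi>"
  have xi: "\<xi> = Complex 1 y" and y: "y \<noteq> 0" using False s by (auto simp: y_def complex_eq_iff)
  \<comment> \<open>The three arguments 0, \<open>y\<close> and \<open>2 * y\<close> are treated at
    once. The 1 for \<open>v = 0\<close> is the residue at the pole of zeta, since
    \<open>t / (w - 1)\<close> is identically 1 there and tends to 0 otherwise.\<close>
  have lim: "\<exists>n::nat. (zeta_reg (Complex 1 v) = 0 \<longrightarrow> n > 0) \<and>
     ((\<lambda>t. t * Re (mangoldt_series (Complex (1 + t) v))) \<longlongrightarrow> (if v = 0 then 1 else 0) - real n) (at_right 0)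
     \<and> (v = 0 \<longrightarrow> n = 0)" for v
  proof -
    obtain n :: nat where n: "zeta_reg (Complex 1 v) = 0 \<longrightarrow> n > 0" "zeta_reg (Complex 1 v) \<noteq> 0 \<longrightarrow> n = 0"
      "((\<lambda>t::real. of_real t * (deriv zeta_reg (Complex 1 v + t) / zeta_reg (Complex 1 v + t))) \<longlongrightarrow> of_nat n) (at_right 0)"
      using zeta_reg_logderiv_limit[of "Complex 1 v"] by force
    have "((\<lambda>t::real. of_real t / (of_real t + \<i> * of_real v)) \<longlongrightarrow> (if v = 0 then 1 else 0)) (at_right 0)"
    proof (cases "v = 0")
      case True
      have "\<forall>\<^sub>F t in at_right 0. of_real t / (of_real t + \<i> * of_real v) = (1::complex)"
        using True by (auto simp: eventually_at_filter)
      thus ?thesis using True by (auto intro: tendsto_eventually)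
    qed (auto intro!: tendsto_eq_intros)
    from tendsto_Re[OF tendsto_diff[OF this n(3)]]
    have "((\<lambda>t::real. Re (of_real t / (of_real t + \<i> * of_real v) - of_real t * (deriv zeta_reg (Complex 1 v + t) / zeta_reg (Complex 1 v + t))))
         \<longlongrightarrow> (if v = 0 then 1 else 0) - real n) (at_right 0)" by (simp split: if_splits)
    moreover have "\<forall>\<^sub>F t in at_right (0::real). Re (of_real t / (of_real t + \<i> * of_real v) -
        of_real t * (deriv zeta_reg (Complex 1 v + t) / zeta_reg (Complex 1 v + t))) = t * Re (mangoldt_series (Complex (1 + t) v))"
      unfolding eventually_at_filter
    proof (intro always_eventually allI impI)
      fix t :: real assume "t \<noteq> 0" "t \<in> {0<..}"
      hence t: "t > 0" by simp
      define w where "w = Complex 1 v + of_real t"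
      have w: "Re w > 1" "w = Complex (1 + t) v" "w - 1 = of_real t + \<i> * of_real v"
        using t by (auto simp: w_def complex_eq_iff)
      have w1: "w \<noteq> 1" using w(1) by auto
      have L: "deriv zeta_reg w / zeta_reg w = 1 / (w - 1) - mangoldt_series w"
        using zeta_reg_deriv[OF w(1)] zeta_reg_nonzero_gt_1[OF w(1)] w1 by (simp add: field_simps)
      have "of_real t / (of_real t + \<i> * of_real v) - of_real t * (deriv zeta_reg w / zeta_reg w) = of_real t * mangoldt_series w"
        unfolding w(3)[symmetric] L by (simp add: right_diff_distrib)
      thus "Re (of_real t / (of_real t + \<i> * of_real v) - of_real t * (deriv zeta_reg (Complex 1 v + t) / zeta_reg (Complex 1 v + t)))
        = t * Re (mangoldt_series (Complex (1 + t) v))"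
        unfolding w_def[symmetric] w(2)[symmetric] by simp
    qed
    ultimately have "((\<lambda>t. t * Re (mangoldt_series (Complex (1 + t) v))) \<longlongrightarrow> (if v = 0 then 1 else 0) - real n) (at_right 0)"
      by (rule Lim_transform_eventually)
    moreover have "v = 0 \<longrightarrow> n = 0" using n(2) zeta_reg_1 by (auto simp: Complex_eq)
    ultimately show ?thesis using n(1) by blast
  qed
  obtain n1 :: nat where n1: "zeta_reg (Complex 1 y) = 0 \<longrightarrow> n1 > 0"
    "((\<lambda>t. t * Re (mangoldt_series (Complex (1 + t) y))) \<longlongrightarrow> - real n1) (at_right 0)"
    using lim[of y] y by auto
  obtain n2 :: nat where n2: "((\<lambda>t. t * Re (mangoldt_series (Complex (1 + t) (2 * y)))) \<longlongrightarrow> - real n2) (at_right 0)"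
    using lim[of "2 * y"] y by auto
  have n0: "((\<lambda>t. t * Re (mangoldt_series (Complex (1 + t) 0))) \<longlongrightarrow> 1) (at_right 0)"
    using lim[of 0] by auto
  have "((\<lambda>t. 3 * (t * Re (mangoldt_series (Complex (1 + t) 0))) + 4 * (t * Re (mangoldt_series (Complex (1 + t) y)))
       + t * Re (mangoldt_series (Complex (1 + t) (2 * y)))) \<longlongrightarrow> 3 * 1 + 4 * (- real n1) + (- real n2)) (at_right 0)"
    by (intro tendsto_intros n0 n1 n2)
  moreover have "\<forall>\<^sub>F t in at_right 0. 3 * (t * Re (mangoldt_series (Complex (1 + t) 0))) + 4 * (t * Re (mangoldt_series (Complex (1 + t) y)))
       + t * Re (mangoldt_series (Complex (1 + t) (2 * y))) \<ge> 0"
    unfolding eventually_at_filter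
  proof (intro always_eventually allI impI)
    fix t :: real assume "t \<noteq> 0" "t \<in> {0<..}"
    hence "t > 0" by simp
    hence "t * (3 * Re (mangoldt_series (Complex (1 + t) 0)) + 4 * Re (mangoldt_series (Complex (1 + t) y))
         + Re (mangoldt_series (Complex (1 + t) (2 * y)))) \<ge> 0"
      by (intro mult_nonneg_nonneg mangoldt_series_341) auto
    thus "3 * (t * Re (mangoldt_series (Complex (1 + t) 0))) + 4 * (t * Re (mangoldt_series (Complex (1 + t) y)))
       + t * Re (mangoldt_series (Complex (1 + t) (2 * y))) \<ge> 0" by (simp add: algebra_simps)
  qed
  ultimately have "3 * 1 + 4 * (- real n1) + (- real n2) \<ge> 0"
    by (intro tendsto_lowerbound) auto
  hence "n1 = 0" by linarith
  thus ?thesis using n1(1) xi by auto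
qed

section \<open>The prime number theorem\<close>

text \<open>The Mellin kernel on an interval where \<psi> is constant. As an integral, rather than a
  quotient by \<open>s\<close>, it has the correct value also at \<open>s = 0\<close>, the point
  that the Tauberian theorem is about.\<close>

definition powr_integral :: "nat \<Rightarrow> complex \<Rightarrow> complex" where
  "powr_integral n s = integral {real n..real n + 1} (\<lambda>u. of_real u powr (-s - 1))"

lemma powr_integral_mult:
  assumes n: "n > 0"
  shows "s * powr_integral n s = of_nat n powr (-s) - of_nat (Suc n) powr (-s)"
proof -
  have H: "((\<lambda>u. (-s) * of_real u powr (-s - 1)) has_integral
      (of_real (real n + 1) powr (-s) - of_real (real n) powr (-s))) {real n..real n + 1}"
  proof (rule fundamental_theorem_of_calculus)
    fix u assume "u \<in> {real n..real n + 1}"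
    hence u: "of_real u \<notin> (\<real>\<^sub>\<le>\<^sub>0 :: complex set)" using n by (auto simp: complex_nonpos_Reals_iff)
    show "((\<lambda>u. of_real u powr (-s)) has_vector_derivative (-s) * of_real u powr (-s - 1))
       (at u within {real n..real n + 1})"
      by (rule has_vector_derivative_real_field[OF has_field_derivative_powr[OF u]])
  qed auto
  have "of_real (real n + 1) = (of_nat (Suc n) :: complex)" "of_real (real n) = (of_nat n :: complex)" by simp_all
  hence "integral {real n..real n + 1} (\<lambda>u. (-s) * of_real u powr (-s - 1)) =
     of_nat (Suc n) powr (-s) - of_nat n powr (-s)" using integral_unique[OF H] by (simp only:)
  hence "(-s) * powr_integral n s = of_nat (Suc n) powr (-s) - of_nat n powr (-s)"
    unfolding powr_integral_def by (simp only: integral_mult_right)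
  thus ?thesis by (simp add: algebra_simps)
qed

lemma powr_integral_0:
  assumes n: "n > 0"
  shows "powr_integral n 0 = of_real (ln (real n + 1) - ln (real n))"
proof -
  have "((\<lambda>u. of_real u powr (-0 - 1)) has_integral
      (of_real (ln (real n + 1)) - of_real (ln (real n)) :: complex)) {real n..real n + 1}"
  proof (rule fundamental_theorem_of_calculus)
    fix u assume "u \<in> {real n..real n + 1}"
    hence u: "u > 0" using n by auto
    have "((\<lambda>u. ln u) has_real_derivative 1 / u) (at u within {real n..real n + 1})"
      using u by (auto intro!: derivative_eq_intros)
    moreover have "(of_real u powr (-0 - 1) :: complex) = of_real (1 / u)"
      using u by (simp add: powr_minus divide_inverse)
    ultimately show "((\<lambda>u. of_real (ln u)) has_vector_derivative (of_real u powr (-0 - 1) :: complex))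
       (at u within {real n..real n + 1})" by (simp only: has_vector_derivative_of_real)
  qed auto
  thus ?thesis unfolding powr_integral_def by (simp add: integral_unique)
qed

text \<open>A removable singularity: away from 0 the function is an entire function vanishing at 0
  divided by \<open>s\<close>, and its value at 0 is the derivative of that function.\<close>

lemma powr_integral_holomorphic:
  assumes n: "n > 0"
  shows "powr_integral n holomorphic_on UNIV"
proof (rule pole_theorem_open_0)
  show "(\<lambda>s. of_nat n powr (-s) - of_nat (Suc n) powr (-s) :: complex) holomorphic_on UNIV"
    by (intro holomorphic_intros)
  show "of_nat n powr (-s) - of_nat (Suc n) powr (-s) = (s - 0) * powr_integral n s"
    if "s \<in> UNIV - {0}" for s :: complex
    using powr_integral_mult[OF n] by simp
  have "((\<lambda>s. of_nat n powr (-s) - of_nat (Suc n) powr (-s) :: complex) has_field_derivative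
       - Ln (of_nat n) - - Ln (of_nat (Suc n))) (at 0)"
    using n by (auto intro!: derivative_eq_intros simp: powr_def simp del: of_nat_Suc)
  moreover have "- Ln (of_nat n) - - Ln (of_nat (Suc n)) = powr_integral n 0"
    using n Ln_of_nat[of "Suc n"] Ln_of_nat[of n] by (simp add: powr_integral_0 add_ac)
  ultimately show "powr_integral n 0 = deriv (\<lambda>s. of_nat n powr (-s) - of_nat (Suc n) powr (-s)) 0"
    by (metis DERIV_imp_deriv)
qed (use n in \<open>auto simp: powr_def simp del: of_nat_Suc\<close>)

lemma norm_powr_integral_le:
  assumes n: "n > 0"
  shows "norm (powr_integral n s) \<le> integral {real n..real n + 1} (\<lambda>u. u powr (- Re s - 1))"
  unfolding powr_integral_def
proof (rule integral_norm_bound_integral)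
  show "(\<lambda>u. of_real u powr (-s - 1) :: complex) integrable_on {real n..real n + 1}"
    using n by (intro integrable_continuous_real continuous_intros) (auto simp: complex_nonpos_Reals_iff)
  show "(\<lambda>u. u powr (- Re s - 1)) integrable_on {real n..real n + 1}"
    using n by (intro integrable_continuous_real continuous_intros) auto
qed (use n in \<open>auto simp: norm_powr_real_powr\<close>)

lemma real_powr_integral:
  assumes n: "n > 0" and x: "x \<noteq> 0"
  shows "integral {real n..real n + 1} (\<lambda>u. u powr (- x - 1)) = (real n powr (-x) - (real n + 1) powr (-x)) / x"
proof -
  have "((\<lambda>u. u powr (- x - 1)) has_integral ((real n + 1) powr (-x) / (-x) - real n powr (-x) / (-x))) {real n..real n + 1}"
  proof (rule fundamental_theorem_of_calculus)
    fix u assume u: "u \<in> {real n..real n + 1}"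
    have "((\<lambda>u. u powr (-x) / (-x)) has_real_derivative u powr (- x - 1)) (at u within {real n..real n + 1})"
      using u n x by (auto intro!: derivative_eq_intros simp: field_simps)
    thus "((\<lambda>u. u powr (-x) / (-x)) has_vector_derivative u powr (- x - 1)) (at u within {real n..real n + 1})"
      by (simp add: has_real_derivative_iff_has_vector_derivative)
  qed auto
  thus ?thesis by (simp add: integral_unique diff_divide_distrib)
qed

text \<open>On the interval \<open>n \<le> u\<close>. This trades the factor \<open>n\<close> from
  the linear bound on \<psi> for one power of \<open>u\<close>, giving the shape that
  \<open>newman_tauberian\<close> requires.\<close>

lemma real_powr_integral_Suc_le:
  assumes n: "n > 0"
  shows "real n * integral {real n..real n + 1} (\<lambda>u. u powr (- (1 + x) - 1)) \<le>
      integral {real n..real n + 1} (\<lambda>u. u powr (- x - 1))"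
proof -
  have "integral {real n..real n + 1} (\<lambda>u. real n * u powr (- (1 + x) - 1)) \<le>
      integral {real n..real n + 1} (\<lambda>u. u powr (- x - 1))"
  proof (rule integral_le)
    fix u assume u: "u \<in> {real n..real n + 1}"
    have "real n * u powr (- (1 + x) - 1) \<le> u * u powr (- (1 + x) - 1)"
      using u by (intro mult_right_mono) auto
    also have "\<dots> = u powr (1 + (- (1 + x) - 1))" using u n by (subst powr_add) auto
    also have "1 + (- (1 + x) - 1) = - x - 1" by simp
    finally show "real n * u powr (- (1 + x) - 1) \<le> u powr (- x - 1)" .
  qed (use n in \<open>intro integrable_continuous_real continuous_intros, auto\<close>)+
  thus ?thesis by simp
qed

lemma sums_powr_integral:
  assumes z: "Re z > 0"
  shows "(\<lambda>k. powr_integral (Suc k) z) sums (1 / z)"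
proof -
  have z0: "z \<noteq> 0" using z by auto
  have "(\<lambda>k. of_nat (Suc k) powr (-z) - of_nat (Suc (Suc k)) powr (-z) :: complex) sums
     (of_nat (Suc 0) powr (-z) - 0)"
    by (rule telescope_sums'[OF of_nat_Suc_powr_tendsto_0[OF z]])
  hence "(\<lambda>k. z * powr_integral (Suc k) z) sums 1" by (simp add: powr_integral_mult)
  from sums_divide[OF this, of z] show ?thesis using z0 by simp
qed

text \<open>Abel summation; the boundary term \<psi>(N) (N + 1)^(-s) tends to 0 by the linear bound
  on \<psi> because Re s > 1.\<close>

lemma sums_psi_powr_integral:
  assumes s: "Re s > 1"
  shows "(\<lambda>k. of_real (chebyshev_psi (Suc k)) * powr_integral (Suc k) s) sums (mangoldt_series s / s)"
proof -
  have s0: "s \<noteq> 0" using s by auto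
  define a :: "nat \<Rightarrow> complex" where "a n = of_nat n powr (-s)" for n
  have abel: "(\<Sum>k<N. of_real (chebyshev_psi (Suc k)) * (a (Suc k) - a (Suc (Suc k)))) =
      (\<Sum>k<N. mangoldt (Suc k) * a (Suc k)) - of_real (chebyshev_psi N) * a (Suc N)" for N
    by (induction N) (simp_all add: chebyshev_psi_Suc algebra_simps, simp add: chebyshev_psi_def)
  have "(\<lambda>N. of_real (chebyshev_psi N) * a (Suc N)) \<longlonglongrightarrow> 0"
  proof (rule Lim_null_comparison)
    show "\<forall>\<^sub>F N in sequentially. norm (of_real (chebyshev_psi N) * a (Suc N)) \<le> 5 * real (Suc N) powr (1 - Re s)"
    proof (intro always_eventually allI)
      fix N
      have "norm (of_real (chebyshev_psi N) * a (Suc N)) = chebyshev_psi N * real (Suc N) powr (- Re s)"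
        by (simp add: norm_mult a_def norm_of_nat_powr chebyshev_psi_nonneg del: of_nat_Suc)
      also have "\<dots> \<le> (5 * real (Suc N)) * real (Suc N) powr (- Re s)"
        using chebyshev_psi_le[of N] by (intro mult_right_mono) auto
      also have "\<dots> = 5 * real (Suc N) powr (1 - Re s)"
        using powr_add[of "real (Suc N)" 1 "- Re s"] by simp
      finally show "norm (of_real (chebyshev_psi N) * a (Suc N)) \<le> 5 * real (Suc N) powr (1 - Re s)" .
    qed
    have "(\<lambda>N. real (Suc N) powr (1 - Re s)) \<longlonglongrightarrow> 0" using s by real_asymp
    thus "(\<lambda>N. 5 * real (Suc N) powr (1 - Re s)) \<longlonglongrightarrow> 0" by (rule tendsto_mult_right_zero)
  qed
  moreover have "(\<lambda>N. \<Sum>k<N. mangoldt (Suc k) * a (Suc k)) \<longlonglongrightarrow> mangoldt_series s"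
  proof -
    have "(\<lambda>n. mangoldt n * a n) sums mangoldt_series s"
      unfolding mangoldt_series_def a_def
      by (rule summable_sums[OF summable_norm_cancel[OF summable_norm_mangoldt[OF s]]])
    hence "(\<lambda>n. mangoldt (Suc n) * a (Suc n)) sums mangoldt_series s" by (subst sums_Suc_iff) simp
    thus ?thesis by (simp add: sums_def)
  qed
  ultimately have "(\<lambda>N. (\<Sum>k<N. mangoldt (Suc k) * a (Suc k)) - of_real (chebyshev_psi N) * a (Suc N)) \<longlonglongrightarrow> mangoldt_series s - 0"
    by (intro tendsto_diff)
  hence "(\<lambda>k. of_real (chebyshev_psi (Suc k)) * (a (Suc k) - a (Suc (Suc k)))) sums mangoldt_series s"
    unfolding sums_def abel by simp
  hence "(\<lambda>k. s * (of_real (chebyshev_psi (Suc k)) * powr_integral (Suc k) s)) sums mangoldt_series s"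
    by (simp add: a_def powr_integral_mult[symmetric] mult_ac del: of_nat_Suc)
  from sums_divide[OF this, of s] show ?thesis using s0 by simp
qed

text \<open>The terms are the integrals of (\<psi>(u) - u) / u^2 over \<open>[n, n + 1]\<close>.
  \<open>newman_tauberian\<close> is applied to the same integrals with an additional factor
  \<open>u powr (-z)\<close>, and gives convergence at \<open>z = 0\<close>.\<close>

lemma summable_psi_error:
  "summable (\<lambda>n. chebyshev_psi n * (1 / real n - 1 / (real n + 1)) - (ln (real n + 1) - ln (real n)))"
proof -
  define e where "e k z = of_real (chebyshev_psi (Suc k)) * powr_integral (Suc k) (1 + z) - powr_integral (Suc k) z" for k z
  define U where "U = {z. Re z > -1} \<inter> {z. zeta_reg (1 + z) \<noteq> 0}"
  \<comment> \<open>Simplified form of \<open>mangoldt_series s / s - 1 / (s - 1)\<close> at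
    \<open>s = 1 + z\<close>. The poles at \<open>z = 0\<close> have cancelled, so only zeros of
    \<open>zeta_reg\<close> restrict the domain.\<close>
  define F where "F z = - (1 + deriv zeta_reg (1 + z) / zeta_reg (1 + z)) / (1 + z)" for z
  have shift: "(\<lambda>z. g (1 + z)) holomorphic_on A" if "g holomorphic_on B" "(\<lambda>z. 1 + z) ` A \<subseteq> B" for g A B
  proof -
    have "(g \<circ> (\<lambda>z. 1 + z)) holomorphic_on A"
      by (rule holomorphic_on_compose_gen[OF _ that]) (intro holomorphic_intros)
    thus ?thesis by (simp add: o_def)
  qed
  have hol: "(\<lambda>z. zeta_reg (1 + z)) holomorphic_on {z. Re z > -1}"
    "(\<lambda>z. deriv zeta_reg (1 + z)) holomorphic_on {z. Re z > -1}"
    by (rule shift[OF zeta_reg_holomorphic] shift[OF holomorphic_deriv[OF zeta_reg_holomorphic open_halfspace_Re_gt]], force)+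
  have opU: "open U" unfolding U_def
    using continuous_open_preimage[OF holomorphic_on_imp_continuous_on[OF hol(1)] open_halfspace_Re_gt, of "-{0}"]
    by (simp add: vimage_def open_Compl Int_def)
  have U0: "{z. Re z \<ge> 0} \<subseteq> U" using zeta_reg_nonzero by (auto simp: U_def)
  have FU: "F holomorphic_on U" unfolding F_def U_def
    by (intro holomorphic_intros holomorphic_on_subset[OF hol(1)] holomorphic_on_subset[OF hol(2)])
       (auto simp: complex_eq_iff)
  have ehol: "e k holomorphic_on UNIV" for k
    unfolding e_def
    by (intro holomorphic_intros shift[OF powr_integral_holomorphic] powr_integral_holomorphic) auto
  \<comment> \<open>The constant is 5 from the bound on \<psi> plus 1 from the subtracted
    integral.\<close>
  have ebd: "norm (e k z) \<le> 6 * ((real k + 1) powr (- Re z) - (real k + 2) powr (- Re z)) / Re z"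
    if z: "Re z \<noteq> 0" for k z
  proof -
    define I where "I x = integral {real (Suc k)..real (Suc k) + 1} (\<lambda>u. u powr (- x - 1))" for x
    have I0: "I x \<ge> 0" for x
      unfolding I_def by (intro integral_nonneg integrable_continuous_real continuous_intros) auto
    have "norm (e k z) \<le> chebyshev_psi (Suc k) * norm (powr_integral (Suc k) (1 + z)) + norm (powr_integral (Suc k) z)"
      unfolding e_def by (rule order_trans[OF norm_triangle_ineq4]) (simp add: norm_mult chebyshev_psi_nonneg)
    also have "\<dots> \<le> (5 * real (Suc k)) * I (1 + Re z) + I (Re z)"
      using norm_powr_integral_le[of "Suc k" "1 + z"] norm_powr_integral_le[of "Suc k" z] chebyshev_psi_le[of "Suc k"]
      by (intro add_mono mult_mono) (auto simp: I_def I0)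
    also have "\<dots> \<le> 5 * I (Re z) + I (Re z)"
    proof -
      have "real (Suc k) * I (1 + Re z) \<le> I (Re z)"
        using real_powr_integral_Suc_le[of "Suc k" "Re z"] unfolding I_def by blast
      from mult_left_mono[OF this, of 5] show ?thesis by (simp add: mult.assoc del: of_nat_Suc)
    qed
    also have "\<dots> = 6 * I (Re z)" by simp
    also have "I (Re z) = ((real k + 1) powr (- Re z) - (real k + 2) powr (- Re z)) / Re z"
      unfolding I_def by (subst real_powr_integral) (use z in \<open>auto simp: add_ac\<close>)
    finally show ?thesis by simp
  qed
  have esum: "(\<lambda>k. e k z) sums F z" if z: "Re z > 0" for z
  proof -
    define s where "s = 1 + z"
    have s: "Re s > 1" "s \<noteq> 0" "s \<noteq> 1" "z = s - 1" using z by (auto simp: s_def complex_eq_iff)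
    have "(\<lambda>k. e k z) sums (mangoldt_series s / s - 1 / z)"
      unfolding e_def s_def[symmetric] by (intro sums_diff sums_psi_powr_integral sums_powr_integral s z)
    also have "mangoldt_series s / s - 1 / z = F z"
    proof -
      have nz: "zeta_reg s \<noteq> 0" using zeta_reg_nonzero[of s] s by simp
      have L: "deriv zeta_reg s / zeta_reg s = 1 / (s - 1) - mangoldt_series s"
        using zeta_reg_deriv[OF s(1)] nz s by (simp add: field_simps)
      have "F z = - (1 + (1 / (s - 1) - mangoldt_series s)) / s"
        unfolding F_def s_def[symmetric] L ..
      thus ?thesis unfolding s(4) using s by (simp add: field_simps)
    qed
    finally show ?thesis .
  qed
  have "(\<lambda>k. e k 0) sums F 0"
    by (rule newman_tauberian[where C = 6 and U = U, OF ehol _ ebd opU U0 FU esum]) simp_all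
  hence "summable (\<lambda>k. Re (e k 0))" by (intro summable_Re sums_summable)
  also have "(\<lambda>k. Re (e k 0)) = (\<lambda>k. chebyshev_psi (Suc k) * (1 / real (Suc k) - 1 / (real (Suc k) + 1)) - (ln (real (Suc k) + 1) - ln (real (Suc k))))"
  proof
    fix k
    have "powr_integral (Suc k) 1 = of_real (1 / real (Suc k) - 1 / (real (Suc k) + 1))"
      using powr_integral_mult[of "Suc k" 1] by (simp add: powr_minus divide_inverse)
    thus "Re (e k 0) = chebyshev_psi (Suc k) * (1 / real (Suc k) - 1 / (real (Suc k) + 1)) - (ln (real (Suc k) + 1) - ln (real (Suc k)))"
      unfolding e_def by (simp only: powr_integral_0 add_0_right) simp
  qed
  finally show ?thesis by (subst (asm) summable_Suc_iff)
qed

text \<open>If \<psi>(N) exceeded \<mu>N with \<mu> > 1, monotonicity would keep \<psi> above \<mu>N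
  on \<open>[N, \<mu> N]\<close>, and that stretch of the series would have at least a fixed
  positive sum, against the Cauchy criterion. For \<mu> < 1 the same happens on
  \<open>[\<mu> N, N]\<close> with the sign reversed.\<close>

lemma psi_asymp:
  assumes summable: "summable (\<lambda>n. chebyshev_psi n * (1 / real n - 1 / (real n + 1)) - (ln (real n + 1) - ln (real n)))"
  shows "(\<lambda>n. chebyshev_psi n / real n) \<longlonglongrightarrow> 1"
proof -
  define r where "r n = chebyshev_psi n * (1 / real n - 1 / (real n + 1)) - (ln (real n + 1) - ln (real n))" for n
  have diff: "1 / real n - 1 / (real n + 1) \<ge> 0" if "n > 0" for n
    using that by (simp add: field_simps)
  have tel: "(\<Sum>n=M..<N. c * (1 / real n - 1 / (real n + 1)) - (ln (real n + 1) - ln (real n))) =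
      c * (1 / real M - 1 / real N) - (ln (real N) - ln (real M))" if "M \<le> N" for M N and c :: real
    using that by (induction N rule: dec_induct) (simp_all add: algebra_simps)
  have small: "\<forall>\<^sub>F M in sequentially. \<forall>N. \<bar>\<Sum>n=M..<N. r n\<bar> < c" if "c > 0" for c
    using summable that unfolding summable_Cauchy r_def[symmetric] real_norm_def eventually_sequentially by blast
  have upper: "\<forall>\<^sub>F N in sequentially. chebyshev_psi N / real N < \<mu>" if l: "\<mu> > 1" for \<mu>
  proof -
    \<comment> \<open>The integral of (\<mu>N - u) / u^2 over \<open>[N, \<mu> N]\<close>, positive
      because \<open>ln \<mu> < \<mu> - 1\<close>. The contradiction is sought only at
      \<open>c / 2\<close>, which leaves room for rounding \<mu>N to an integer.\<close>
    define c where "c = \<mu> - 1 - ln \<mu>"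
    have c: "c > 0" using l ln_le_minus_one[of \<mu>] ln_eq_minus_one[of \<mu>] unfolding c_def by force
    have "(\<lambda>N. \<mu> - \<mu> * real N / (\<mu> * real N - 1) - ln \<mu>) \<longlonglongrightarrow> \<mu> - 1 - ln \<mu>"
      using l by real_asymp
    hence "\<forall>\<^sub>F N in sequentially. \<mu> - \<mu> * real N / (\<mu> * real N - 1) - ln \<mu> > c / 2"
      using c by (intro order_tendstoD) (auto simp: c_def)
    moreover have "\<forall>\<^sub>F N in sequentially. \<mu> * real N - 1 > 0" using l by real_asymp
    moreover have "\<forall>\<^sub>F N in sequentially. \<forall>K. \<bar>\<Sum>n=N..<K. r n\<bar> < c / 2" using small[of "c/2"] c by simp
    ultimately show ?thesis using eventually_gt_at_top[of 0]
    proof eventually_elim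
      case (elim N)
      show ?case
      proof (rule ccontr)
        assume "\<not> chebyshev_psi N / real N < \<mu>"
        hence psi: "chebyshev_psi N \<ge> \<mu> * real N" using elim by (simp add: field_simps)
        define K where "K = nat \<lfloor>\<mu> * real N\<rfloor>"
        have K: "real K \<le> \<mu> * real N" "real K > \<mu> * real N - 1"
          using elim unfolding K_def by linarith+
        have "real N \<le> \<mu> * real N" using l by (simp add: mult_le_cancel_right1)
        hence NK: "N \<le> K" unfolding K_def by (simp add: le_nat_floor)
        have "(\<Sum>n=N..<K. (\<mu> * real N) * (1 / real n - 1 / (real n + 1)) - (ln (real n + 1) - ln (real n))) \<le> (\<Sum>n=N..<K. r n)"
          unfolding r_def
        proof (intro sum_mono diff_right_mono mult_right_mono)
          fix n assume "n \<in> {N..<K}"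
          thus "\<mu> * real N \<le> chebyshev_psi n" using psi chebyshev_psi_mono[of N n] by simp
          show "1 / real n - 1 / (real n + 1) \<ge> 0" using \<open>n \<in> {N..<K}\<close> elim by (intro diff) auto
        qed
        hence "(\<mu> * real N) * (1 / real N - 1 / real K) - (ln (real K) - ln (real N)) < c / 2"
          using elim(3)[rule_format, of K] unfolding tel[OF NK] by linarith
        moreover have "(\<mu> * real N) * (1 / real N - 1 / real K) = \<mu> - \<mu> * real N / real K"
          using elim by (simp add: field_simps)
        moreover have "\<mu> * real N / real K \<le> \<mu> * real N / (\<mu> * real N - 1)"
          using K elim l NK by (intro divide_left_mono mult_pos_pos) auto
        moreover have "ln (real K) - ln (real N) \<le> ln \<mu>"
        proof -
          have "ln (real K) \<le> ln (\<mu> * real N)" using K NK elim by (subst ln_le_cancel_iff) auto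
          also have "\<dots> = ln \<mu> + ln (real N)" using l elim by (simp add: ln_mult)
          finally show ?thesis by simp
        qed
        ultimately show False using elim by linarith
      qed
    qed
  qed
  have lower: "\<forall>\<^sub>F N in sequentially. chebyshev_psi N / real N > \<mu>" if l: "0 < \<mu>" "\<mu> < 1" for \<mu>
  proof -
    define c where "c = \<mu> - 1 - ln \<mu>"
    have c: "c > 0" using l ln_le_minus_one[of \<mu>] ln_eq_minus_one[of \<mu>] unfolding c_def by force
    have "(\<lambda>N. 1 - \<mu> + ln (\<mu> + 1 / real N)) \<longlonglongrightarrow> 1 - \<mu> + ln \<mu>"
      using l by real_asymp
    hence "\<forall>\<^sub>F N in sequentially. 1 - \<mu> + ln (\<mu> + 1 / real N) < - (c / 2)"
    proof (rule order_tendstoD)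
      show "1 - \<mu> + ln \<mu> < - (c / 2)"
      proof -
        have "1 - \<mu> + ln \<mu> = - c" by (simp add: c_def)
        thus ?thesis using c by simp
      qed
    qed
    moreover have "\<forall>\<^sub>F N in sequentially. \<forall>K. \<bar>\<Sum>n=nat \<lceil>\<mu> * real N\<rceil>..<K. r n\<bar> < c / 2"
    proof -
      have "filterlim (\<lambda>N. nat \<lceil>\<mu> * real N\<rceil>) at_top sequentially" using l by real_asymp
      from eventually_compose_filterlim[OF small[of "c/2"] this] show ?thesis using c by simp
    qed
    ultimately show ?thesis using eventually_gt_at_top[of 0]
    proof eventually_elim
      case (elim N)
      show ?case
      proof (rule ccontr)
        assume "\<not> chebyshev_psi N / real N > \<mu>"
        hence psi: "chebyshev_psi N \<le> \<mu> * real N" using elim by (simp add: field_simps)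
        define K where "K = nat \<lceil>\<mu> * real N\<rceil>"
        have lN: "\<mu> * real N > 0" using l elim by simp
        have K: "real K \<ge> \<mu> * real N" "real K < \<mu> * real N + 1" unfolding K_def using lN by linarith+
        have K0: "K > 0" using K lN by linarith
        have "\<mu> * real N \<le> real N" using l by (simp add: mult_le_cancel_right2)
        hence NK: "K \<le> N" unfolding K_def by (simp add: nat_le_iff ceiling_le_iff)
        have "(\<Sum>n=K..<N. r n) \<le> (\<Sum>n=K..<N. (\<mu> * real N) * (1 / real n - 1 / (real n + 1)) - (ln (real n + 1) - ln (real n)))"
          unfolding r_def
        proof (intro sum_mono diff_right_mono mult_right_mono)
          fix n assume "n \<in> {K..<N}"
          thus "chebyshev_psi n \<le> \<mu> * real N" using psi chebyshev_psi_mono[of n N] by simp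
          show "1 / real n - 1 / (real n + 1) \<ge> 0" using \<open>n \<in> {K..<N}\<close> K0 by (intro diff) auto
        qed
        hence "(\<mu> * real N) * (1 / real K - 1 / real N) - (ln (real N) - ln (real K)) > - (c / 2)"
          using elim(2)[rule_format, of N] unfolding tel[OF NK] K_def[symmetric] by linarith
        moreover have "(\<mu> * real N) * (1 / real K - 1 / real N) = \<mu> * real N / real K - \<mu>"
          using elim K0 by (simp add: field_simps)
        moreover have "\<mu> * real N / real K \<le> 1" using K K0 by (simp add: divide_le_eq_1)
        moreover have "ln (real K) - ln (real N) \<le> ln (\<mu> + 1 / real N)"
        proof -
          have "ln (real K) \<le> ln ((\<mu> + 1 / real N) * real N)"
          proof (rule ln_mono)
            have "(\<mu> + 1 / real N) * real N = \<mu> * real N + 1" using elim by (simp add: field_simps)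
            thus "real K \<le> (\<mu> + 1 / real N) * real N" using K by simp
          qed (use K0 in simp)
          also have "\<dots> = ln (\<mu> + 1 / real N) + ln (real N)" using l elim by (subst ln_mult) (auto intro!: add_pos_pos)
          finally show ?thesis by simp
        qed
        ultimately show False using elim by linarith
      qed
    qed
  qed
  show ?thesis
  proof (rule order_tendstoI)
    fix a :: real assume a: "a < 1"
    have "\<forall>\<^sub>F N in sequentially. chebyshev_psi N / real N > max a (1/2)" using a by (intro lower) auto
    thus "\<forall>\<^sub>F N in sequentially. chebyshev_psi N / real N > a" by eventually_elim simp
  qed (rule upper)
qed

section \<open>From \<psi> at integers to \<theta> at real arguments\<close>

definition chebyshev_theta :: "real \<Rightarrow> real" where
  "chebyshev_theta x = (\<Sum>p | prime p \<and> real p \<le> x. ln (real p))"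

lemma finite_primes_le: "finite {p::nat. prime p \<and> real p \<le> x}"
  by (rule finite_subset[of _ "{..nat \<lfloor>x\<rfloor>}"]) (auto simp: le_nat_floor)

text \<open>The difference comes from the powers \<open>p ^ k\<close> with \<open>k \<ge> 2\<close>.
  These have \<open>p \<le> sqrt n\<close> and \<open>k \<le> log 2 n\<close>, and each contributes
  at most \<open>ln n\<close>.\<close>

lemma chebyshev_psi_minus_theta_le:
  assumes "n > 0"
  shows "chebyshev_psi n \<le> chebyshev_theta (real n) + sqrt (real n) * log 2 (real n) * ln (real n)"
    and "chebyshev_theta (real n) \<le> chebyshev_psi n"
proof -
  define S where "S = {p. prime p \<and> real p \<le> real n}"
  define D where "D = {d\<in>{1..n}. primepow d \<and> \<not> prime d}"
  have S1: "S \<subseteq> {1..n}" by (auto simp: S_def Suc_le_eq prime_gt_0_nat)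
  have th: "chebyshev_theta (real n) = (\<Sum>p\<in>S. mangoldt p)"
    unfolding chebyshev_theta_def S_def by (intro sum.cong) auto
  show "chebyshev_theta (real n) \<le> chebyshev_psi n"
    unfolding th chebyshev_psi_def using S1 by (intro sum_mono2) (auto simp: mangoldt_nonneg)
  have "chebyshev_psi n = (\<Sum>d\<in>S \<union> D. mangoldt d)"
    unfolding chebyshev_psi_def
    by (rule sum.mono_neutral_right) (use S1 in \<open>auto simp: D_def S_def mangoldt_def\<close>)
  also have "\<dots> = chebyshev_theta (real n) + (\<Sum>d\<in>D. mangoldt d)"
    unfolding th using finite_subset[OF S1] by (intro sum.union_disjoint) (auto simp: D_def S_def)
  also have "(\<Sum>d\<in>D. mangoldt d) \<le> real (card D) * ln (real n)"
  proof (rule sum_bounded_above)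
    fix d assume "d \<in> D"
    hence "d > 0" "d \<le> n" by (auto simp: D_def)
    thus "mangoldt d \<le> ln (real n)" using mangoldt_le[of d] by (meson ln_mono of_nat_0_less_iff of_nat_le_iff order_trans)
  qed
  also have "real (card D) \<le> sqrt (real n) * log 2 (real n)"
  proof -
    have "D \<subseteq> (\<lambda>(p,k). p ^ k) ` ({1..nat \<lfloor>sqrt (real n)\<rfloor>} \<times> {1..nat \<lfloor>log 2 (real n)\<rfloor>})"
    proof
      fix d assume d: "d \<in> D"
      then obtain p k where pk: "prime p" "k > 0" "d = p ^ k" by (auto simp: D_def primepow_def)
      have "k \<noteq> 1" using d pk by (auto simp: D_def)
      hence k2: "k \<ge> 2" using pk by linarith
      have p2: "p \<ge> 2" using pk prime_ge_2_nat by auto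
      have dn: "p ^ k \<le> n" using d pk by (auto simp: D_def)
      have "p ^ 2 \<le> p ^ k" using k2 p2 by (intro power_increasing) auto
      hence "p ^ 2 \<le> n" using dn by simp
      hence "(real p)^2 \<le> real n" by (metis of_nat_le_iff of_nat_power)
      hence "real p \<le> sqrt (real n)" by (rule real_le_rsqrt)
      moreover have "2 ^ k \<le> p ^ k" using p2 by (intro power_mono) auto
      hence "2 ^ k \<le> n" using dn by simp
      hence "2 ^ k \<le> real n" by (metis of_nat_le_iff of_nat_power of_nat_numeral)
      hence "real k \<le> log 2 (real n)" using assms by (simp add: le_log_iff powr_realpow)
      ultimately show "d \<in> (\<lambda>(p,k). p ^ k) ` ({1..nat \<lfloor>sqrt (real n)\<rfloor>} \<times> {1..nat \<lfloor>log 2 (real n)\<rfloor>})"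
        using pk p2 k2 by (intro image_eqI[of _ _ "(p,k)"]) (auto simp: le_nat_floor)
    qed
    hence "card D \<le> card ((\<lambda>(p,k). p ^ k) ` ({1..nat \<lfloor>sqrt (real n)\<rfloor>} \<times> {1..nat \<lfloor>log 2 (real n)\<rfloor>}))"
      by (intro card_mono) auto
    also have "\<dots> \<le> nat \<lfloor>sqrt (real n)\<rfloor> * nat \<lfloor>log 2 (real n)\<rfloor>"
      by (rule order_trans[OF card_image_le]) auto
    finally have "real (card D) \<le> real (nat \<lfloor>sqrt (real n)\<rfloor>) * real (nat \<lfloor>log 2 (real n)\<rfloor>)"
      by (metis of_nat_le_iff of_nat_mult)
    also have "\<dots> \<le> sqrt (real n) * log 2 (real n)"
      using assms by (intro mult_mono of_nat_floor) auto
    finally show ?thesis .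
  qed
  finally show "chebyshev_psi n \<le> chebyshev_theta (real n) + sqrt (real n) * log 2 (real n) * ln (real n)"
    using assms by (simp add: mult_right_mono)
qed

lemma theta_asymp:
  assumes psi: "(\<lambda>n. chebyshev_psi n / real n) \<longlonglongrightarrow> 1"
  shows "((\<lambda>x. chebyshev_theta x / x) \<longlongrightarrow> 1) at_top"
proof -
  have 1: "(\<lambda>n. chebyshev_theta (real n) / real n) \<longlonglongrightarrow> 1"
  proof (rule tendsto_sandwich)
    show "\<forall>\<^sub>F n in sequentially. chebyshev_psi n / real n - sqrt (real n) * log 2 (real n) * ln (real n) / real n
        \<le> chebyshev_theta (real n) / real n"
      using eventually_gt_at_top[of 0]
    proof eventually_elim
      case (elim n)
      have "chebyshev_psi n - sqrt (real n) * log 2 (real n) * ln (real n) \<le> chebyshev_theta (real n)"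
        using chebyshev_psi_minus_theta_le(1)[OF elim] by linarith
      thus ?case unfolding diff_divide_distrib[symmetric] by (rule divide_right_mono) simp
    qed
    show "\<forall>\<^sub>F n in sequentially. chebyshev_theta (real n) / real n \<le> chebyshev_psi n / real n"
      using eventually_gt_at_top[of 0]
      by eventually_elim (use chebyshev_psi_minus_theta_le(2) in \<open>auto intro!: divide_right_mono\<close>)
    have "(\<lambda>n. sqrt (real n) * log 2 (real n) * ln (real n) / real n) \<longlonglongrightarrow> 0" by real_asymp
    from tendsto_diff[OF psi this]
    show "(\<lambda>n. chebyshev_psi n / real n - sqrt (real n) * log 2 (real n) * ln (real n) / real n) \<longlonglongrightarrow> 1" by simp
  qed (rule psi)
  have "filterlim (\<lambda>x::real. nat \<lfloor>x\<rfloor>) at_top at_top" by real_asymp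
  from filterlim_compose[OF 1 this]
  have 2: "((\<lambda>x::real. chebyshev_theta (real (nat \<lfloor>x\<rfloor>)) / real (nat \<lfloor>x\<rfloor>)) \<longlongrightarrow> 1) at_top" .
  have "((\<lambda>x::real. real (nat \<lfloor>x\<rfloor>) / x) \<longlongrightarrow> 1) at_top" by real_asymp
  from tendsto_mult[OF 2 this]
  have "((\<lambda>x. chebyshev_theta (real (nat \<lfloor>x\<rfloor>)) / real (nat \<lfloor>x\<rfloor>) * (real (nat \<lfloor>x\<rfloor>) / x)) \<longlongrightarrow> 1) at_top" by simp
  moreover have "\<forall>\<^sub>F x in at_top. chebyshev_theta (real (nat \<lfloor>x\<rfloor>)) / real (nat \<lfloor>x\<rfloor>) * (real (nat \<lfloor>x\<rfloor>) / x) = chebyshev_theta x / x"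
    using eventually_ge_at_top[of 1]
  proof eventually_elim
    case (elim x)
    have "p \<le> nat \<lfloor>x\<rfloor> \<longleftrightarrow> real p \<le> x" for p using elim by (simp add: le_nat_iff le_floor_iff)
    hence "{p. prime p \<and> real p \<le> real (nat \<lfloor>x\<rfloor>)} = {p. prime p \<and> real p \<le> x}" by simp
    hence "chebyshev_theta (real (nat \<lfloor>x\<rfloor>)) = chebyshev_theta x" by (simp add: chebyshev_theta_def)
    moreover have "real (nat \<lfloor>x\<rfloor>) \<noteq> 0" using elim by linarith
    moreover have "a / b * (b / x) = a / x" if "b \<noteq> 0" for a b :: real using that by simp
    ultimately show ?case by (simp only:)
  qed
  ultimately show ?thesis by (rule Lim_transform_eventually)
qed

section \<open>Disjoint progressions\<close>

text \<open>Each index \<open>i\<close> corresponds to the box \<open>PiE P (A i)\<close> in a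
  product probability space. Two boxes that are separated in one coordinate are disjoint, so their
  measures add up to at most 1.\<close>

lemma sum_prod_weights_le_1:
  fixes w :: "'p \<Rightarrow> 'r \<Rightarrow> real"
  assumes fin: "finite I" "finite P" "\<And>p. p \<in> P \<Longrightarrow> finite (R p)"
    and A: "\<And>i p. i \<in> I \<Longrightarrow> p \<in> P \<Longrightarrow> A i p \<subseteq> R p"
    and sep: "\<And>i j. i \<in> I \<Longrightarrow> j \<in> I \<Longrightarrow> i \<noteq> j \<Longrightarrow> \<exists>p\<in>P. A i p \<inter> A j p = {}"
    and w: "\<And>p r. p \<in> P \<Longrightarrow> r \<in> R p \<Longrightarrow> w p r \<ge> 0" "\<And>p. p \<in> P \<Longrightarrow> (\<Sum>r\<in>R p. w p r) = 1"
  shows "(\<Sum>i\<in>I. \<Prod>p\<in>P. \<Sum>r\<in>A i p. w p r) \<le> 1"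
proof -
  have finA: "finite (A i p)" if "i \<in> I" "p \<in> P" for i p
    using that A fin finite_subset by metis
  have "(\<Sum>i\<in>I. \<Prod>p\<in>P. \<Sum>r\<in>A i p. w p r) = (\<Sum>i\<in>I. \<Sum>g\<in>PiE P (A i). \<Prod>p\<in>P. w p (g p))"
    using fin finA by (intro sum.cong refl prod_sum_PiE) auto
  also have "\<dots> = (\<Sum>g\<in>(\<Union>i\<in>I. PiE P (A i)). \<Prod>p\<in>P. w p (g p))"
  proof (rule sum.UNION_disjoint[symmetric])
    show "\<forall>i\<in>I. finite (PiE P (A i))" using fin finA by (auto intro!: finite_PiE)
    show "\<forall>i\<in>I. \<forall>j\<in>I. i \<noteq> j \<longrightarrow> PiE P (A i) \<inter> PiE P (A j) = {}"
    proof (intro ballI impI)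
      fix i j assume "i \<in> I" "j \<in> I" "i \<noteq> j"
      then obtain p where p: "p \<in> P" "A i p \<inter> A j p = {}" using sep by blast
      have False if "g \<in> PiE P (A i)" "g \<in> PiE P (A j)" for g
        using PiE_mem[OF that(1) p(1)] PiE_mem[OF that(2) p(1)] p(2) by auto
      thus "PiE P (A i) \<inter> PiE P (A j) = {}" by auto
    qed
  qed (use fin in auto)
  also have "\<dots> \<le> (\<Sum>g\<in>PiE P R. \<Prod>p\<in>P. w p (g p))"
  proof (rule sum_mono2)
    show "finite (PiE P R)" using fin by (intro finite_PiE) auto
    show "(\<Union>i\<in>I. PiE P (A i)) \<subseteq> PiE P R"
      using A by (intro UN_least PiE_mono) auto
    show "(\<Prod>p\<in>P. w p (g p)) \<ge> 0" if "g \<in> PiE P R - (\<Union>i\<in>I. PiE P (A i))" for g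
      using that w(1) by (intro prod_nonneg) (auto dest: PiE_mem)
  qed
  also have "\<dots> = (\<Prod>p\<in>P. \<Sum>r\<in>R p. w p r)"
    using fin by (intro prod_sum_PiE[symmetric]) auto
  also have "\<dots> = 1" using w(2) by simp
  finally show ?thesis .
qed

lemma gcd_dvd_imp_arith_prog_inter:
  assumes "int (gcd m n) dvd a - b"
  shows "arith_prog a m \<inter> arith_prog b n \<noteq> {}"
proof -
  obtain u v where uv: "u * int m + v * int n = gcd (int m) (int n)" using bezout_int by blast
  obtain c where c: "a - b = gcd (int m) (int n) * c" using assms by (auto simp: gcd_int_int_eq)
  have "a + int m * (- u * c) = b + int n * (v * c)"
    using c unfolding uv[symmetric] by (simp add: algebra_simps)
  moreover have "a + int m * (- u * c) \<in> arith_prog a m" "b + int n * (v * c) \<in> arith_prog b n"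
    unfolding arith_prog_def by blast+
  ultimately show ?thesis by auto
qed

lemma card_residues_ge:
  fixes p :: nat and f :: int
  assumes p: "p > 0" and v: "v \<le> a"
  shows "card {r \<in> {0..<int p ^ a}. [r = f] (mod int p ^ v)} \<ge> p ^ (a - v)"
proof -
  define h where "h t = f mod int p ^ v + int p ^ v * t" for t :: int
  have pv: "int p ^ v > 0" using p by simp
  have pa: "int p ^ a = int p ^ v * int p ^ (a - v)" using v by (simp flip: power_add)
  have "inj_on h {0..<int p ^ (a - v)}" using pv by (auto simp: inj_on_def h_def)
  hence ceq: "card (h ` {0..<int p ^ (a - v)}) = p ^ (a - v)"
    by (simp add: card_image flip: of_nat_power)
  have sub: "h ` {0..<int p ^ (a - v)} \<subseteq> {r \<in> {0..<int p ^ a}. [r = f] (mod int p ^ v)}"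
  proof (intro image_subsetI CollectI conjI)
    fix t assume t: "t \<in> {0..<int p ^ (a - v)}"
    have "h t < int p ^ v + int p ^ v * t" unfolding h_def using pv by simp
    also have "\<dots> = int p ^ v * (t + 1)" by (simp add: algebra_simps)
    also have "\<dots> \<le> int p ^ v * int p ^ (a - v)" using t pv by (intro mult_left_mono) auto
    finally show "h t \<in> {0..<int p ^ a}" using t pv unfolding pa h_def by auto
    show "[h t = f] (mod int p ^ v)" by (simp add: h_def cong_def)
  qed
  have "finite {r \<in> {0..<int p ^ a}. [r = f] (mod int p ^ v)}"
    by (rule finite_subset[of _ "{0..<int p ^ a}"]) auto
  from card_mono[OF this sub] show ?thesis unfolding ceq .
qed

lemma prod_prime_power_multiplicity:
  fixes n :: nat
  assumes "n > 0" "finite P" "prime_factors n \<subseteq> P" "\<And>p. p \<in> P \<Longrightarrow> prime p"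
  shows "(\<Prod>p\<in>P. p ^ multiplicity p n) = n"
proof -
  have "n = (\<Prod>p\<in>prime_factors n. p ^ multiplicity p n)"
    using assms(1) by (intro prime_factorization_nat)
  also have "\<dots> = (\<Prod>p\<in>P. p ^ multiplicity p n)"
    using assms by (intro prod.mono_neutral_left) (auto simp: prime_factors_multiplicity)
  finally show ?thesis ..
qed

text \<open>
  The weight at a prime \<open>p \<in> G\<close> is concentrated on the residue class of the progression \<open>c p\<close>,
  the remaining mass \<open>\<epsilon>\<close> being shared among the at most \<open>\<epsilon> p\<close> progressions whose period is divisible
  by \<open>p\<close>; at all other primes it is uniform. Thus the primes of \<open>G\<close> cannot be used to separate
  progressions efficiently.
\<close>
lemma disjoint_progressions_weight:
  fixes \<pi> c :: "nat \<Rightarrow> nat" and f :: "nat \<Rightarrow> int" and \<epsilon> :: real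
  assumes I: "finite I" and pos: "\<And>i. i \<in> I \<Longrightarrow> \<pi> i > 0"
    and disj: "disjoint_family_on (\<lambda>i. arith_prog (f i) (\<pi> i)) I"
    and eps: "0 < \<epsilon>" "\<epsilon> < 1" and G: "finite G" "\<And>p. p \<in> G \<Longrightarrow> prime p"
    and c: "\<And>p. p \<in> G \<Longrightarrow> c p \<in> I \<and> p dvd \<pi> (c p)"
    and few: "\<And>p. p \<in> G \<Longrightarrow> real (card {i\<in>I. p dvd \<pi> i}) \<le> \<epsilon> * real p"
  shows "(\<Sum>i\<in>I. (1 - \<epsilon>) ^ card {p\<in>G. c p = i} *
            real (\<Prod>p\<in>{p\<in>G. c p = i}. p ^ multiplicity p (\<pi> i)) / real (\<pi> i)) \<le> 1"
proof -
  define P where "P = (\<Union>i\<in>I. prime_factors (\<pi> i))"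
  have P: "finite P" "\<And>p. p \<in> P \<Longrightarrow> prime p" using I by (auto simp: P_def)
  have GP: "G \<subseteq> P"
  proof
    fix p assume "p \<in> G"
    thus "p \<in> P" unfolding P_def using c[of p] G(2)[of p] pos[of "c p"]
      by (intro UN_I[of "c p"]) (auto simp: prime_factors_dvd)
  qed
  \<comment> \<open>The largest exponent of \<open>p\<close> in any period, so that all constraints
    at \<open>p\<close> live in the same residue ring modulo \<open>p ^ a p\<close>.\<close>
  define a where "a p = Max ((\<lambda>i. multiplicity p (\<pi> i)) ` I)" for p
  have a: "multiplicity p (\<pi> i) \<le> a p" if "i \<in> I" for i p
    unfolding a_def using I that by (intro Max_ge) auto
  define R where "R p = {0..<int p ^ a p}" for p
  define A where "A i p = {r \<in> R p. [r = f i] (mod int p ^ multiplicity p (\<pi> i))}" for i p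
  define T where "T p = {i\<in>I. p dvd \<pi> i}" for p
  define w where "w p r = (if p \<in> G then (1 - \<epsilon>) * of_bool (r = f (c p) mod int p ^ a p)
       + \<epsilon> / real (card (T p)) * (\<Sum>j\<in>T p. of_bool (r = f j mod int p ^ a p))
     else 1 / real (p ^ a p))" for p r
  have Tfin: "finite (T p)" for p using I by (simp add: T_def)
  have Tpos: "card (T p) > 0" if "p \<in> G" for p
    using c[OF that] Tfin[of p] by (auto simp: T_def card_gt_0_iff)
  have w0: "w p r \<ge> 0" for p r
    unfolding w_def using eps by (auto intro!: add_nonneg_nonneg divide_nonneg_nonneg mult_nonneg_nonneg sum_nonneg)
  have pp: "p > 0" if "p \<in> P" for p using P(2)[OF that] prime_gt_0_nat by blast
  have modR: "x mod int p ^ a p \<in> R p" if "p \<in> P" for p x using pp[OF that] by (simp add: R_def)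
  have finR: "finite (R p)" for p by (simp add: R_def)
  have w1: "(\<Sum>r\<in>R p. w p r) = 1" if p: "p \<in> P" for p
  proof (cases "p \<in> G")
    case True
    have one: "(\<Sum>r\<in>R p. of_bool (r = x mod int p ^ a p)) = (1::real)" for x
      using modR[OF p] finR by (simp add: of_bool_def)
    have "(\<Sum>r\<in>R p. w p r) = (1 - \<epsilon>) * (\<Sum>r\<in>R p. of_bool (r = f (c p) mod int p ^ a p))
        + \<epsilon> / real (card (T p)) * (\<Sum>r\<in>R p. \<Sum>j\<in>T p. of_bool (r = f j mod int p ^ a p))"
      using True by (simp only: w_def if_True sum.distrib sum_distrib_left)
    also have "(\<Sum>r\<in>R p. \<Sum>j\<in>T p. of_bool (r = f j mod int p ^ a p)) = (\<Sum>j\<in>T p. (1::real))"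
      by (subst sum.swap) (simp only: one)
    also have "(\<Sum>j\<in>T p. (1::real)) = real (card (T p))" by simp
    finally show ?thesis unfolding one using Tpos[OF True] by simp
  next
    case False
    thus ?thesis using pp[OF p] by (simp add: w_def R_def flip: of_nat_power)
  qed
  \<comment> \<open>Lower bounds for the measures of the sets \<open>A i p\<close>. When
    \<open>p \<in> G\<close> divides the period of an unfavoured \<open>i\<close>, the point mass at
    its own residue suffices: it is at least \<open>\<epsilon> / card (T p) \<ge> 1 / p\<close> by
    the assumption \<open>few\<close>.\<close>
  define u where "u i p = (if p \<in> G \<and> c p = i then 1 - \<epsilon> else 1 / real (p ^ multiplicity p (\<pi> i)))" for i p
  have u_le: "u i p \<le> (\<Sum>r\<in>A i p. w p r)" if i: "i \<in> I" and p: "p \<in> P" for i p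
  proof -
    have finA: "finite (A i p)" using finR[of p] by (simp add: A_def)
    define r0 where "r0 = f i mod int p ^ a p"
    have r0: "r0 \<in> A i p"
      using modR[OF p] a[OF i, of p] by (auto simp: A_def r0_def cong_def mod_mod_cancel le_imp_power_dvd)
    have r0le: "w p r0 \<le> (\<Sum>r\<in>A i p. w p r)"
      using r0 finA w0 by (intro member_le_sum) auto
    consider "p \<in> G" "c p = i" | "p \<in> G" "c p \<noteq> i" "p dvd \<pi> i" | "p \<in> G" "c p \<noteq> i" "\<not> p dvd \<pi> i" | "p \<notin> G" by blast
    thus ?thesis
    proof cases
      case 1
      have "1 - \<epsilon> \<le> w p r0" using 1 eps by (auto simp: w_def r0_def intro!: divide_nonneg_nonneg mult_nonneg_nonneg sum_nonneg)
      thus ?thesis using r0le 1 by (simp add: u_def)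
    next
      case 2
      have iT: "i \<in> T p" using 2 i by (simp add: T_def)
      have "1 / real (p ^ multiplicity p (\<pi> i)) \<le> 1 / real p"
      proof -
        have "multiplicity p (\<pi> i) \<ge> 1" using 2 P(2)[OF p] pos[OF i]
          by (metis One_nat_def Suc_leI multiplicity_gt_zero_iff not_prime_unit not_gr_zero)
        hence "p ^ 1 \<le> p ^ multiplicity p (\<pi> i)" using pp[OF p] by (intro power_increasing) auto
        hence "real p \<le> real (p ^ multiplicity p (\<pi> i))" unfolding of_nat_le_iff by simp
        thus ?thesis using pp[OF p] by (intro divide_left_mono) auto
      qed
      also have "\<dots> \<le> \<epsilon> / real (card (T p))"
        using few[OF 2(1)] Tpos[OF 2(1)] pp[OF p] by (simp add: field_simps T_def)
      also have "\<dots> \<le> \<epsilon> / real (card (T p)) * (\<Sum>j\<in>T p. of_bool (r0 = f j mod int p ^ a p))"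
      proof -
        have "of_bool (r0 = f i mod int p ^ a p) \<le> (\<Sum>j\<in>T p. of_bool (r0 = f j mod int p ^ a p) :: real)"
          using iT Tfin by (intro member_le_sum) auto
        hence "1 \<le> (\<Sum>j\<in>T p. of_bool (r0 = f j mod int p ^ a p) :: real)" by (simp add: r0_def)
        from mult_left_mono[OF this, of "\<epsilon> / real (card (T p))"] show ?thesis using eps by simp
      qed
      also have "\<dots> \<le> w p r0" using 2 eps by (simp add: w_def)
      finally show ?thesis using r0le 2 by (simp add: u_def)
    next
      case 3
      hence "multiplicity p (\<pi> i) = 0" by (simp add: not_dvd_imp_multiplicity_0)
      hence "A i p = R p" by (auto simp: A_def)
      thus ?thesis using w1[OF p] \<open>multiplicity p (\<pi> i) = 0\<close> 3 by (simp add: u_def)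
    next
      case 4
      define v where "v = multiplicity p (\<pi> i)"
      have "1 / real (p ^ v) = real (p ^ (a p - v)) / real (p ^ a p)"
      proof -
        have "p ^ a p = p ^ v * p ^ (a p - v)" using a[OF i, of p] by (simp add: v_def flip: power_add)
        thus ?thesis using pp[OF p] by simp
      qed
      also have "\<dots> \<le> real (card (A i p)) / real (p ^ a p)"
        using card_residues_ge[OF pp[OF p] a[OF i, of p], of "f i"]
        unfolding A_def R_def v_def by (intro divide_right_mono) (simp_all del: of_nat_power)
      also have "\<dots> = (\<Sum>r\<in>A i p. w p r)" using 4 by (simp add: w_def)
      finally show ?thesis using 4 by (simp add: u_def v_def)
    qed
  qed
  \<comment> \<open>If no prime separates \<open>i\<close> and \<open>j\<close>, then at every prime
    the smaller of the two prime powers divides \<open>f i - f j\<close>. Hence the gcd of the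
    periods divides it, and the progressions would meet.\<close>
  have sep: "\<exists>p\<in>P. A i p \<inter> A j p = {}" if ij: "i \<in> I" "j \<in> I" "i \<noteq> j" for i j
  proof (rule ccontr)
    assume contr: "\<not> (\<exists>p\<in>P. A i p \<inter> A j p = {})"
    have "int (gcd (\<pi> i) (\<pi> j)) dvd f i - f j"
    proof (cases "f i = f j")
      case False
      define x where "x = nat \<bar>f i - f j\<bar>"
      have x: "x \<noteq> 0" using False by (simp add: x_def)
      have "gcd (\<pi> i) (\<pi> j) dvd x"
      proof (rule multiplicity_le_imp_dvd)
        show "gcd (\<pi> i) (\<pi> j) \<noteq> 0" using pos ij by auto
        fix p :: nat assume p: "prime p"
        define m where "m = multiplicity p (gcd (\<pi> i) (\<pi> j))"
        show "m \<le> multiplicity p x"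
        proof (cases "p \<in> P")
          case True
          then obtain r where r: "r \<in> A i p" "r \<in> A j p" using contr by blast
          have "p ^ m dvd gcd (\<pi> i) (\<pi> j)" unfolding m_def by (rule multiplicity_dvd)
          hence "p ^ m dvd \<pi> i" "p ^ m dvd \<pi> j" using dvd_trans gcd_dvd1 gcd_dvd2 by blast+
          hence le: "m \<le> multiplicity p (\<pi> i)" "m \<le> multiplicity p (\<pi> j)"
            using pos ij p by (auto intro!: multiplicity_geI simp: prime_gt_Suc_0_nat)
          have "[r = f i] (mod int p ^ m)" "[r = f j] (mod int p ^ m)"
            using r le by (auto simp: A_def intro: cong_dvd_modulus le_imp_power_dvd)
          hence "[f i = f j] (mod int p ^ m)" using cong_sym cong_trans by blast
          hence "int (p ^ m) dvd f i - f j" by (simp add: cong_iff_dvd_diff)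
          hence "p ^ m dvd x" unfolding x_def by (metis abs_ge_zero dvd_abs_iff int_dvd_int_iff int_nat_eq)
          thus ?thesis using x p by (intro multiplicity_geI) (auto simp: prime_gt_Suc_0_nat)
        next
          case False
          hence "p \<notin> prime_factors (\<pi> i)" using ij by (auto simp: P_def)
          hence "\<not> p dvd gcd (\<pi> i) (\<pi> j)" using p pos[OF ij(1)] by (auto simp: prime_factors_dvd)
          thus ?thesis by (simp add: m_def not_dvd_imp_multiplicity_0)
        qed
      qed
      thus ?thesis unfolding x_def by (metis abs_ge_zero dvd_abs_iff int_dvd_int_iff int_nat_eq)
    qed simp
    from gcd_dvd_imp_arith_prog_inter[OF this] show False
      using disj ij by (auto simp: disjoint_family_on_def)
  qed
  have "(\<Sum>i\<in>I. \<Prod>p\<in>P. u i p) \<le> (\<Sum>i\<in>I. \<Prod>p\<in>P. \<Sum>r\<in>A i p. w p r)"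
    using u_le eps by (intro sum_mono prod_mono) (auto simp: u_def)
  also have "\<dots> \<le> 1"
    by (rule sum_prod_weights_le_1[where R = R]) (use I P finR sep w0 w1 in \<open>auto simp: A_def\<close>)
  \<comment> \<open>Primes not assigned to \<open>i\<close> contribute the reciprocals of their
    powers in \<open>\<pi> i\<close>; completing these to \<open>1 / \<pi> i\<close> leaves the
    assigned prime powers in the numerator.\<close>
  also have "(\<Sum>i\<in>I. \<Prod>p\<in>P. u i p) = (\<Sum>i\<in>I. (1 - \<epsilon>) ^ card {p\<in>G. c p = i} *
            real (\<Prod>p\<in>{p\<in>G. c p = i}. p ^ multiplicity p (\<pi> i)) / real (\<pi> i))"
  proof (intro sum.cong refl)
    fix i assume i: "i \<in> I"
    define H where "H = {p\<in>G. c p = i}"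
    have H: "H \<subseteq> P" using GP by (auto simp: H_def)
    have split: "(\<Prod>p\<in>P. g p) = (\<Prod>p\<in>P - H. g p) * (\<Prod>p\<in>H. g p)" for g :: "nat \<Rightarrow> real"
      using prod.subset_diff[OF H P(1)] by simp
    have "prime_factors (\<pi> i) \<subseteq> P" using i by (auto simp: P_def)
    from prod_prime_power_multiplicity[OF pos[OF i] P(1) this P(2)]
    have e: "(\<Prod>p\<in>P. p ^ multiplicity p (\<pi> i)) = \<pi> i" .
    have "real (\<pi> i) = real (\<Prod>p\<in>P. p ^ multiplicity p (\<pi> i))" unfolding e ..
    also have "\<dots> = (\<Prod>p\<in>P. real (p ^ multiplicity p (\<pi> i)))" by (rule of_nat_prod)
    finally have "real (\<pi> i) = (\<Prod>p\<in>P. real (p ^ multiplicity p (\<pi> i)))" .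
    hence pi: "real (\<pi> i) = (\<Prod>p\<in>P - H. real (p ^ multiplicity p (\<pi> i))) * (\<Prod>p\<in>H. real (p ^ multiplicity p (\<pi> i)))"
      unfolding split .
    have "(\<Prod>p\<in>H. u i p) = (\<Prod>p\<in>H. 1 - \<epsilon>)" by (intro prod.cong) (auto simp: u_def H_def)
    hence "(\<Prod>p\<in>P. u i p) = (\<Prod>p\<in>P - H. 1 / real (p ^ multiplicity p (\<pi> i))) * (1 - \<epsilon>) ^ card H"
      unfolding split by (simp, intro disjI2 prod.cong) (auto simp: u_def H_def)
    also have "\<dots> = (1 - \<epsilon>) ^ card H / (\<Prod>p\<in>P - H. real (p ^ multiplicity p (\<pi> i)))"
      by (simp add: prod_dividef)
    also have "\<dots> = (1 - \<epsilon>) ^ card H * real (\<Prod>p\<in>H. p ^ multiplicity p (\<pi> i)) / real (\<pi> i)"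
    proof -
      have "(\<Prod>p\<in>H. real (p ^ multiplicity p (\<pi> i))) \<noteq> 0"
        using H pp P(1) finite_subset[OF H P(1)] by (auto simp: prod_zero_iff)
      thus ?thesis unfolding pi of_nat_prod by simp
    qed
    finally show "(\<Prod>p\<in>P. u i p) = (1 - \<epsilon>) ^ card {p\<in>G. c p = i} *
            real (\<Prod>p\<in>{p\<in>G. c p = i}. p ^ multiplicity p (\<pi> i)) / real (\<pi> i)" by (simp add: H_def)
  qed
  finally show ?thesis .
qed

theorem prime_number_theorem: "((\<lambda>x. chebyshev_theta x / x) \<longlongrightarrow> 1) at_top"
  by (rule theta_asymp[OF psi_asymp[OF summable_psi_error]])

section \<open>Sums over primes and over coprime families\<close>

lemma theta_scaled_asymp:
  assumes "b > 0"
  shows "((\<lambda>x. chebyshev_theta (x * b) / x) \<longlongrightarrow> b) at_top"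
proof -
  have "filterlim (\<lambda>x. x * b) at_top at_top" using assms by real_asymp
  from tendsto_mult[OF filterlim_compose[OF prime_number_theorem this] tendsto_const[of b]]
  have "((\<lambda>x. chebyshev_theta (x * b) / (x * b) * b) \<longlongrightarrow> b) at_top" by simp
  thus ?thesis using assms by simp
qed

lemma theta_diff:
  assumes "a \<le> b"
  shows "chebyshev_theta b - chebyshev_theta a = (\<Sum>p | prime p \<and> a < real p \<and> real p \<le> b. ln (real p))"
proof -
  have "{p. prime p \<and> real p \<le> b} = {p. prime p \<and> real p \<le> a} \<union> {p. prime p \<and> a < real p \<and> real p \<le> b}"
    using assms by auto
  moreover have "finite {p. prime p \<and> a < real p \<and> real p \<le> b}"
    by (rule finite_subset[OF _ finite_primes_le[of b]]) auto
  ultimately show ?thesis unfolding chebyshev_theta_def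
    using finite_primes_le[of a] by (simp add: sum.union_disjoint disjoint_iff)
qed

text \<open>Cutting at squares makes the values of \<open>sqrt (p / x)\<close> equidistant: on block
  \<open>j\<close> they lie between \<open>(j - 1) / J\<close> and \<open>j / J\<close>. Sums of
  square roots become Riemann sums with rational coefficients.\<close>

definition prime_block :: "real \<Rightarrow> nat \<Rightarrow> nat \<Rightarrow> nat set" where
  "prime_block x J j = {p. prime p \<and> x * (real (j - 1) / real J)^2 < real p \<and> real p \<le> x * (real j / real J)^2}"

lemma finite_prime_block: "finite (prime_block x J j)"
  unfolding prime_block_def by (rule finite_subset[OF _ finite_primes_le[of "x * (real j / real J)^2"]]) auto

lemma prime_block_theta:
  assumes "x \<ge> 0"
  shows "(\<Sum>p\<in>prime_block x J j. ln (real p)) =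
    chebyshev_theta (x * (real j / real J)^2) - chebyshev_theta (x * (real (j - 1) / real J)^2)"
  unfolding prime_block_def
  by (rule theta_diff[symmetric]) (use assms in \<open>auto intro!: mult_left_mono power_mono divide_right_mono\<close>)

lemma prime_block_disjoint:
  assumes "x \<ge> 0" "i \<noteq> j" "i > 0" "j > 0"
  shows "prime_block x J i \<inter> prime_block x J j = {}"
proof -
  have aux: "prime_block x J i \<inter> prime_block x J j = {}" if "i < j" for i j
  proof -
    have "x * (real i / real J)^2 \<le> x * (real (j - 1) / real J)^2"
      using that assms(1) by (intro mult_left_mono power_mono divide_right_mono) auto
    thus ?thesis unfolding prime_block_def by auto
  qed
  show ?thesis using aux[of i j] aux[of j i] assms(2) by (metis Int_commute nat_neq_iff)
qed

lemma prime_block_theta_asymp: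
  assumes "J > 0" "j \<ge> 2"
  shows "((\<lambda>x. (\<Sum>p\<in>prime_block x J j. ln (real p)) / x) \<longlongrightarrow> real (2 * j - 1) / real J ^ 2) at_top"
proof -
  have "((\<lambda>x. chebyshev_theta (x * (real j / real J)^2) / x - chebyshev_theta (x * (real (j - 1) / real J)^2) / x)
     \<longlongrightarrow> (real j / real J)^2 - (real (j - 1) / real J)^2) at_top"
    using assms by (intro tendsto_diff theta_scaled_asymp) auto
  also have "(real j / real J)^2 - (real (j - 1) / real J)^2 = real (2 * j - 1) / real J ^ 2"
    using assms by (simp add: power_divide diff_divide_distrib[symmetric] of_nat_diff power2_eq_square algebra_simps)
  finally show ?thesis
  proof (rule Lim_transform_eventually)
    show "\<forall>\<^sub>F x in at_top. chebyshev_theta (x * (real j / real J)^2) / x - chebyshev_theta (x * (real (j - 1) / real J)^2) / x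
       = (\<Sum>p\<in>prime_block x J j. ln (real p)) / x"
      using eventually_ge_at_top[of 0]
      by eventually_elim (simp only: prime_block_theta diff_divide_distrib)
  qed
qed

text \<open>\<open>sqrt t / ln t\<close> is increasing from \<open>exp 2\<close> on; the proof needs
  only \<open>ln y \<le> y - 1\<close> at \<open>y = sqrt t / sqrt s\<close>.\<close>

lemma sqrt_ln_mono:
  assumes "ln s \<ge> (2::real)" "0 < s" "s \<le> t"
  shows "sqrt s * ln t \<le> sqrt t * ln s"
proof -
  have t: "t > 0" using assms by linarith
  have "ln t - ln s = 2 * ln (sqrt t / sqrt s)" using assms t by (simp add: ln_div ln_sqrt)
  also have "\<dots> \<le> 2 * (sqrt t / sqrt s - 1)" using assms t by (intro mult_left_mono ln_le_minus_one) auto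
  also have "\<dots> \<le> ln s * (sqrt t / sqrt s - 1)" using assms t by (intro mult_right_mono) (auto simp: field_simps)
  finally have "ln t \<le> ln s * (sqrt t / sqrt s)" by (simp add: algebra_simps)
  from mult_left_mono[OF this, of "sqrt s"] show ?thesis using assms by (simp add: mult.commute)
qed

text \<open>The derivative \<open>1 / (2 * sqrt t) - l / t\<close> is nonnegative exactly when
  \<open>sqrt t \<ge> 2 * l\<close>, whence the threshold \<open>4 * l^2\<close>.\<close>

lemma sqrt_minus_ln_mono:
  assumes "4 * l^2 \<le> s" "s \<le> t" "0 < s" "(l::real) \<ge> 0"
  shows "sqrt s - l * ln s \<le> sqrt t - l * ln t"
proof -
  have t: "t > 0" using assms by linarith
  have ls: "2 * l \<le> sqrt s" using assms real_le_rsqrt[of "2 * l" s] by (simp add: power_mult_distrib)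
  have "ln t - ln s = 2 * ln (sqrt t / sqrt s)" using assms t by (simp add: ln_div ln_sqrt)
  also have "\<dots> \<le> 2 * (sqrt t / sqrt s - 1)" using assms t by (intro mult_left_mono ln_le_minus_one) auto
  finally have "l * (ln t - ln s) \<le> l * (2 * (sqrt t / sqrt s - 1))" using assms by (intro mult_left_mono) auto
  also have "\<dots> = (2 * l) * ((sqrt t - sqrt s) / sqrt s)" using assms by (simp add: field_simps)
  also have "\<dots> \<le> sqrt s * ((sqrt t - sqrt s) / sqrt s)" using assms ls by (intro mult_right_mono) auto
  also have "\<dots> = sqrt t - sqrt s" using assms by simp
  finally show ?thesis by (simp add: algebra_simps)
qed

text \<open>
  A Lagrange multiplier argument: among coprime families with given product, \<open>\<Sum> sqrt q\<close> is smallest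
  essentially for the family of all primes up to the logarithm of the product.
\<close>
lemma sum_sqrt_coprime_ge:
  fixes q :: "'a \<Rightarrow> nat" and x l :: real
  assumes I: "finite I" and q: "\<And>i. i \<in> I \<Longrightarrow> q i > 1"
    and cop: "\<And>i j. i \<in> I \<Longrightarrow> j \<in> I \<Longrightarrow> i \<noteq> j \<Longrightarrow> coprime (q i) (q j)"
    and x: "ln x \<ge> 2" "x > 0" and l: "l = sqrt x / ln x" and big: "ln (4 * l^2) \<ge> 2"
  shows "(\<Sum>i\<in>I. sqrt (q i)) \<ge> l * ((\<Sum>i\<in>I. ln (q i)) - chebyshev_theta x)
     + (\<Sum>p | prime p \<and> 4 * l^2 < real p \<and> real p \<le> x. sqrt p) - 4 * l^2 * (l * ln x)"
proof -
  \<comment> \<open>The Lagrangian. The multiplier \<open>l = sqrt x / ln x\<close> is chosen so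
    that \<open>h x = 0\<close>; then \<open>h\<close> is nonnegative beyond \<open>x\<close> and
    nonpositive between \<open>4 * l^2\<close> and \<open>x\<close>.\<close>
  define h where "h t = sqrt t - l * ln t" for t :: real
  have l0: "l > 0" using x unfolding l by (intro divide_pos_pos real_sqrt_gt_zero) linarith+
  have s0: "4 * l^2 > 0" using l0 by simp
  have lx0: "l * ln x \<ge> 0" using l0 x(1) by (intro mult_nonneg_nonneg) linarith+
  have h_ge: "h t \<ge> 0" if "t \<ge> x" for t
  proof -
    have "l * ln t = sqrt x * ln t / ln x" by (simp add: l)
    also have "\<dots> \<le> sqrt t * ln x / ln x"
      using sqrt_ln_mono[OF x that] x(1) by (intro divide_right_mono) linarith+
    finally show ?thesis using x by (cases "x = 1") (simp_all add: h_def)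
  qed
  have h_le: "h t \<le> 0" if "4 * l^2 < t" "t \<le> x" for t
  proof -
    have "ln t \<ge> 2" using that big s0 by (meson less_eq_real_def ln_mono order_trans less_trans)
    hence "sqrt t * ln x \<le> sqrt x * ln t" using that s0 by (intro sqrt_ln_mono) linarith+
    moreover have "ln x > 0" using x(1) by linarith
    ultimately have "sqrt t \<le> sqrt x * ln t / ln x" by (simp only: pos_le_divide_eq)
    thus ?thesis by (simp add: h_def l)
  qed
  have "\<exists>p. prime p \<and> p dvd q i" if "i \<in> I" for i
    using q[OF that] prime_factor_nat[of "q i"] by auto
  \<comment> \<open>One prime divisor is selected from each \<open>q i\<close>; coprimality makes
    the selection injective, so the family can be compared with the set of all primes.\<close>
  then obtain P where P: "\<And>i. i \<in> I \<Longrightarrow> prime (P i)" "\<And>i. i \<in> I \<Longrightarrow> P i dvd q i" by metis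
  have inj: "inj_on P I"
  proof (rule inj_onI, rule ccontr)
    fix i j assume ij: "i \<in> I" "j \<in> I" "P i = P j" "i \<noteq> j"
    hence "P i dvd gcd (q i) (q j)" using P by (metis gcd_greatest)
    thus False using cop[OF ij(1,2,4)] P(1)[OF ij(1)] by (metis coprime_imp_gcd_eq_1 not_prime_unit)
  qed
  define S where "S = {p. prime p \<and> 4 * l^2 < real p \<and> real p \<le> x}"
  have finS: "finite S" unfolding S_def by (rule finite_subset[OF _ finite_primes_le[of x]]) auto
  define A where "A = {i\<in>I. P i \<in> S}"
  define B where "B = {i\<in>I. real (P i) \<le> 4 * l^2}"
  \<comment> \<open>Three cases: for \<open>q i \<ge> x\<close> the left side is nonnegative, below
    \<open>x\<close> the increase of \<open>h\<close> allows \<open>q i\<close> to be replaced by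
    its prime \<open>P i\<close>, and a prime below \<open>4 * l^2\<close>, where \<open>h\<close>
    need not increase, is charged the crude amount \<open>l * ln x\<close>.\<close>
  have key: "h (q i) \<ge> (if P i \<in> S then h (P i) else 0) + (if real (P i) \<le> 4 * l^2 then - (l * ln x) else 0)"
    if i: "i \<in> I" for i
  proof (cases "real (q i) \<ge> x")
    case True
    have "(if P i \<in> S then h (P i) else 0) \<le> 0" using h_le by (simp add: S_def)
    moreover have "(if real (P i) \<le> 4 * l^2 then - (l * ln x) else 0) \<le> 0" using lx0 by simp
    ultimately show ?thesis using h_ge[OF True] by linarith
  next
    case False
    have le: "P i \<le> q i" using P(2)[OF i] q[OF i] by (intro dvd_imp_le) auto
    have Px: "real (P i) \<le> x" using False le by linarith
    show ?thesis
    proof (cases "real (P i) \<le> 4 * l^2")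
      case True
      have "l * ln (q i) \<le> l * ln x" using False q[OF i] l0 by (intro mult_left_mono ln_mono) auto
      moreover have "sqrt (q i) \<ge> 0" by simp
      ultimately have "h (q i) \<ge> - (l * ln x)" unfolding h_def by linarith
      thus ?thesis using True by (simp add: S_def)
    next
      case gt: False
      hence PS: "P i \<in> S" using P(1)[OF i] Px by (simp add: S_def)
      have "real (P i) \<le> real (q i)" using le by simp
      hence "h (P i) \<le> h (q i)" unfolding h_def
        using gt l0 s0 by (intro sqrt_minus_ln_mono) linarith+
      thus ?thesis using PS gt by simp
    qed
  qed
  \<comment> \<open>Primes of \<open>S\<close> that are not selected only lower the sum, as
    \<open>h\<close> is nonpositive on \<open>S\<close>.\<close>
  have "(\<Sum>p\<in>P ` A. - h p) \<le> (\<Sum>p\<in>S. - h p)"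
    by (rule sum_mono2) (use finS h_le in \<open>auto simp: A_def S_def\<close>)
  hence "(\<Sum>p\<in>S. h p) \<le> (\<Sum>p\<in>P ` A. h p)" by (simp add: sum_negf)
  also have "\<dots> = (\<Sum>i\<in>A. h (P i))"
    using inj by (subst sum.reindex) (auto simp: A_def inj_on_def)
  also have "\<dots> = (\<Sum>i\<in>I. if P i \<in> S then h (P i) else 0)"
    unfolding A_def by (rule sum.inter_filter[OF I])
  finally have 1: "(\<Sum>p\<in>S. h p) \<le> (\<Sum>i\<in>I. if P i \<in> S then h (P i) else 0)" .
  have "card B = card (P ` B)" using inj by (subst card_image) (auto simp: B_def inj_on_def)
  also have "\<dots> \<le> card {1..nat \<lfloor>4 * l^2\<rfloor>}"
    using P(1) by (intro card_mono) (auto simp: B_def le_nat_floor Suc_le_eq prime_gt_0_nat)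
  finally have "card B \<le> nat \<lfloor>4 * l^2\<rfloor>" by simp
  hence "real (card B) \<le> real (nat \<lfloor>4 * l^2\<rfloor>)" by (simp only: of_nat_le_iff)
  also have "\<dots> \<le> 4 * l^2" by (rule of_nat_floor) simp
  finally have "4 * l^2 * (- (l * ln x)) \<le> real (card B) * (- (l * ln x))"
    using lx0 by (intro mult_right_mono_neg) auto
  also have "\<dots> = (\<Sum>i\<in>I. if real (P i) \<le> 4 * l^2 then - (l * ln x) else 0)"
    unfolding B_def using I by (subst sum.inter_filter[symmetric]) auto
  finally have 2: "- (4 * l^2 * (l * ln x)) \<le> (\<Sum>i\<in>I. if real (P i) \<le> 4 * l^2 then - (l * ln x) else 0)" by simp
  have 3: "(\<Sum>i\<in>I. h (q i)) = (\<Sum>i\<in>I. sqrt (q i)) - l * (\<Sum>i\<in>I. ln (q i))"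
    unfolding h_def by (simp add: sum_subtractf sum_distrib_left)
  have 4: "(\<Sum>p\<in>S. h p) = (\<Sum>p\<in>S. sqrt p) - l * (\<Sum>p\<in>S. ln p)"
    unfolding h_def by (simp add: sum_subtractf sum_distrib_left)
  have "(\<Sum>p\<in>S. ln (real p)) \<le> chebyshev_theta x"
    unfolding chebyshev_theta_def S_def using prime_gt_0_nat
    by (intro sum_mono2 finite_primes_le) (auto intro!: ln_ge_zero simp: Suc_le_eq)
  hence 5: "l * (\<Sum>p\<in>S. ln (real p)) \<le> l * chebyshev_theta x" using l0 by (intro mult_left_mono) auto
  have "(\<Sum>i\<in>I. h (q i)) \<ge> (\<Sum>i\<in>I. (if P i \<in> S then h (P i) else 0) + (if real (P i) \<le> 4 * l^2 then - (l * ln x) else 0))"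
    by (intro sum_mono key)
  hence "(\<Sum>i\<in>I. h (q i)) \<ge> (\<Sum>p\<in>S. h p) - 4 * l^2 * (l * ln x)" using 1 2 by (simp add: sum.distrib)
  thus ?thesis using 3 4 5 unfolding S_def[symmetric] by (simp add: algebra_simps)
qed

lemma sum_block_coeff: "(\<Sum>j=2..J. real (j - 1) * real (2 * j - 1)) = real J * (4 * real J ^ 2 - 3 * real J - 1) / 6" if "J \<ge> 1"
  using that
proof (induction J rule: dec_induct)
  case (step n)
  have "(\<Sum>j=2..Suc n. real (j - 1) * real (2 * j - 1)) = (\<Sum>j=2..n. real (j - 1) * real (2 * j - 1)) + real n * (2 * real n + 1)"
    using step by (simp add: of_nat_diff)
  thus ?case using step by (simp add: field_simps power2_eq_square)
qed simp

text \<open>On block \<open>j\<close> one has \<open>sqrt p \<ge> sqrt x * (j - 1) / J\<close> and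
  \<open>ln p \<le> ln x\<close>, while the block carries \<theta>-mass about
  \<open>x * (2 * j - 1) / J^2\<close>. The resulting Riemann sum approximates the integral of
  \<open>2 * t^2\<close> over [0, 1], which is the constant \<open>2/3\<close>.\<close>

lemma sum_sqrt_primes_ge:
  assumes "\<delta> > 0"
  shows "\<forall>\<^sub>F x in at_top. (\<Sum>p | prime p \<and> 4 * (sqrt x / ln x)^2 < real p \<and> real p \<le> x. sqrt p) \<ge> (2/3 - \<delta>) * (x * sqrt x / ln x)"
proof -
  have "((\<lambda>J. real J * (4 * real J ^ 2 - 3 * real J - 1) / 6 / real J ^ 3) \<longlongrightarrow> 2/3) sequentially" by real_asymp
  hence "\<forall>\<^sub>F J in sequentially. real J * (4 * real J ^ 2 - 3 * real J - 1) / 6 / real J ^ 3 > 2/3 - \<delta>"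
    using assms by (intro order_tendstoD) auto
  hence "\<forall>\<^sub>F J in sequentially. real J * (4 * real J ^ 2 - 3 * real J - 1) / 6 / real J ^ 3 > 2/3 - \<delta> \<and> J \<ge> 2"
    using eventually_ge_at_top[of 2] by eventually_elim auto
  then obtain J where J: "real J * (4 * real J ^ 2 - 3 * real J - 1) / 6 / real J ^ 3 > 2/3 - \<delta>" "J \<ge> 2"
    by (auto simp: eventually_sequentially)
  define T where "T x = (\<Sum>j=2..J. real (j - 1) / real J * ((\<Sum>p\<in>prime_block x J j. ln (real p)) / x))" for x
  have "(T \<longlongrightarrow> (\<Sum>j=2..J. real (j - 1) / real J * (real (2 * j - 1) / real J ^ 2))) at_top"
    unfolding T_def using J by (intro tendsto_sum tendsto_mult tendsto_const prime_block_theta_asymp) auto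
  also have "(\<Sum>j=2..J. real (j - 1) / real J * (real (2 * j - 1) / real J ^ 2)) = (\<Sum>j=2..J. real (j - 1) * real (2 * j - 1)) / real J ^ 3"
    by (simp add: sum_divide_distrib power3_eq_cube power2_eq_square mult_ac)
  also have "\<dots> = real J * (4 * real J ^ 2 - 3 * real J - 1) / 6 / real J ^ 3" using J by (subst sum_block_coeff) auto
  finally have "\<forall>\<^sub>F x in at_top. T x > 2/3 - \<delta>" by (rule order_tendstoD(1)[OF _ J(1)])
  \<comment> \<open>The blocks from 2 on consist of primes above \<open>x / J^2\<close>, and the
    threshold is \<open>4 * x / ln^2 x\<close>, so eventually none of their primes is cut
    off.\<close>
  moreover have "\<forall>\<^sub>F x in at_top. 4 * (sqrt x / ln x)^2 \<le> x * (1 / real J)^2" using J by real_asymp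
  ultimately show ?thesis using eventually_gt_at_top[of 1]
  proof eventually_elim
    case (elim x)
    define S where "S = {p. prime p \<and> 4 * (sqrt x / ln x)^2 < real p \<and> real p \<le> x}"
    have finS: "finite S" unfolding S_def by (rule finite_subset[OF _ finite_primes_le[of x]]) auto
    have sub: "(\<Union>j\<in>{2..J}. prime_block x J j) \<subseteq> S"
    proof
      fix p assume "p \<in> (\<Union>j\<in>{2..J}. prime_block x J j)"
      then obtain j where j: "2 \<le> j" "j \<le> J" "p \<in> prime_block x J j" by auto
      have "x * (1 / real J)^2 \<le> x * (real (j - 1) / real J)^2"
        using j elim by (intro mult_left_mono power_mono divide_right_mono) auto
      moreover have "x * (real j / real J)^2 \<le> x * 1^2"
        using j elim by (intro mult_left_mono power_mono) auto
      moreover have "prime p" "x * (real (j - 1) / real J)^2 < real p" "real p \<le> x * (real j / real J)^2"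
        using j(3) unfolding prime_block_def by blast+
      ultimately show "p \<in> S" using elim(2) unfolding S_def by simp
    qed
    have "(2/3 - \<delta>) * (x * sqrt x / ln x) \<le> T x * (x * sqrt x / ln x)"
      using elim by (intro mult_right_mono) auto
    also have "\<dots> = (\<Sum>j=2..J. \<Sum>p\<in>prime_block x J j. sqrt x * (real (j - 1) / real J) * (ln (real p) / ln x))"
      unfolding T_def using elim
      by (simp add: sum_distrib_left sum_distrib_right sum_divide_distrib mult_ac)
    also have "\<dots> \<le> (\<Sum>j=2..J. \<Sum>p\<in>prime_block x J j. sqrt p)"
    proof (intro sum_mono)
      fix j p assume j: "j \<in> {2..J}" and p: "p \<in> prime_block x J j"
      have pS: "p \<in> S" using sub j p by blast
      have p0: "p > 0" using pS prime_gt_0_nat by (auto simp: S_def)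
      have "sqrt x * (real (j - 1) / real J) * (ln (real p) / ln x) \<le> sqrt x * (real (j - 1) / real J) * 1"
        using pS p0 elim by (intro mult_left_mono) (auto simp: S_def divide_le_eq_1)
      also have "\<dots> \<le> sqrt p"
      proof (rule real_le_rsqrt)
        have "(sqrt x * (real (j - 1) / real J) * 1)^2 = x * (real (j - 1) / real J)^2"
          using elim(3) unfolding mult_1_right by (subst power_mult_distrib, subst real_sqrt_pow2) auto
        thus "(sqrt x * (real (j - 1) / real J) * 1)^2 \<le> real p"
          using p unfolding prime_block_def by simp
      qed
      finally show "sqrt x * (real (j - 1) / real J) * (ln (real p) / ln x) \<le> sqrt p" .
    qed
    also have "\<dots> = (\<Sum>p\<in>(\<Union>j\<in>{2..J}. prime_block x J j). sqrt p)"
      using prime_block_disjoint[of x _ _ J] elim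
      by (intro sum.UNION_disjoint[symmetric]) (auto simp: finite_prime_block)
    also have "\<dots> \<le> (\<Sum>p\<in>S. sqrt p)" using sub finS by (intro sum_mono2) auto
    finally show ?case by (simp add: S_def)
  qed
qed

text \<open>The loss \<open>\<delta>\<close> is shared equally by the error of the prime number
  theorem, the error in the sum over primes, and the primes below \<open>4 * l^2\<close>, which cost
  \<open>4 * x * sqrt x / ln^2 x\<close>.\<close>

lemma sum_sqrt_coprime_asymp:
  assumes d: "\<delta> > 0"
  shows "\<forall>\<^sub>F x in at_top. \<forall>(I :: nat set) (q :: nat \<Rightarrow> nat). finite I \<longrightarrow> (\<forall>i\<in>I. q i > 1) \<longrightarrow>
      (\<forall>i\<in>I. \<forall>j\<in>I. i \<noteq> j \<longrightarrow> coprime (q i) (q j)) \<longrightarrow> (\<Sum>i\<in>I. ln (q i)) \<ge> x \<longrightarrow>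
      (\<Sum>i\<in>I. sqrt (q i)) \<ge> (2/3 - \<delta>) * (x * sqrt x / ln x)"
proof -
  have "\<forall>\<^sub>F x in at_top. chebyshev_theta x / x < 1 + \<delta> / 3"
    using d by (intro order_tendstoD(2)[OF prime_number_theorem]) auto
  moreover have "\<forall>\<^sub>F x in at_top. (\<Sum>p | prime p \<and> 4 * (sqrt x / ln x)^2 < real p \<and> real p \<le> x. sqrt p) \<ge> (2/3 - \<delta>/3) * (x * sqrt x / ln x)"
    using d by (intro sum_sqrt_primes_ge) auto
  moreover have "\<forall>\<^sub>F x::real in at_top. ln x \<ge> 2" by real_asymp
  moreover have "\<forall>\<^sub>F x::real in at_top. ln (4 * (sqrt x / ln x)^2) \<ge> 2" by real_asymp
  moreover have "\<forall>\<^sub>F x::real in at_top. 4 * (sqrt x / ln x)^2 * ((sqrt x / ln x) * ln x) \<le> \<delta> / 3 * (x * sqrt x / ln x)"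
    using d by real_asymp
  ultimately show ?thesis using eventually_gt_at_top[of 0]
  proof eventually_elim
    case (elim x)
    show ?case
    proof (intro allI impI)
      fix I :: "nat set" and q :: "nat \<Rightarrow> nat"
      assume I: "finite I" "\<forall>i\<in>I. q i > 1" "\<forall>i\<in>I. \<forall>j\<in>I. i \<noteq> j \<longrightarrow> coprime (q i) (q j)" and L: "(\<Sum>i\<in>I. ln (q i)) \<ge> x"
      define l where "l = sqrt x / ln x"
      have l0: "l > 0" using elim(3,6) unfolding l_def by (intro divide_pos_pos real_sqrt_gt_zero) linarith+
      have lx: "l * x = x * sqrt x / ln x" by (simp add: l_def)
      have "chebyshev_theta x \<le> x * (1 + \<delta> / 3)" using elim by (simp add: field_simps)
      hence "- (\<delta> / 3) * x \<le> (\<Sum>i\<in>I. ln (q i)) - chebyshev_theta x" using L by (simp add: algebra_simps)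
      from mult_left_mono[OF this, of l]
      have "- (\<delta> / 3) * (x * sqrt x / ln x) \<le> l * ((\<Sum>i\<in>I. ln (q i)) - chebyshev_theta x)"
        using l0 unfolding lx[symmetric] by (simp add: mult_ac)
      moreover have "(\<Sum>i\<in>I. sqrt (q i)) \<ge> l * ((\<Sum>i\<in>I. ln (q i)) - chebyshev_theta x)
         + (\<Sum>p | prime p \<and> 4 * l^2 < real p \<and> real p \<le> x. sqrt p) - 4 * l^2 * (l * ln x)"
        by (rule sum_sqrt_coprime_ge) (use I elim in \<open>auto simp: l_def\<close>)
      moreover have "(2/3 - \<delta>) * (x * sqrt x / ln x) = - (\<delta> / 3) * (x * sqrt x / ln x) +
          (2/3 - \<delta> / 3) * (x * sqrt x / ln x) - \<delta> / 3 * (x * sqrt x / ln x)" by (simp add: algebra_simps)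
      ultimately show "(\<Sum>i\<in>I. sqrt (q i)) \<ge> (2/3 - \<delta>) * (x * sqrt x / ln x)"
        using elim(2,5) unfolding l_def[symmetric] by linarith
    qed
  qed
qed

section \<open>The upper bound\<close>

text \<open>The largest of \<open>k\<close> distinct positive integers is at least \<open>k\<close>.
  The inequality serves to turn a bound on the sum of the exceptional primes into one on their
  number.\<close>

lemma sum_ge_card_squared:
  fixes B :: "nat set"
  assumes "finite B" "0 \<notin> B"
  shows "card B ^ 2 \<le> 2 * \<Sum>B"
  using assms
proof (induction B rule: finite_linorder_max_induct)
  case (insert b A)
  have "A \<subseteq> {1..<b}"
  proof
    fix a assume "a \<in> A"
    thus "a \<in> {1..<b}" using insert by (cases "a = 0") auto
  qed
  hence "card A \<le> card {1..<b}" by (intro card_mono) auto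
  moreover have "b > 0" using insert by (cases "b = 0") auto
  ultimately have le: "card A + 1 \<le> b" by simp
  have "b \<notin> A" using insert by auto
  hence "card (insert b A) ^ 2 = card A ^ 2 + 2 * card A + 1"
    using insert by (simp add: power2_eq_square)
  also have "\<dots> \<le> 2 * \<Sum>A + 2 * b" using insert le by auto
  also have "\<dots> = 2 * \<Sum>(insert b A)" using insert \<open>b \<notin> A\<close> by simp
  finally show ?case .
qed simp

lemma two_power_card_prime_factors_le:
  assumes "n > (0::nat)"
  shows "2 ^ card (prime_factors n) \<le> n"
proof -
  have "2 ^ card (prime_factors n) = (\<Prod>p\<in>prime_factors n. (2::nat))" by simp
  also have "\<dots> \<le> (\<Prod>p\<in>prime_factors n. p ^ multiplicity p n)"
  proof (intro prod_mono conjI)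
    fix p assume p: "p \<in> prime_factors n"
    hence "multiplicity p n \<ge> 1" "p \<ge> 2" by (auto simp: prime_factors_multiplicity prime_ge_2_nat Suc_le_eq)
    hence "2 ^ 1 \<le> p ^ multiplicity p n"
      by (meson order_trans power_increasing power_mono one_le_numeral zero_le_numeral)
    thus "2 \<le> p ^ multiplicity p n" by simp
  qed simp
  also have "\<dots> = n" using assms by (intro prime_factorization_nat[symmetric])
  finally show ?thesis .
qed

lemma card_prime_factors_le:
  assumes "m > (0::nat)" "m \<le> n"
  shows "real (card (prime_factors m)) \<le> log 2 (real n)"
proof -
  have "2 ^ card (prime_factors m) \<le> n" using two_power_card_prime_factors_le[OF assms(1)] assms by simp
  hence "2 ^ card (prime_factors m) \<le> real n" by (metis of_nat_le_iff of_nat_power of_nat_numeral)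
  thus ?thesis using assms by (simp add: le_log_iff powr_realpow)
qed

lemma sum_sqrt_squared_le:
  fixes q \<pi> :: "'a \<Rightarrow> real"
  assumes pos: "\<And>i. i \<in> I \<Longrightarrow> \<pi> i > 0" "\<And>i. i \<in> I \<Longrightarrow> q i \<ge> 0"
  shows "(\<Sum>i\<in>I. sqrt (q i))^2 \<le> (\<Sum>i\<in>I. q i / \<pi> i) * (\<Sum>i\<in>I. \<pi> i)"
proof -
  have "(\<Sum>i\<in>I. sqrt (q i))^2 = (\<Sum>i\<in>I. sqrt (q i / \<pi> i) * sqrt (\<pi> i))^2"
  proof (intro arg_cong[where f = "\<lambda>x. x^2"] sum.cong refl)
    fix i assume "i \<in> I"
    thus "sqrt (q i) = sqrt (q i / \<pi> i) * sqrt (\<pi> i)" using pos(1)[of i] by (simp flip: real_sqrt_mult)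
  qed
  also have "\<dots> \<le> (\<Sum>i\<in>I. (sqrt (q i / \<pi> i))^2) * (\<Sum>i\<in>I. (sqrt (\<pi> i))^2)" by (rule Cauchy_Schwarz_ineq_sum)
  also have "(\<Sum>i\<in>I. (sqrt (q i / \<pi> i))^2) = (\<Sum>i\<in>I. q i / \<pi> i)"
    using pos by (intro sum.cong refl real_sqrt_pow2 divide_nonneg_pos) auto
  also have "(\<Sum>i\<in>I. (sqrt (\<pi> i))^2) = (\<Sum>i\<in>I. \<pi> i)"
    using pos(1) by (intro sum.cong refl real_sqrt_pow2) (auto intro: less_imp_le)
  finally show ?thesis .
qed

text \<open>
  Up to a factor \<open>b\<close> of the least common multiple, consisting of few prime powers, the periods
  can be replaced by pairwise coprime divisors \<open>q i\<close> satisfying an almost optimal density bound.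
\<close>
lemma coprime_reduction:
  fixes \<pi> :: "nat \<Rightarrow> nat" and f :: "nat \<Rightarrow> int" and \<epsilon> :: real and n :: nat
  assumes I: "finite I" "I \<noteq> {}" and pos: "\<And>i. i \<in> I \<Longrightarrow> \<pi> i > 0" and n: "(\<Sum>i\<in>I. \<pi> i) \<le> n"
    and disj: "disjoint_family_on (\<lambda>i. arith_prog (f i) (\<pi> i)) I"
    and eps: "0 < \<epsilon>" "\<epsilon> * log 2 (real n) < 1" "\<epsilon> < 1"
  shows "\<exists>q. (\<forall>i\<in>I. q i > 0) \<and> (\<forall>i\<in>I. \<forall>j\<in>I. i \<noteq> j \<longrightarrow> coprime (q i) (q j)) \<and>
     (\<Sum>i\<in>I. sqrt (real (q i)))^2 \<le> real n / (1 - \<epsilon> * log 2 (real n)) \<and>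
     ln (real (Lcm (\<pi> ` I))) \<le> (\<Sum>i\<in>I. ln (real (q i))) + sqrt (2 * sqrt (real n) * log 2 (real n) / \<epsilon>) * ln (real n)"
proof -
  have le_n: "\<pi> i \<le> n" if "i \<in> I" for i
    using member_le_sum[OF that, of \<pi>] I n by simp
  have n0: "n > 0" using I pos le_n by (metis all_not_in_conv gr0I le_zero_eq not_gr0)
  have sumn: "(\<Sum>i\<in>I. real (\<pi> i)) \<le> real n" using n by (metis of_nat_le_iff of_nat_sum)
  have lg: "log 2 (real n) \<ge> 0" using n0 by simp
  \<comment> \<open>With no favoured primes the weight inequality is the density bound, that the sum
    of the reciprocal periods is at most 1. Cauchy-Schwarz then gives
    \<open>card I ^ 2 \<le> n\<close>.\<close>
  have card_I: "real (card I) \<le> sqrt (real n)"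
  proof -
    have "(\<Sum>i\<in>I. 1 / real (\<pi> i)) \<le> 1"
      using disjoint_progressions_weight[OF I(1) pos disj eps(1,3), of "{}"] by simp
    moreover have "(\<Sum>i\<in>I. sqrt 1)^2 \<le> (\<Sum>i\<in>I. 1 / real (\<pi> i)) * (\<Sum>i\<in>I. real (\<pi> i))"
      using pos by (intro sum_sqrt_squared_le) auto
    moreover have "(\<Sum>i\<in>I. 1 / real (\<pi> i)) * (\<Sum>i\<in>I. real (\<pi> i)) \<le> 1 * real n"
      using calculation sumn by (intro mult_mono) (auto intro!: sum_nonneg)
    moreover have "(\<Sum>i\<in>I. sqrt 1) = real (card I)" by simp
    ultimately have "real (card I) ^ 2 \<le> real n" by (simp only:)
    thus ?thesis by (rule real_le_rsqrt)
  qed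
  define N where "N = Lcm (\<pi> ` I)"
  have N0: "N > 0"
    unfolding N_def neq0_conv[symmetric] Lcm_0_iff[OF finite_imageI[OF I(1)]]
    using pos by (metis imageE less_irrefl)
  define Q where "Q = prime_factors N"
  have Q: "finite Q" "\<And>p. p \<in> Q \<Longrightarrow> prime p" by (auto simp: Q_def)
  have piN: "\<pi> i dvd N" if "i \<in> I" for i using that by (auto simp: N_def)
  define a where "a p = Max ((\<lambda>i. multiplicity p (\<pi> i)) ` I)" for p
  have "\<exists>i\<in>I. multiplicity p (\<pi> i) = a p" for p
  proof -
    have "a p \<in> (\<lambda>i. multiplicity p (\<pi> i)) ` I" unfolding a_def using I by (intro Max_in) auto
    thus ?thesis by auto
  qed
  \<comment> \<open>\<open>c p\<close> is a period that carries the full power of \<open>p\<close>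
    occurring in the lcm; that power is credited to this index alone.\<close>
  then obtain c where c: "\<And>p. c p \<in> I" "\<And>p. multiplicity p (\<pi> (c p)) = a p" by metis
  have a_max: "multiplicity p (\<pi> i) \<le> a p" if "i \<in> I" for i p
    unfolding a_def using I that by (intro Max_ge) auto
  have N_dvd: "N dvd (\<Prod>p\<in>Q. p ^ a p)"
    unfolding N_def
  proof (rule Lcm_least)
    fix b assume "b \<in> \<pi> ` I"
    then obtain i where i: "i \<in> I" "b = \<pi> i" by auto
    have "prime_factors (\<pi> i) \<subseteq> Q" unfolding Q_def using piN[OF i(1)] N0 by (intro dvd_prime_factors) auto
    hence "\<pi> i = (\<Prod>p\<in>Q. p ^ multiplicity p (\<pi> i))"
      using prod_prime_power_multiplicity[OF pos[OF i(1)] Q(1) _ Q(2)] by simp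
    also have "\<dots> dvd (\<Prod>p\<in>Q. p ^ a p)" using a_max[OF i(1)] by (intro prod_dvd_prod le_imp_power_dvd)
    finally show "b dvd (\<Prod>p\<in>Q. p ^ a p)" using i by simp
  qed
  have pp: "p > 0" if "p \<in> Q" for p using Q(2)[OF that] prime_gt_0_nat by blast
  have "N \<le> (\<Prod>p\<in>Q. p ^ a p)" using N_dvd pp by (intro dvd_imp_le) (auto intro!: prod_pos)
  hence "ln (real N) \<le> ln (real (\<Prod>p\<in>Q. p ^ a p))" using N0 by (intro ln_mono) (auto simp del: of_nat_prod of_nat_power)
  also have "\<dots> = (\<Sum>p\<in>Q. ln (real (p ^ a p)))"
    unfolding of_nat_prod using Q pp by (subst ln_prod) auto
  finally have lnN: "ln (real N) \<le> (\<Sum>p\<in>Q. ln (real (p ^ a p)))" .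
  define t where "t p = card {i\<in>I. p dvd \<pi> i}" for p
  \<comment> \<open>The primes to which the neutralising measure applies; the complement
    \<open>B\<close> is dropped from the lcm.\<close>
  define G where "G = {p\<in>Q. real (t p) \<le> \<epsilon> * real p}"
  define B where "B = {p\<in>Q. \<not> real (t p) \<le> \<epsilon> * real p}"
  have GB: "Q = G \<union> B" "G \<inter> B = {}" "finite G" "finite B" using Q by (auto simp: G_def B_def)
  have cdvd: "p dvd \<pi> (c p)" if "p \<in> Q" for p
  proof (rule ccontr)
    assume "\<not> p dvd \<pi> (c p)"
    have pr: "prime p" using Q(2)[OF that] .
    from \<open>\<not> p dvd \<pi> (c p)\<close> have "a p = 0" using c(2)[of p] by (simp add: not_dvd_imp_multiplicity_0)
    have "p dvd N" using that by (auto simp: Q_def)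
    hence "p dvd (\<Prod>r\<in>Q. r ^ a r)" using N_dvd dvd_trans by blast
    then obtain r where r: "r \<in> Q" "p dvd r ^ a r"
      using Q(1) pr by (metis prime_dvd_prod_iff)
    hence "p = r" using pr Q(2)[OF r(1)] by (metis prime_dvd_power primes_dvd_imp_eq)
    thus False using r \<open>a p = 0\<close> pr by simp
  qed
  have ln_pa: "ln (real (p ^ a p)) \<le> ln (real n)" if "p \<in> Q" for p
  proof -
    have "p ^ a p dvd \<pi> (c p)" using c(2)[of p] multiplicity_dvd[of p "\<pi> (c p)"] by simp
    hence "p ^ a p \<le> n" using pos[OF c(1)] le_n[OF c(1)] by (meson dvd_imp_le order_trans)
    thus ?thesis using pp[OF that] by (intro ln_mono) (simp_all del: of_nat_power)
  qed
  \<comment> \<open>On \<open>B\<close> one has \<open>p < t p / \<epsilon>\<close>. The sum of the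
    \<open>t p\<close> counts pairs of a period and one of its primes in \<open>B\<close>, hence is
    at most \<open>card I * log 2 n\<close>.\<close>
  have card_B: "real (card B) \<le> sqrt (2 * sqrt (real n) * log 2 (real n) / \<epsilon>)"
  proof (rule real_le_rsqrt)
    have "0 \<notin> B" using pp by (auto simp: B_def)
    hence "card B ^ 2 \<le> 2 * \<Sum>B" using GB by (intro sum_ge_card_squared)
    hence "real (card B ^ 2) \<le> real (2 * \<Sum>B)" by (simp only: of_nat_le_iff)
    hence "real (card B) ^ 2 \<le> 2 * (\<Sum>p\<in>B. real p)"
      by (simp only: of_nat_power of_nat_mult of_nat_sum of_nat_numeral)
    also have "\<dots> \<le> 2 * (\<Sum>p\<in>B. real (t p) / \<epsilon>)"
      using eps by (intro mult_left_mono sum_mono) (auto simp: B_def field_simps)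
    also have "\<dots> = 2 / \<epsilon> * (\<Sum>p\<in>B. real (t p))" by (simp flip: sum_divide_distrib)
    also have "(\<Sum>p\<in>B. real (t p)) \<le> sqrt (real n) * log 2 (real n)"
    proof -
      have "(\<Sum>p\<in>B. t p) = (\<Sum>p\<in>B. \<Sum>i\<in>I. of_bool (p dvd \<pi> i))"
        unfolding t_def using I by (simp add: Int_def)
      also have "\<dots> = (\<Sum>i\<in>I. \<Sum>p\<in>B. of_bool (p dvd \<pi> i))" by (rule sum.swap)
      also have "\<dots> = (\<Sum>i\<in>I. card {p\<in>B. p dvd \<pi> i})" using GB by (simp add: Int_def)
      finally have "(\<Sum>p\<in>B. real (t p)) = (\<Sum>i\<in>I. real (card {p\<in>B. p dvd \<pi> i}))" by (simp only: of_nat_sum[symmetric])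
      also have "\<dots> \<le> (\<Sum>i\<in>I. log 2 (real n))"
      proof (rule sum_mono)
        fix i assume i: "i \<in> I"
        have "{p\<in>B. p dvd \<pi> i} \<subseteq> prime_factors (\<pi> i)" using pos[OF i] Q(2) by (auto simp: B_def prime_factors_dvd)
        hence "card {p\<in>B. p dvd \<pi> i} \<le> card (prime_factors (\<pi> i))" by (intro card_mono) auto
        thus "real (card {p\<in>B. p dvd \<pi> i}) \<le> log 2 (real n)"
          using card_prime_factors_le[OF pos[OF i] le_n[OF i]] by linarith
      qed
      also have "\<dots> = real (card I) * log 2 (real n)" by simp
      also have "\<dots> \<le> sqrt (real n) * log 2 (real n)" using card_I lg by (intro mult_right_mono) auto
      finally show ?thesis .
    qed
    finally show "real (card B) ^ 2 \<le> 2 * sqrt (real n) * log 2 (real n) / \<epsilon>"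
      using eps by (simp add: mult_left_mono divide_right_mono mult.assoc)
  qed
  \<comment> \<open>The good prime powers credited to \<open>i\<close>. Each prime is credited once,
    which makes the \<open>q i\<close> coprime.\<close>
  define q where "q i = (\<Prod>p\<in>{p\<in>G. c p = i}. p ^ multiplicity p (\<pi> i))" for i
  have ppG: "p > 0" if "p \<in> G" for p using that pp by (auto simp: G_def)
  have q0: "q i > 0" for i unfolding q_def using ppG by (intro prod_pos) auto
  have cop: "coprime (q i) (q j)" if "i \<noteq> j" for i j
    unfolding q_def
  proof (intro prod_coprime_left prod_coprime_right)
    fix p r assume "p \<in> {p\<in>G. c p = i}" "r \<in> {p\<in>G. c p = j}"
    hence "p \<noteq> r" "prime p" "prime r" using that Q by (auto simp: G_def)
    thus "coprime (p ^ multiplicity p (\<pi> i)) (r ^ multiplicity r (\<pi> j))"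
      by (simp add: primes_coprime)
  qed
  have "(\<Sum>i\<in>I. ln (real (q i))) = (\<Sum>i\<in>I. \<Sum>p\<in>{p\<in>G. c p = i}. ln (real (p ^ a p)))"
  proof (intro sum.cong refl)
    fix i
    have "ln (real (q i)) = (\<Sum>p\<in>{p\<in>G. c p = i}. ln (real (p ^ multiplicity p (\<pi> i))))"
      unfolding q_def of_nat_prod using ppG GB(3) by (subst ln_prod) auto
    also have "\<dots> = (\<Sum>p\<in>{p\<in>G. c p = i}. ln (real (p ^ a p)))" using c(2) by (intro sum.cong) auto
    finally show "ln (real (q i)) = \<dots>" .
  qed
  also have "\<dots> = (\<Sum>p\<in>G. ln (real (p ^ a p)))" using GB I c(1) by (intro sum.group) auto
  finally have lnq: "(\<Sum>i\<in>I. ln (real (q i))) = (\<Sum>p\<in>G. ln (real (p ^ a p)))" .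
  have "(\<Sum>p\<in>Q. ln (real (p ^ a p))) = (\<Sum>p\<in>G. ln (real (p ^ a p))) + (\<Sum>p\<in>B. ln (real (p ^ a p)))"
    using GB by (simp add: sum.union_disjoint)
  moreover have "(\<Sum>p\<in>B. ln (real (p ^ a p))) \<le> real (card B) * ln (real n)"
    using ln_pa by (intro sum_bounded_above) (auto simp: B_def)
  moreover have "real (card B) * ln (real n) \<le> sqrt (2 * sqrt (real n) * log 2 (real n) / \<epsilon>) * ln (real n)"
    using card_B n0 by (intro mult_right_mono) auto
  ultimately have main: "ln (real N) \<le> (\<Sum>i\<in>I. ln (real (q i))) + sqrt (2 * sqrt (real n) * log 2 (real n) / \<epsilon>) * ln (real n)"
    using lnN lnq by linarith
  define \<eta> where "\<eta> = \<epsilon> * log 2 (real n)"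
  have eta: "\<eta> < 1" using eps by (simp add: \<eta>_def)
  \<comment> \<open>A period has at most \<open>log 2 n\<close> primes, so by Bernoulli's inequality
    the factor \<open>(1 - \<epsilon>)\<close> raised to their number is at least
    \<open>1 - \<eta>\<close>.\<close>
  have "(1 - \<eta>) * (\<Sum>i\<in>I. real (q i) / real (\<pi> i)) \<le> (\<Sum>i\<in>I. (1 - \<epsilon>) ^ card {p\<in>G. c p = i} * real (q i) / real (\<pi> i))"
    unfolding sum_distrib_left
  proof (rule sum_mono)
    fix i assume i: "i \<in> I"
    have "{p\<in>G. c p = i} \<subseteq> prime_factors (\<pi> i)"
      using cdvd pos[OF i] Q(2) by (auto simp: G_def prime_factors_dvd)
    hence "card {p\<in>G. c p = i} \<le> card (prime_factors (\<pi> i))" by (intro card_mono) auto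
    hence "real (card {p\<in>G. c p = i}) \<le> log 2 (real n)"
      using card_prime_factors_le[OF pos[OF i] le_n[OF i]] by linarith
    hence "1 - \<eta> \<le> 1 + real (card {p\<in>G. c p = i}) * (- \<epsilon>)"
      using eps unfolding \<eta>_def by (simp add: mult.commute mult_left_mono)
    also have "\<dots> \<le> (1 + (- \<epsilon>)) ^ card {p\<in>G. c p = i}" using eps by (intro Bernoulli_inequality) auto
    finally have "(1 - \<eta>) * (real (q i) / real (\<pi> i)) \<le> (1 - \<epsilon>) ^ card {p\<in>G. c p = i} * (real (q i) / real (\<pi> i))"
      by (intro mult_right_mono) auto
    thus "(1 - \<eta>) * (real (q i) / real (\<pi> i)) \<le> (1 - \<epsilon>) ^ card {p\<in>G. c p = i} * real (q i) / real (\<pi> i)" by simp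
  qed
  also have "\<dots> \<le> 1" unfolding q_def
  proof (rule disjoint_progressions_weight[OF I(1) pos disj eps(1,3) GB(3)])
    fix p assume "p \<in> G"
    hence p: "p \<in> Q" "real (t p) \<le> \<epsilon> * real p" by (simp_all add: G_def)
    show "prime p" "c p \<in> I \<and> p dvd \<pi> (c p)" using p Q(2) c(1) cdvd by blast+
    show "real (card {i\<in>I. p dvd \<pi> i}) \<le> \<epsilon> * real p" using p(2) by (simp only: t_def)
  qed
  finally have "(\<Sum>i\<in>I. real (q i) / real (\<pi> i)) \<le> 1 / (1 - \<eta>)" using eta by (simp add: field_simps)
  hence "(\<Sum>i\<in>I. real (q i) / real (\<pi> i)) * (\<Sum>i\<in>I. real (\<pi> i)) \<le> 1 / (1 - \<eta>) * real n"
    using sumn eta by (intro mult_mono) (auto intro!: sum_nonneg)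
  moreover have "(\<Sum>i\<in>I. sqrt (real (q i)))^2 \<le> (\<Sum>i\<in>I. real (q i) / real (\<pi> i)) * (\<Sum>i\<in>I. real (\<pi> i))"
    using pos by (intro sum_sqrt_squared_le) auto
  ultimately have "(\<Sum>i\<in>I. sqrt (real (q i)))^2 \<le> real n / (1 - \<eta>)" by simp
  thus ?thesis using q0 cop main unfolding N_def \<eta>_def by blast
qed

section \<open>Normalisation and the asymptotic upper bound\<close>

definition lo_rate :: "nat \<Rightarrow> real" where
  "lo_rate n = (real n * (ln (real n))^2) powr (1/3)"

lemma lo_rate_cube: "lo_rate n ^ 3 = real n * (ln (real n))^2"
proof -
  have "lo_rate n ^ 3 = lo_rate n powr real 3"
    by (cases "lo_rate n = 0") (auto simp: powr_realpow lo_rate_def simp del: of_nat_numeral)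
  thus ?thesis by (simp add: lo_rate_def powr_powr)
qed

lemma lo_rate_filterlim: "c > 0 \<Longrightarrow> filterlim (\<lambda>n. c * lo_rate n) at_top sequentially"
  unfolding lo_rate_def by real_asymp

lemma lo_rate_pos: "\<forall>\<^sub>F n in sequentially. lo_rate n > 0"
  unfolding lo_rate_def by real_asymp

text \<open>The logarithm of \<open>c * lo_rate n\<close> is asymptotically \<open>ln n / 3\<close>;
  the square of this 3 is the factor 9.\<close>

lemma cube_over_ln_asymp:
  assumes c: "c > 0"
  shows "(\<lambda>n. (c * lo_rate n)^3 / (ln (c * lo_rate n))^2 / real n) \<longlonglongrightarrow> 9 * c^3"
proof -
  have "(\<lambda>n. ln (real n) / ln (c * lo_rate n)) \<longlonglongrightarrow> 3"
    unfolding lo_rate_def using c by real_asymp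
  hence "(\<lambda>n. c^3 * (ln (real n) / ln (c * lo_rate n))^2) \<longlonglongrightarrow> c^3 * 3^2"
    by (intro tendsto_intros)
  moreover have "\<forall>\<^sub>F n in sequentially. c^3 * (ln (real n) / ln (c * lo_rate n))^2 = (c * lo_rate n)^3 / (ln (c * lo_rate n))^2 / real n"
    using eventually_gt_at_top[of 0]
    by eventually_elim (simp add: power_mult_distrib lo_rate_cube power_divide)
  ultimately have "(\<lambda>n. (c * lo_rate n)^3 / (ln (c * lo_rate n))^2 / real n) \<longlonglongrightarrow> c^3 * 3^2"
    by (rule Lim_transform_eventually)
  thus ?thesis by (simp add: mult.commute)
qed

lemma landau_okhotin_attained:
  assumes "n > 0"
  obtains ps where "ps \<in> admissible_arrays n" "landau_okhotin n = Lcm (set ps)"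
proof -
  have "landau_okhotin n \<in> (\<lambda>ps. Lcm (set ps)) ` admissible_arrays n"
    unfolding landau_okhotin_def
    using finite_admissible_arrays admissible_arrays_nonempty[OF assms] by (intro Max_in) auto
  thus ?thesis using that by blast
qed

lemma landau_okhotin_ge: "ps \<in> admissible_arrays n \<Longrightarrow> Lcm (set ps) \<le> landau_okhotin n"
  unfolding landau_okhotin_def using finite_admissible_arrays by (intro Max_ge) auto

lemma landau_okhotin_pos: "n > 0 \<Longrightarrow> landau_okhotin n > 0"
proof -
  assume n: "n > 0"
  then obtain ps where ps: "ps \<in> admissible_arrays n" "landau_okhotin n = Lcm (set ps)"
    by (rule landau_okhotin_attained)
  have "0 \<notin> set ps" using ps by (auto simp: admissible_arrays_def)
  thus ?thesis unfolding ps neq0_conv[symmetric] by (subst Lcm_0_iff) auto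
qed

text \<open>The loss in \<open>coprime_reduction\<close> for
  \<open>\<epsilon> = 1 / (ln n)^2\<close>, left unsimplified so that it matches after unfolding. It
  is of order \<open>n powr (1/4)\<close> up to logarithms.\<close>

definition lo_error :: "nat \<Rightarrow> real" where
  "lo_error n = sqrt (2 * sqrt (real n) * log 2 (real n) / (1 / (ln (real n))^2)) * ln (real n)"

text \<open>If the coprime parts had logarithmic sum at least \<open>x = c * lo_rate n\<close>,
  their square roots would give
  \<open>(2/3 - \<delta>)^2 * x^3 / (ln x)^2 \<le> n * (1 + o(1))\<close>. The left side is about
  \<open>(2/3 - \<delta>)^2 * 9 * c^3 * n\<close>, which for small \<open>\<delta>\<close> is close
  to \<open>4 * c^3 * n\<close> and exceeds \<open>n\<close>.\<close>

lemma ln_landau_okhotin_upper: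
  assumes c: "c > 0" "c^3 > 1/4"
  shows "\<forall>\<^sub>F n in sequentially. ln (real (landau_okhotin n)) \<le> c * lo_rate n + lo_error n"
proof -
  have "((\<lambda>\<delta>::real. (2/3 - \<delta>)^2 * (9 * c^3)) \<longlongrightarrow> (2/3 - 0)^2 * (9 * c^3)) (at_right 0)"
    by (intro tendsto_intros)
  hence "\<forall>\<^sub>F \<delta> in at_right 0. (2/3 - \<delta>)^2 * (9 * c^3) > 1"
    by (rule order_tendstoD) (use c in \<open>simp add: power2_eq_square\<close>)
  moreover have "\<forall>\<^sub>F \<delta>::real in at_right 0. \<delta> \<in> {0<..<1/3}" by (rule eventually_at_right_real) simp
  ultimately have "\<forall>\<^sub>F \<delta> in at_right 0. (2/3 - \<delta>)^2 * (9 * c^3) > 1 \<and> \<delta> \<in> {0<..<1/3}" by eventually_elim auto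
  from eventually_happens[OF this] obtain \<delta> :: real
    where d: "(2/3 - \<delta>)^2 * (9 * c^3) > 1" "\<delta> > 0" "\<delta> < 1/3" by auto
  \<comment> \<open>Small enough that \<open>\<epsilon> n * log 2 n\<close> tends to 0, so the
    density bound is asymptotically sharp, yet only a power of the logarithm, so that few primes are
    lost.\<close>
  define \<epsilon> where "\<epsilon> n = 1 / (ln (real n))^2" for n :: nat
  define x where "x n = c * lo_rate n" for n
  have xlim: "filterlim x at_top sequentially" unfolding x_def by (rule lo_rate_filterlim[OF c(1)])
  have E1: "\<forall>\<^sub>F n in sequentially. \<forall>(I :: nat set) (q :: nat \<Rightarrow> nat). finite I \<longrightarrow> (\<forall>i\<in>I. q i > 1) \<longrightarrow>
      (\<forall>i\<in>I. \<forall>j\<in>I. i \<noteq> j \<longrightarrow> coprime (q i) (q j)) \<longrightarrow> (\<Sum>i\<in>I. ln (q i)) \<ge> x n \<longrightarrow>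
      (\<Sum>i\<in>I. sqrt (q i)) \<ge> (2/3 - \<delta>) * (x n * sqrt (x n) / ln (x n))"
    by (rule eventually_compose_filterlim[OF sum_sqrt_coprime_asymp[OF d(2)] xlim])
  have "(\<lambda>n. (2/3 - \<delta>)^2 * (x n ^ 3 / (ln (x n))^2 / real n) * (1 - \<epsilon> n * log 2 (real n))) \<longlonglongrightarrow> (2/3 - \<delta>)^2 * (9 * c^3) * (1 - 0)"
  proof (intro tendsto_mult tendsto_const tendsto_diff)
    show "(\<lambda>n. x n ^ 3 / (ln (x n))^2 / real n) \<longlonglongrightarrow> 9 * c^3"
      unfolding x_def by (rule cube_over_ln_asymp[OF c(1)])
    show "(\<lambda>n. \<epsilon> n * log 2 (real n)) \<longlonglongrightarrow> 0" unfolding \<epsilon>_def by real_asymp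
  qed
  hence E2: "\<forall>\<^sub>F n in sequentially. (2/3 - \<delta>)^2 * (x n ^ 3 / (ln (x n))^2 / real n) * (1 - \<epsilon> n * log 2 (real n)) > 1"
    using d by (intro order_tendstoD) auto
  have E3: "\<forall>\<^sub>F n in sequentially. \<epsilon> n > 0 \<and> \<epsilon> n < 1 \<and> \<epsilon> n * log 2 (real n) < 1"
    unfolding \<epsilon>_def by (intro eventually_conj) real_asymp+
  have E4: "\<forall>\<^sub>F n in sequentially. x n > 1" using xlim by (simp add: filterlim_at_top_dense)
  show ?thesis using E1 E2 E3 E4 eventually_gt_at_top[of 0]
  proof eventually_elim
    case (elim n)
    obtain ps where ps: "ps \<in> admissible_arrays n" "landau_okhotin n = Lcm (set ps)"
      by (rule landau_okhotin_attained[OF elim(5)])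
    obtain f where f: "disjoint_family_on (\<lambda>i. arith_prog (f i) (ps ! i)) {..<length ps}"
      using ps by (auto simp: admissible_arrays_def disjoint_realizable_def)
    define I where "I = {..<length ps}"
    have I: "finite I" "I \<noteq> {}" using ps by (auto simp: I_def admissible_arrays_def)
    have set: "(\<lambda>i. ps ! i) ` I = set ps" by (auto simp: I_def set_conv_nth)
    have pos: "ps ! i > 0" if "i \<in> I" for i using ps that by (auto simp: I_def admissible_arrays_def)
    have sum: "(\<Sum>i\<in>I. ps ! i) \<le> n"
      using ps by (auto simp: I_def admissible_arrays_def sum_list_sum_nth atLeast0LessThan)
    obtain q where q: "\<forall>i\<in>I. q i > 0" "\<forall>i\<in>I. \<forall>j\<in>I. i \<noteq> j \<longrightarrow> coprime (q i) (q j)"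
      "(\<Sum>i\<in>I. sqrt (real (q i)))^2 \<le> real n / (1 - \<epsilon> n * log 2 (real n))"
      "ln (real (Lcm ((\<lambda>i. ps ! i) ` I))) \<le> (\<Sum>i\<in>I. ln (real (q i))) + sqrt (2 * sqrt (real n) * log 2 (real n) / \<epsilon> n) * ln (real n)"
      using coprime_reduction[OF I pos sum f[folded I_def], of "\<epsilon> n"] elim(3) by auto
    have "(\<Sum>i\<in>I. ln (real (q i))) < x n"
    proof (rule ccontr)
      assume nlt: "\<not> (\<Sum>i\<in>I. ln (real (q i))) < x n"
      \<comment> \<open>Indices with \<open>q i = 1\<close> add nothing to the logarithmic sum and
        are removed to meet the hypothesis \<open>q i > 1\<close>.\<close>
      define I' where "I' = {i\<in>I. q i > 1}"
      have "(\<Sum>i\<in>I'. ln (real (q i))) = (\<Sum>i\<in>I. ln (real (q i)))"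
        unfolding I'_def using I q(1)
        by (intro sum.mono_neutral_left) (auto simp: not_less le_Suc_eq)
      hence "(\<Sum>i\<in>I'. ln (real (q i))) \<ge> x n" using nlt by simp
      moreover have "finite I'" "\<forall>i\<in>I'. q i > 1" "\<forall>i\<in>I'. \<forall>j\<in>I'. i \<noteq> j \<longrightarrow> coprime (q i) (q j)"
        using I q(2) by (auto simp: I'_def)
      ultimately have "(2/3 - \<delta>) * (x n * sqrt (x n) / ln (x n)) \<le> (\<Sum>i\<in>I'. sqrt (q i))"
        using elim(1) by blast
      also have "\<dots> \<le> (\<Sum>i\<in>I. sqrt (q i))" using I by (intro sum_mono2) (auto simp: I'_def)
      finally have "((2/3 - \<delta>) * (x n * sqrt (x n) / ln (x n)))^2 \<le> (\<Sum>i\<in>I. sqrt (q i))^2"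
        using d elim(4) by (intro power_mono mult_nonneg_nonneg divide_nonneg_nonneg) auto
      also note q(3)
      also have "((2/3 - \<delta>) * (x n * sqrt (x n) / ln (x n)))^2 = (2/3 - \<delta>)^2 * (x n ^ 3 / (ln (x n))^2)"
        using elim(4) by (simp add: power_mult_distrib power_divide power3_eq_cube power2_eq_square)
      finally have "(2/3 - \<delta>)^2 * (x n ^ 3 / (ln (x n))^2) * (1 - \<epsilon> n * log 2 (real n)) \<le> real n"
        using elim(3) by (simp add: pos_le_divide_eq)
      hence "(2/3 - \<delta>)^2 * (x n ^ 3 / (ln (x n))^2) * (1 - \<epsilon> n * log 2 (real n)) / real n \<le> 1"
        using elim(5) by (subst divide_le_eq_1_pos) simp_all
      moreover have "(2/3 - \<delta>)^2 * (x n ^ 3 / (ln (x n))^2 / real n) * (1 - \<epsilon> n * log 2 (real n)) =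
          (2/3 - \<delta>)^2 * (x n ^ 3 / (ln (x n))^2) * (1 - \<epsilon> n * log 2 (real n)) / real n" by simp
      ultimately show False using elim(2) by linarith
    qed
    thus ?case using q(4) unfolding set ps(2)[symmetric] x_def lo_error_def \<epsilon>_def by linarith
  qed
qed

lemma lo_error_asymp: "(\<lambda>n. lo_error n / lo_rate n) \<longlonglongrightarrow> 0"
  unfolding lo_error_def lo_rate_def by real_asymp

section \<open>The lower bound\<close>

lemma not_arith_prog_inter:
  assumes "z \<in> arith_prog a m" "z \<in> arith_prog b n" "int d dvd int m" "int d dvd int n"
  shows "[a = b] (mod int d)"
proof -
  obtain u v where "z = a + int m * u" "z = b + int n * v"
    using assms(1,2) unfolding arith_prog_def by blast
  hence "a - b = int n * v - int m * u" by simp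
  moreover have "int d dvd int n * v - int m * u" using assms by auto
  ultimately show ?thesis by (simp add: cong_iff_dvd_diff)
qed

text \<open>
  The construction: the residue classes modulo \<open>B\<close> are distributed among the blocks, block \<open>j\<close>
  receiving \<open>b j\<close> of them, and each class is split further into enough classes for the
  elements of the block.
\<close>
lemma block_progressions_disjoint:
  fixes S :: "'b \<Rightarrow> nat set" and b :: "'b \<Rightarrow> nat" and j :: "nat \<Rightarrow> 'b"
  assumes K: "finite K" "\<And>k. k \<in> K \<Longrightarrow> finite (S k)" "\<And>k. k \<in> K \<Longrightarrow> b k > 0"
    and B: "B = (\<Sum>k\<in>K. b k)"
    and j: "\<And>p. p \<in> U \<Longrightarrow> j p \<in> K \<and> p \<in> S (j p)"
  shows "\<exists>f. disjoint_family_on (\<lambda>p. arith_prog (f p) (B * (card (S (j p)) div b (j p) + 1) * p)) U"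
proof -
  have "\<exists>h. bij_betw h (S k) {0..<card (S k)}" if "k \<in> K" for k
    using ex_bij_betw_finite_nat[OF K(2)[OF that]] by blast
  then obtain h where h: "\<And>k. k \<in> K \<Longrightarrow> bij_betw (h k) (S k) {0..<card (S k)}" by metis
  \<comment> \<open>Slots \<open>(k, r)\<close> with \<open>r < b k\<close>. There are
    \<open>B\<close> of them, and \<open>e\<close> numbers them by the residue classes modulo
    \<open>B\<close>.\<close>
  define Z where "Z = (SIGMA k:K. {0..<b k})"
  have "finite Z" "card Z = B" using K by (auto simp: Z_def B card_SigmaI)
  then obtain e where e: "bij_betw e Z {0..<B}" using ex_bij_betw_finite_nat by metis
  define i where "i p = h (j p) p" for p
  define cl where "cl p = e (j p, i p mod b (j p))" for p
  \<comment> \<open>The element of index \<open>i p\<close> in its block takes the slot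
    \<open>i p mod b\<close>, and within that class modulo \<open>B\<close> the subclass
    \<open>i p div b\<close>. Since \<open>i p < card (S k)\<close>, the
    \<open>card (S k) div b k + 1\<close> subclasses suffice.\<close>
  define f where "f p = int (cl p + B * (i p div b (j p)))" for p
  define m where "m k = B * (card (S k) div b k + 1)" for k
  have inZ: "(j p, i p mod b (j p)) \<in> Z" if "p \<in> U" for p
    using j[OF that] K by (auto simp: Z_def)
  have cl: "cl p < B" if "p \<in> U" for p
    using bij_betwE[OF e] inZ[OF that] by (auto simp: cl_def)
  have f_lt: "f p < int (m (j p))" "f p \<ge> 0" if p: "p \<in> U" for p
  proof -
    have "i p < card (S (j p))" using bij_betwE[OF h] j[OF p] by (auto simp: i_def)
    hence "i p div b (j p) \<le> card (S (j p)) div b (j p)" by (intro div_le_mono) simp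
    hence "B * (i p div b (j p)) \<le> B * (card (S (j p)) div b (j p))" by (rule mult_le_mono2)
    moreover have "m (j p) = B * (card (S (j p)) div b (j p)) + B" by (simp add: m_def)
    ultimately have "cl p + B * (i p div b (j p)) < m (j p)" using cl[OF p] by linarith
    thus "f p < int (m (j p))" "f p \<ge> 0" unfolding f_def by (simp_all only: of_nat_less_iff of_nat_0_le_iff)
  qed
  have "disjoint_family_on (\<lambda>p. arith_prog (f p) (m (j p) * p)) U"
    unfolding disjoint_family_on_def
  proof (intro ballI impI, rule ccontr)
    fix p r assume pr: "p \<in> U" "r \<in> U" "p \<noteq> r"
      and ne: "arith_prog (f p) (m (j p) * p) \<inter> arith_prog (f r) (m (j r) * r) \<noteq> {}"
    then obtain z where z: "z \<in> arith_prog (f p) (m (j p) * p)" "z \<in> arith_prog (f r) (m (j r) * r)" by blast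
    \<comment> \<open>A common element is first compared modulo \<open>B\<close>, which identifies
      the slot and hence the block. Only then are the moduli \<open>m\<close> known to agree, and
      comparing modulo \<open>m\<close> identifies the subclass.\<close>
    have "[f p = f r] (mod int B)" by (rule not_arith_prog_inter[OF z]) (auto simp: m_def)
    hence "[int (cl p) = int (cl r)] (mod int B)" by (simp add: f_def cong_def)
    hence "cl p = cl r" using cl[OF pr(1)] cl[OF pr(2)] by (simp add: cong_def)
    hence "(j p, i p mod b (j p)) = (j r, i r mod b (j r))"
      unfolding cl_def using inZ pr by (intro inj_onD[OF bij_betw_imp_inj_on[OF e]]) auto
    hence jeq: "j p = j r" and imod: "i p mod b (j p) = i r mod b (j p)" by auto
    have "[f p = f r] (mod int (m (j p)))"
      by (rule not_arith_prog_inter[OF z]) (simp_all add: jeq)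
    hence "f p = f r" using f_lt[OF pr(1)] f_lt[OF pr(2)] by (simp add: cong_def jeq)
    hence "B * (i p div b (j p)) = B * (i r div b (j p))" using \<open>cl p = cl r\<close> unfolding f_def jeq by linarith
    hence "i p div b (j p) = i r div b (j p)" using cl[OF pr(1)] by simp
    hence "i p = i r" using imod by (metis div_mult_mod_eq)
    hence "p = r" using inj_onD[OF bij_betw_imp_inj_on[OF h], of "j p" p r] j[OF pr(1)] j[OF pr(2)] jeq
      by (auto simp: i_def)
    thus False using pr by simp
  qed
  thus ?thesis unfolding m_def by blast
qed

lemma prime_family_le_landau_okhotin:
  fixes m :: "nat \<Rightarrow> nat"
  assumes U: "finite U" "U \<noteq> {}" "\<And>p. p \<in> U \<Longrightarrow> prime p" and m: "\<And>p. p \<in> U \<Longrightarrow> m p > 0"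
    and f: "disjoint_family_on (\<lambda>p. arith_prog (f p) (m p * p)) U" and n: "(\<Sum>p\<in>U. m p * p) \<le> n"
  shows "(\<Sum>p\<in>U. ln (real p)) \<le> ln (real (landau_okhotin n))"
proof -
  obtain xs where xs: "set xs = U" "distinct xs" using finite_distinct_list[OF U(1)] by blast
  define ps where "ps = map (\<lambda>p. m p * p) xs"
  have pp: "p > 0" if "p \<in> U" for p using U(3)[OF that] prime_gt_0_nat by blast
  have pos: "\<forall>p\<in>set ps. 0 < p" using xs m pp by (auto simp: ps_def)
  have "disjoint_family_on (\<lambda>i. arith_prog (f (xs ! i)) (ps ! i)) {..<length ps}"
    unfolding disjoint_family_on_def
  proof (intro ballI impI)
    fix i k assume ik: "i \<in> {..<length ps}" "k \<in> {..<length ps}" "i \<noteq> k"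
    hence "xs ! i \<noteq> xs ! k" "xs ! i \<in> U" "xs ! k \<in> U"
      using xs by (auto simp: ps_def nth_eq_iff_index_eq)
    thus "arith_prog (f (xs ! i)) (ps ! i) \<inter> arith_prog (f (xs ! k)) (ps ! k) = {}"
      using f ik by (simp add: disjoint_family_on_def ps_def)
  qed
  hence "disjoint_realizable ps" unfolding disjoint_realizable_def by (intro exI[of _ "\<lambda>i. f (xs ! i)"])
  moreover have "sum_list ps \<le> n"
    using n xs by (simp add: ps_def sum_list_distinct_conv_sum_set)
  moreover have "ps \<noteq> []" using xs U by (auto simp: ps_def)
  ultimately have adm: "ps \<in> admissible_arrays n" using pos by (simp add: admissible_arrays_def)
  have L0: "Lcm (set ps) > 0" using pos unfolding neq0_conv[symmetric] by (subst Lcm_0_iff) auto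
  have "\<Prod>U dvd Lcm (set ps)"
  proof -
    have dvd: "p dvd Lcm (set ps)" if "p \<in> U" for p
    proof -
      have "m p * p dvd Lcm (set ps)" using that xs by (intro dvd_Lcm) (auto simp: ps_def)
      thus ?thesis using dvd_mult_right by blast
    qed
    have "finite V \<Longrightarrow> V \<subseteq> U \<Longrightarrow> \<Prod>V dvd Lcm (set ps)" for V
    proof (induction V rule: finite_induct)
      case (insert p V)
      have "coprime p (\<Prod>V)"
        using insert U(3) by (intro prod_coprime_right primes_coprime) auto
      thus ?case using insert dvd by (simp add: divides_mult)
    qed simp
    thus ?thesis using U(1) by blast
  qed
  hence "\<Prod>U \<le> landau_okhotin n"
    using L0 landau_okhotin_ge[OF adm] by (meson dvd_imp_le order_trans)
  moreover have "\<Prod>U > 0" using pp by (intro prod_pos) auto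
  ultimately have "ln (real (\<Prod>U)) \<le> ln (real (landau_okhotin n))" by (intro ln_mono) (simp_all del: of_nat_prod)
  moreover have "ln (real (\<Prod>U)) = (\<Sum>p\<in>U. ln (real p))"
    unfolding of_nat_prod using U(1) pp by (subst ln_prod) auto
  ultimately show ?thesis by simp
qed

text \<open>The optimal share of residue classes for a block is proportional to its sum of
  \<open>sqrt p\<close>. Block \<open>j\<close> has a number of primes proportional to
  \<open>2 * j - 1\<close>, and their square roots are about proportional to
  \<open>j\<close>.\<close>

definition block_weight :: "nat \<Rightarrow> nat" where
  "block_weight j = (2 * j - 1) * j"

text \<open>The final -1 removes the weight 1 of the omitted block 1. Divided by \<open>J^3\<close>
  the sum tends to \<open>2/3\<close>, the same constant as in
  \<open>sum_sqrt_primes_ge\<close>.\<close>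

lemma sum_block_weight:
  assumes "J \<ge> 1"
  shows "real (\<Sum>j=2..J. block_weight j) = real J * (real J + 1) * (4 * real J - 1) / 6 - 1"
  using assms
proof (induction J rule: dec_induct)
  case (step n)
  have "(\<Sum>j=2..Suc n. block_weight j) = (\<Sum>j=2..n. block_weight j) + (2 * n + 1) * (n + 1)"
    using step by (simp add: block_weight_def)
  thus ?case using step by (simp add: field_simps)
qed simp

lemma sum_block_length:
  assumes "J \<ge> 1"
  shows "(\<Sum>j=2..J. real (2 * j - 1)) = real J ^ 2 - 1"
  using assms by (induction J rule: dec_induct) (auto simp: power2_eq_square algebra_simps of_nat_diff)

definition block_theta :: "real \<Rightarrow> nat \<Rightarrow> nat \<Rightarrow> real" where
  "block_theta x J j = (\<Sum>p\<in>prime_block x J j. ln (real p))"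

text \<open>Bounds the number of primes in a block with \<open>j \<ge> 2\<close>: each of them
  exceeds \<open>x / J^2\<close>, so its logarithm is at least the denominator.\<close>

definition block_bound :: "real \<Rightarrow> nat \<Rightarrow> nat \<Rightarrow> real" where
  "block_bound x J j = block_theta x J j / ln (x * (1 / real J)^2)"

text \<open>Bounds the total length of the construction: number of primes, times multiplier, times
  largest possible prime of the block. The \<open>+ 1\<close> is the one of
  \<open>card (S k) div b k + 1\<close> in \<open>block_progressions_disjoint\<close>.\<close>

definition block_cost :: "real \<Rightarrow> nat \<Rightarrow> real" where
  "block_cost x J = (\<Sum>j=2..J. block_bound x J j *
     (real (\<Sum>i=2..J. block_weight i) * (block_bound x J j / real (block_weight j) + 1)) * (x * (real j / real J)^2))"

lemma card_prime_block_le: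
  assumes "x * (1 / real J)^2 > 1" "j \<ge> 2"
  shows "real (card (prime_block x J j)) \<le> block_bound x J j"
proof -
  have x: "x \<ge> 0" using assms(1) by (metis less_eq_real_def mult_nonpos_nonneg not_le order_trans zero_le_one zero_le_power2)
  have "real (card (prime_block x J j)) * ln (x * (1 / real J)^2) \<le> block_theta x J j"
    unfolding block_theta_def
  proof (rule sum_bounded_below)
    fix p assume "p \<in> prime_block x J j"
    hence "x * (real (j - 1) / real J)^2 < real p" by (simp add: prime_block_def)
    moreover have "x * (1 / real J)^2 \<le> x * (real (j - 1) / real J)^2"
      using assms x by (intro mult_left_mono power_mono divide_right_mono) auto
    ultimately show "ln (x * (1 / real J)^2) \<le> ln (real p)" using assms by (intro ln_mono) linarith+
  qed
  thus ?thesis unfolding block_bound_def using assms by (simp add: pos_le_divide_eq)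
qed

text \<open>The number of primes in block \<open>j\<close> enters squared and one factor
  \<open>block_weight j = (2 * j - 1) * j\<close> is divided out, so the summand has limit
  \<open>B * block_weight j / J^6\<close> and the total is \<open>B^2 / J^6\<close>. The rounding
  term \<open>+ 1\<close> becomes \<open>ln x / x\<close> and disappears.\<close>

lemma block_cost_asymp:
  assumes J: "J \<ge> 2"
  shows "((\<lambda>x. block_cost x J / (x^3 / (ln x)^2)) \<longlongrightarrow> real (\<Sum>j=2..J. block_weight j) ^ 2 / real J ^ 6) at_top"
proof -
  define B where "B = real (\<Sum>j=2..J. block_weight j)"
  define u where "u j x = block_theta x J j / x * (ln x / ln (x * (1 / real J)^2))" for j x
  have ulim: "(u j \<longlongrightarrow> real (2 * j - 1) / real J ^ 2 * 1) at_top" if "j \<in> {2..J}" for j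
    unfolding u_def
  proof (rule tendsto_mult)
    show "((\<lambda>x. block_theta x J j / x) \<longlongrightarrow> real (2 * j - 1) / real J ^ 2) at_top"
      unfolding block_theta_def using that J by (intro prime_block_theta_asymp) auto
    show "((\<lambda>x. ln x / ln (x * (1 / real J)^2)) \<longlongrightarrow> 1) at_top" using J by real_asymp
  qed
  have l0: "((\<lambda>x::real. ln x / x) \<longlongrightarrow> 0) at_top" by real_asymp
  have "((\<lambda>x. \<Sum>j=2..J. u j x * (B * (u j x / real (block_weight j) + ln x / x)) * (real j / real J)^2) \<longlongrightarrow>
      (\<Sum>j=2..J. (real (2 * j - 1) / real J ^ 2 * 1) * (B * ((real (2 * j - 1) / real J ^ 2 * 1) / real (block_weight j) + 0)) * (real j / real J)^2)) at_top"
    by (intro tendsto_sum tendsto_mult tendsto_add tendsto_const tendsto_divide l0 ulim) (auto simp: block_weight_def)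
  also have "(\<Sum>j=2..J. (real (2 * j - 1) / real J ^ 2 * 1) * (B * ((real (2 * j - 1) / real J ^ 2 * 1) / real (block_weight j) + 0)) * (real j / real J)^2)
     = (\<Sum>j=2..J. B * real (block_weight j) / real J ^ 6)"
  proof (intro sum.cong refl)
    fix j assume j: "j \<in> {2..J}"
    define t where "t = real (2 * j - 1)"
    have "t \<noteq> 0" "real j \<noteq> 0" "real J \<noteq> 0" using j by (auto simp: t_def)
    thus "(real (2 * j - 1) / real J ^ 2 * 1) * (B * ((real (2 * j - 1) / real J ^ 2 * 1) / real (block_weight j) + 0)) * (real j / real J)^2
      = B * real (block_weight j) / real J ^ 6"
      unfolding block_weight_def of_nat_mult t_def[symmetric] by (simp add: divide_simps eval_nat_numeral)
  qed
  also have "\<dots> = B ^ 2 / real J ^ 6"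
    unfolding B_def by (simp add: sum_divide_distrib[symmetric] sum_distrib_left[symmetric] power2_eq_square)
  finally have "((\<lambda>x. \<Sum>j=2..J. u j x * (B * (u j x / real (block_weight j) + ln x / x)) * (real j / real J)^2) \<longlongrightarrow> B ^ 2 / real J ^ 6) at_top" .
  moreover have "\<forall>\<^sub>F x in at_top. (\<Sum>j=2..J. u j x * (B * (u j x / real (block_weight j) + ln x / x)) * (real j / real J)^2)
      = block_cost x J / (x^3 / (ln x)^2)"
    using eventually_gt_at_top[of 1]
  proof eventually_elim
    case (elim x)
    have lx: "ln x \<noteq> 0" "x \<noteq> 0" using elim by auto
    have u: "u j x = block_bound x J j * (ln x / x)" for j
      by (simp add: u_def block_bound_def)
    show ?case
      unfolding block_cost_def B_def[symmetric] sum_divide_distrib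
    proof (intro sum.cong refl)
      fix j
      define w k r where "w = real (block_weight j)" and "k = block_bound x J j" and "r = ln x / x"
      have "k * r / w + r = (k / w + 1) * r" by (simp add: algebra_simps)
      hence "k * r * (B * (k * r / w + r)) * (real j / real J)^2 = (k * (B * (k / w + 1)) * (real j / real J)^2) * r^2"
        by (simp only: power2_eq_square mult_ac)
      also have "r^2 = x / (x^3 / (ln x)^2)"
        using lx by (simp add: r_def power_divide power2_eq_square power3_eq_cube)
      finally show "u j x * (B * (u j x / real (block_weight j) + ln x / x)) * (real j / real J)^2 =
        block_bound x J j * (B * (block_bound x J j / real (block_weight j) + 1)) * (x * (real j / real J)^2) / (x^3 / (ln x)^2)"
        unfolding u w_def[symmetric] k_def[symmetric] r_def[symmetric] by (simp add: mult_ac)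
    qed
  qed
  ultimately show ?thesis unfolding B_def by (rule Lim_transform_eventually)
qed

lemma landau_okhotin_ge_blocks:
  assumes J: "J \<ge> 2" and x: "x * (1 / real J)^2 > 1" and n: "n > 0" "block_cost x J \<le> real n"
  shows "(\<Sum>j=2..J. block_theta x J j) \<le> ln (real (landau_okhotin n))"
proof -
  define U where "U = (\<Union>j\<in>{2..J}. prime_block x J j)"
  have x0: "x \<ge> 0" using x by (metis less_eq_real_def mult_nonpos_nonneg not_le order_trans zero_le_one zero_le_power2)
  have U: "finite U" "\<And>p. p \<in> U \<Longrightarrow> prime p"
    unfolding U_def by (blast intro: finite_prime_block) (auto simp: prime_block_def)
  have disj: "prime_block x J i \<inter> prime_block x J j = {}" if "i \<in> {2..J}" "j \<in> {2..J}" "i \<noteq> j" for i j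
    using that x0 by (intro prime_block_disjoint) auto
  have sumU: "(\<Sum>p\<in>U. g p) = (\<Sum>j=2..J. \<Sum>p\<in>prime_block x J j. g p)" for g :: "nat \<Rightarrow> real"
    unfolding U_def using disj by (intro sum.UNION_disjoint) (auto simp: finite_prime_block)
  have "\<exists>j. j \<in> {2..J} \<and> p \<in> prime_block x J j" if "p \<in> U" for p using that by (auto simp: U_def)
  then obtain jj where jj: "\<And>p. p \<in> U \<Longrightarrow> jj p \<in> {2..J} \<and> p \<in> prime_block x J (jj p)" by metis
  have jj_eq: "jj p = j" if "j \<in> {2..J}" "p \<in> prime_block x J j" for p j
  proof (rule ccontr)
    assume "jj p \<noteq> j"
    moreover have "p \<in> U" using that by (auto simp: U_def)
    ultimately show False using disj[of "jj p" j] jj[of p] that by auto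
  qed
  define B where "B = (\<Sum>j=2..J. block_weight j)"
  have B0: "B > 0" unfolding B_def using J
    by (intro sum_pos) (auto simp: block_weight_def)
  define m where "m p = B * (card (prime_block x J (jj p)) div block_weight (jj p) + 1)" for p
  have "\<exists>f. disjoint_family_on (\<lambda>p. arith_prog (f p)
      (B * (card (prime_block x J (jj p)) div block_weight (jj p) + 1) * p)) U"
    by (rule block_progressions_disjoint[where K = "{2..J}"])
       (use jj in \<open>auto simp: finite_prime_block block_weight_def B_def\<close>)
  then obtain f where f: "disjoint_family_on (\<lambda>p. arith_prog (f p) (m p * p)) U" unfolding m_def by blast
  have "(\<Sum>p\<in>U. real (m p * p)) = (\<Sum>j=2..J. \<Sum>p\<in>prime_block x J j. real (m p * p))" by (rule sumU)
  also have "\<dots> \<le> (\<Sum>j=2..J. real (card (prime_block x J j)) * (real B * (block_bound x J j / real (block_weight j) + 1) * (x * (real j / real J)^2)))"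
  proof (intro sum_mono sum_bounded_above)
    fix j p assume j: "j \<in> {2..J}" and p: "p \<in> prime_block x J j"
    have "real (card (prime_block x J j) div block_weight j) \<le> real (card (prime_block x J j)) / real (block_weight j)"
      by (rule of_nat_div_le_of_nat)
    also have "\<dots> \<le> block_bound x J j / real (block_weight j)"
      using card_prime_block_le[OF x, of j] j by (intro divide_right_mono) auto
    finally have "real (m p) \<le> real B * (block_bound x J j / real (block_weight j) + 1)"
      unfolding m_def jj_eq[OF j p] of_nat_mult of_nat_add by (intro mult_left_mono) auto
    moreover have "real p \<le> x * (real j / real J)^2" using p by (simp add: prime_block_def)
    ultimately show "real (m p * p) \<le> real B * (block_bound x J j / real (block_weight j) + 1) * (x * (real j / real J)^2)"
      unfolding of_nat_mult by (intro mult_mono) (auto intro: order_trans[OF of_nat_0_le_iff])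
  qed
  also have "\<dots> \<le> block_cost x J"
    unfolding block_cost_def B_def[symmetric]
  proof (rule sum_mono)
    fix j assume j: "j \<in> {2..J}"
    have k: "real (card (prime_block x J j)) \<le> block_bound x J j" using card_prime_block_le[OF x, of j] j by auto
    hence "block_bound x J j \<ge> 0" by (meson of_nat_0_le_iff order_trans)
    hence "real (card (prime_block x J j)) * (real B * (block_bound x J j / real (block_weight j) + 1) * (x * (real j / real J)^2))
       \<le> block_bound x J j * (real B * (block_bound x J j / real (block_weight j) + 1) * (x * (real j / real J)^2))"
      using k x0 by (intro mult_right_mono mult_nonneg_nonneg) auto
    thus "real (card (prime_block x J j)) * (real B * (block_bound x J j / real (block_weight j) + 1) * (x * (real j / real J)^2))
       \<le> block_bound x J j * (real B * (block_bound x J j / real (block_weight j) + 1)) * (x * (real j / real J)^2)"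
      by (simp only: mult.assoc)
  qed
  also note n(2)
  finally have "real (\<Sum>p\<in>U. m p * p) \<le> real n" by (simp only: of_nat_sum)
  hence cost: "(\<Sum>p\<in>U. m p * p) \<le> n" by (simp only: of_nat_le_iff)
  have "(\<Sum>p\<in>U. ln (real p)) \<le> ln (real (landau_okhotin n))"
  \<comment> \<open>An empty family gives no admissible array; then the left side is 0, and
    positivity of \<open>landau_okhotin n\<close> suffices.\<close>
  proof (cases "U = {}")
    case True
    thus ?thesis using landau_okhotin_pos[OF n(1)] by simp
  next
    case False
    thus ?thesis using U f cost B0 by (intro prime_family_le_landau_okhotin[where m = m]) (auto simp: m_def)
  qed
  thus ?thesis unfolding sumU block_theta_def .
qed

text \<open>The left side of the assumption \<open>less\<close> is the limit of
  \<open>block_cost x J / n\<close> at \<open>x = c * lo_rate n\<close>; being below 1, it makes the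
  construction eventually fit into length \<open>n\<close>.\<close>

lemma ln_landau_okhotin_lower:
  assumes J: "J \<ge> 2" and c: "c > 0" and less: "9 * c^3 * (real (\<Sum>j=2..J. block_weight j) ^ 2 / real J ^ 6) < 1"
  shows "\<forall>\<^sub>F n in sequentially. (\<Sum>j=2..J. block_theta (c * lo_rate n) J j) \<le> ln (real (landau_okhotin n))"
proof -
  define x where "x n = c * lo_rate n" for n
  have xlim: "filterlim x at_top sequentially" unfolding x_def by (rule lo_rate_filterlim[OF c])
  have "(\<lambda>n. block_cost (x n) J / (x n ^ 3 / (ln (x n))^2) * (x n ^ 3 / (ln (x n))^2 / real n)) \<longlonglongrightarrow>
      real (\<Sum>j=2..J. block_weight j) ^ 2 / real J ^ 6 * (9 * c^3)"
    by (intro tendsto_mult filterlim_compose[OF block_cost_asymp[OF J] xlim] cube_over_ln_asymp[OF c, folded x_def])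
  hence "\<forall>\<^sub>F n in sequentially. block_cost (x n) J / (x n ^ 3 / (ln (x n))^2) * (x n ^ 3 / (ln (x n))^2 / real n) < 1"
    using less by (intro order_tendstoD) (auto simp: mult_ac)
  moreover have "filterlim (\<lambda>n. x n * (1 / real J)^2) at_top sequentially"
    using J by (intro filterlim_at_top_mult_tendsto_pos[OF tendsto_const _ xlim]) auto
  hence "\<forall>\<^sub>F n in sequentially. x n * (1 / real J)^2 > 1" by (simp add: filterlim_at_top_dense)
  moreover have "\<forall>\<^sub>F n in sequentially. x n > 1" using xlim by (simp add: filterlim_at_top_dense)
  ultimately show ?thesis using eventually_gt_at_top[of 0] unfolding x_def[symmetric]
  proof eventually_elim
    case (elim n)
    have "ln (x n) \<noteq> 0" "x n \<noteq> 0" using elim(3) by auto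
    hence "block_cost (x n) J / real n < 1" using elim(1) by simp
    hence "block_cost (x n) J \<le> real n" using elim(4) by simp
    thus ?case by (intro landau_okhotin_ge_blocks[OF J elim(2) elim(4)])
  qed
qed

theorem theorem1:
  shows "(\<lambda>n::nat. (ln (real (landau_okhotin n))) ^ 3 / (1 / 4 * real n * (ln (real n)) ^ 2)) \<longlonglongrightarrow> 1"
proof -
  define \<kappa> :: real where "\<kappa> = root 3 (1/4)"
  have k: "\<kappa> > 0" "\<kappa>^3 = 1/4" by (auto simp: \<kappa>_def)
  have "(\<lambda>n. ln (real (landau_okhotin n)) / lo_rate n) \<longlonglongrightarrow> \<kappa>"
  proof (rule order_tendstoI)
    fix a assume a: "\<kappa> < a"
    \<comment> \<open>A midpoint: \<open>c > \<kappa>\<close> is needed for the upper bound, and the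
      remaining gap \<open>a - c\<close> absorbs \<open>lo_error\<close>.\<close>
    define c where "c = (\<kappa> + a) / 2"
    have c: "c > \<kappa>" "c < a" using a by (auto simp: c_def)
    have "c^3 > \<kappa>^3" using c k by (intro power_strict_mono) auto
    hence "\<forall>\<^sub>F n in sequentially. ln (real (landau_okhotin n)) \<le> c * lo_rate n + lo_error n"
      using c k by (intro ln_landau_okhotin_upper) auto
    moreover have "\<forall>\<^sub>F n in sequentially. lo_error n / lo_rate n < a - c"
      using c by (intro order_tendstoD(2)[OF lo_error_asymp]) auto
    ultimately show "\<forall>\<^sub>F n in sequentially. ln (real (landau_okhotin n)) / lo_rate n < a"
      using lo_rate_pos
    proof eventually_elim
      case (elim n)
      have "ln (real (landau_okhotin n)) / lo_rate n \<le> (c * lo_rate n + lo_error n) / lo_rate n"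
        using elim by (intro divide_right_mono) auto
      also have "\<dots> = c + lo_error n / lo_rate n" using elim by (simp add: add_divide_distrib)
      finally show ?case using elim by linarith
    qed
  next
    fix a assume a: "a < \<kappa>"
    \<comment> \<open>The maximum with 0 keeps \<open>c\<close> positive when \<open>a\<close> is
      negative.\<close>
    define c where "c = (max a 0 + \<kappa>) / 2"
    have c: "c > 0" "c < \<kappa>" "c > a" using a k by (auto simp: c_def max_def)
    have "c^3 < \<kappa>^3" using c by (intro power_strict_mono) auto
    hence c3: "c^3 < 1/4" using k by simp
    \<comment> \<open>The limit is \<open>4 * c^3 < 1\<close>, so for large \<open>J\<close> the
      blocks are cheap enough. A second condition on \<open>J\<close> is that discarding block 1, a
      proportion \<open>1 / J^2\<close> of the \<theta>-mass, still leaves more than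
      \<open>a\<close>.\<close>
    have "((\<lambda>J. 9 * c^3 * ((real J * (real J + 1) * (4 * real J - 1) / 6 - 1)^2 / real J ^ 6)) \<longlongrightarrow> 9 * c^3 * (2/3)^2) sequentially"
      by (intro tendsto_mult tendsto_const) real_asymp
    hence "\<forall>\<^sub>F J in sequentially. 9 * c^3 * ((real J * (real J + 1) * (4 * real J - 1) / 6 - 1)^2 / real J ^ 6) < 1"
      by (rule order_tendstoD(2)) (use c3 in \<open>simp add: power2_eq_square\<close>)
    moreover have "(\<lambda>J. c * (1 - 1 / real J ^ 2)) \<longlonglongrightarrow> c * (1 - 0)"
      by (intro tendsto_mult tendsto_const tendsto_diff) real_asymp
    hence "\<forall>\<^sub>F J in sequentially. c * (1 - 1 / real J ^ 2) > a" using c by (intro order_tendstoD) auto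
    ultimately have "\<forall>\<^sub>F J in sequentially. 9 * c^3 * ((real J * (real J + 1) * (4 * real J - 1) / 6 - 1)^2 / real J ^ 6) < 1
       \<and> c * (1 - 1 / real J ^ 2) > a \<and> J \<ge> 2" using eventually_ge_at_top[of 2] by eventually_elim auto
    then obtain J where J: "9 * c^3 * ((real J * (real J + 1) * (4 * real J - 1) / 6 - 1)^2 / real J ^ 6) < 1"
       "c * (1 - 1 / real J ^ 2) > a" "J \<ge> 2" by (auto simp: eventually_sequentially)
    have "\<forall>\<^sub>F n in sequentially. (\<Sum>j=2..J. block_theta (c * lo_rate n) J j) \<le> ln (real (landau_okhotin n))"
      by (rule ln_landau_okhotin_lower[OF J(3) c(1)]) (use J sum_block_weight[of J] in simp)
    moreover have "(\<lambda>n. \<Sum>j=2..J. block_theta (c * lo_rate n) J j / (c * lo_rate n)) \<longlonglongrightarrow> (\<Sum>j=2..J. real (2 * j - 1) / real J ^ 2)"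
      unfolding block_theta_def using J
      by (intro tendsto_sum filterlim_compose[OF prime_block_theta_asymp lo_rate_filterlim[OF c(1)]]) auto
    hence "(\<lambda>n. c * (\<Sum>j=2..J. block_theta (c * lo_rate n) J j / (c * lo_rate n))) \<longlonglongrightarrow> c * (\<Sum>j=2..J. real (2 * j - 1) / real J ^ 2)"
      by (intro tendsto_mult tendsto_const)
    hence "\<forall>\<^sub>F n in sequentially. c * (\<Sum>j=2..J. block_theta (c * lo_rate n) J j / (c * lo_rate n)) > a"
    proof (rule order_tendstoD)
      have "(\<Sum>j=2..J. real (2 * j - 1) / real J ^ 2) = (real J ^ 2 - 1) / real J ^ 2"
        using sum_block_length[of J] J by (simp add: sum_divide_distrib[symmetric])
      also have "\<dots> = 1 - 1 / real J ^ 2" using J by (simp add: diff_divide_distrib)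
      finally show "a < c * (\<Sum>j=2..J. real (2 * j - 1) / real J ^ 2)" using J by simp
    qed
    ultimately show "\<forall>\<^sub>F n in sequentially. ln (real (landau_okhotin n)) / lo_rate n > a"
      using lo_rate_pos
    proof eventually_elim
      case (elim n)
      have "c * (\<Sum>j=2..J. block_theta (c * lo_rate n) J j / (c * lo_rate n)) = (\<Sum>j=2..J. block_theta (c * lo_rate n) J j) / lo_rate n"
        using c by (simp add: sum_divide_distrib[symmetric])
      also have "\<dots> \<le> ln (real (landau_okhotin n)) / lo_rate n" using elim by (intro divide_right_mono) auto
      finally show ?case using elim by linarith
    qed
  qed
  from tendsto_mult[OF tendsto_const[of 4] tendsto_power[OF this, of 3]]
  have "(\<lambda>n. 4 * (ln (real (landau_okhotin n)) / lo_rate n)^3) \<longlonglongrightarrow> 1" using k by simp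
  thus ?thesis by (simp add: power_divide lo_rate_cube mult.commute)
qed

end
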